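(* (i) If $\mathbb{P}\{S_0<\infty\}=1$, then for all $\delta\ge0$ and $x\ge0$, and for $Q_\delta$ as defined in the context, $$\mathcal{B}_Z^\delta(x)=\int_0^\infty\mathbb{P}\left\{\int_{\delta\mathbb{Z}^d}\mathbb{I}(Q_\delta(t)>s)\,\lambda_\delta(dt)>x\right\}\lambda(ds)<\infty .$$ (ii) If $\mathbb{P}\{S_0<\infty\}>0$, let $V$ be a random field whose law is that of $Z$ conditioned on $\{S_0<\infty\}$, multiplied by the positive constant that makes $\mathbb{E}\{V(t)\}=1$ for all $t$; that is, $V$ has the law of $\frac{\mathbb{P}\{S_0<\infty\}}{\mathbb{E}\{Z(0)\mathbb{I}\{S_0<\infty\}\}}\,Z$ conditioned on $\{S_0<\infty\}$. Then for all $\delta\ge0$ and $x\ge0$ $$\mathcal{B}_Z^\delta(x)=\mathbb{P}\{S_0(\Theta)<\infty\}\,\mathcal{B}_V^\delta(x)<\infty .$$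
   Context: Let $d\ge1$. $D$ is the space of generalised c\`adl\`ag functions $f:\mathbb{R}^d\to[0,\infty)$ (limits exist at every point within each of the $2^d$ quadrants, and $f(s)\to f(t)$ as $s\to t$ with $s\ge t$ componentwise), equipped with Skorohod's $J_1$-topology and the $\sigma$-field generated by the projections $f\mapsto f(t)$. The underlying probability space is complete and non-atomic. $Z(t),t\in\mathbb{R}^d$, is a random field with almost all sample paths in $D$ such that $\mathbb{E}\{Z(t)\}=1$ for all $t\in\mathbb{R}^d$, $\mathbb{E}\{\sup_{t\in[0,T]^d}Z(t)\}<\infty$ for all $T>0$, $\mathbb{P}\{\sup_{t\in\mathbb{R}^d}Z(t)>0\}=1$, and $Z$ is a spectral random field of a stationary max-stable random field $X$: the field $X(t)=\max_{i\ge1}\Gamma_i^{-1}Z^{(i)}(t)$, $t\in\mathbb{R}^d$, is stationary, where $\Gamma_i=\sum_{k=1}^i\mathcal{V}_k$, the $\mathcal{V}_k$ are i.i.d. unit exponential, independent of the i.i.d. copies $Z^{(i)}$ of $Z$. With $B^hZ(\cdot)=Z(\cdot-h)$, stationarity of $X$ is equivalent to $\mathbb{E}\{Z(h)F(Z)\}=\mathbb{E}\{Z(0)F(B^hZ)\}$ for all $h\in\mathbb{R}^d$ and all measurable $F:D\to[0,\infty]$ with $F(cf)=F(f)$ for all $f\in D,c>0$. $\mathbb{I}$ denotes an indicator. $\lambda_0=\lambda$ is Lebesgue measure and $0\mathbb{Z}^d:=\mathbb{R}^d$; for $\delta>0$, $\lambda_\delta$ is $\delta^d$ times the counting measure on $\delta\mathbb{Z}^d$.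 Set $S_\delta=S_\delta(Z)=\int_{\delta\mathbb{Z}^d}Z(t)\,\lambda_\delta(dt)$ and similarly $S_\delta(f)$ for other $f$. For the fixed $\delta\ge0$ under consideration $Z$ is chosen so that $S_\delta>0$ almost surely. The Berman function is, for $\delta,x\ge0$ (and similarly for $V$), $$\mathcal{B}_Z^\delta(x)=\lim_{T\to\infty}\frac1{T^d}\int_0^\infty\mathbb{P}\left\{\int_{[0,T]^d\cap\delta\mathbb{Z}^d}\mathbb{I}(Z(t)>s)\,\lambda_\delta(dt)>x\right\}ds .$$ $\Theta$ is a random field with sample paths in $D$ and law $\mu(A)=\mathbb{E}\{Z(0)\mathbb{I}\{Z/Z(0)\in A\}\}$ for measurable $A\subset D$. Definition of $Q_\delta$ (when $\mathbb{P}\{S_0<\infty\}=1$): let $T$ be a random variable with values in $\delta\mathbb{Z}^d$ and density $p(s)>0$, $s\in\delta\mathbb{Z}^d$ (a probability mass function on $\delta\mathbb{Z}^d$ if $\delta>0$; a continuous Lebesgue density on $\mathbb{R}^d$ if $\delta=0$), and let $\bar Q_\delta(t)$, $t\in\delta\mathbb{Z}^d$, be a non-negative random field (with c\`adl\`ag paths if $\delta=0$) independent of $T$ such that $$Z_*(t)=\frac1{p(T)}\,\bar Q_\delta(t-T),\qquad t\in\delta\mathbb{Z}^d,$$ is a spectral random field of the max-stable random field $X_\delta(t)=X(t)$, $t\in\delta\mathbb{Z}^d$. Put $Q_\delta=\bar Q_\delta/c$ with $c=1$ if $\delta=0$ and $c=\delta^d$ if $\delta>0$. (One possible construction is $\bar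 Q_\delta(t)=c\,\Theta(t)/S_\delta(\Theta)$.) *)

theory Defs
  imports "HOL-Probability.Probability"
begin

definition nonatomic :: "'a measure \<Rightarrow> bool" where
  "nonatomic M \<longleftrightarrow> (\<forall>A\<in>sets M. 0 < emeasure M A \<longrightarrow>
     (\<exists>B\<in>sets M. B \<subseteq> A \<and> 0 < emeasure M B \<and> emeasure M B < emeasure M A))"

text \<open>The \<open>2\<^sup>d\<close> quadrants at \<open>t\<close>, one for each set \<open>I\<close> of coordinates in which
  \<open>t\<close> is approached from the right; they partition the whole space.\<close>

definition quadrant :: "'d set \<Rightarrow> real ^ 'd \<Rightarrow> (real ^ 'd) set" where
  "quadrant I t = {s. \<forall>i. if i \<in> I then t $ i \<le> s $ i else s $ i < t $ i}"

definition cadlag :: "(real ^ 'd::finite \<Rightarrow> real) set" where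
  "cadlag = {f. (\<forall>t. 0 \<le> f t) \<and>
     (\<forall>t I. \<exists>l. (f \<longlongrightarrow> l) (at t within quadrant I t)) \<and>
     (\<forall>t. (f \<longlongrightarrow> f t) (at t within {s. \<forall>i. t $ i \<le> s $ i}))}"

text \<open>The set \<open>cadlag\<close> with the \<open>\<sigma>\<close>-field generated by the projections \<open>f \<mapsto> f t\<close>.\<close>

definition cadlag_algebra :: "(real ^ 'd::finite \<Rightarrow> real) measure" where
  "cadlag_algebra = restrict_space (PiM UNIV (\<lambda>_. borel)) cadlag"

definition random_field :: "'w measure \<Rightarrow> 't set \<Rightarrow> ('w \<Rightarrow> 't \<Rightarrow> real) \<Rightarrow> bool" where
  "random_field M I Y \<longleftrightarrow> (\<forall>t\<in>I. (\<lambda>\<omega>. Y \<omega> t) \<in> borel_measurable M)"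

definition cadlag_field :: "'w measure \<Rightarrow> ('w \<Rightarrow> real ^ 'd::finite \<Rightarrow> real) \<Rightarrow> bool" where
  "cadlag_field M Y \<longleftrightarrow> random_field M UNIV Y \<and> (AE \<omega> in M. Y \<omega> \<in> cadlag)"

definition grid :: "real \<Rightarrow> (real ^ 'd) set" where
  "grid \<delta> = (if \<delta> = 0 then UNIV else {t. \<forall>i. \<exists>k::int. t $ i = \<delta> * of_int k})"

definition lam :: "real \<Rightarrow> (real ^ 'd::finite) measure" where
  "lam \<delta> = (if \<delta> = 0 then lborel
     else scale_measure (ennreal (\<delta> ^ CARD('d))) (count_space (grid \<delta>)))"

definition total_mass :: "real \<Rightarrow> (real ^ 'd::finite \<Rightarrow> real) \<Rightarrow> ennreal" where
  "total_mass \<delta> f = (\<integral>\<^sup>+t. ennreal (f t) \<partial>lam \<delta>)"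

definition cube :: "real \<Rightarrow> (real ^ 'd) set" where
  "cube T = {t. \<forall>i. 0 \<le> t $ i \<and> t $ i \<le> T}"

definition excursion :: "real \<Rightarrow> (real ^ 'd::finite) set \<Rightarrow> (real ^ 'd \<Rightarrow> real) \<Rightarrow> real \<Rightarrow> ennreal" where
  "excursion \<delta> A f s = (\<integral>\<^sup>+t\<in>A \<inter> grid \<delta>. indicator {t. f t > s} t \<partial>lam \<delta>)"

definition berman_mean ::
    "'w measure \<Rightarrow> ('w \<Rightarrow> real ^ 'd::finite \<Rightarrow> real) \<Rightarrow> real \<Rightarrow> real \<Rightarrow> real \<Rightarrow> ennreal" where
  "berman_mean M Z \<delta> x T =
     (\<integral>\<^sup>+s\<in>{0..}. ennreal (\<P>(\<omega> in M. excursion \<delta> (cube T) (Z \<omega>) s > ennreal x)) \<partial>lborel)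
       / ennreal (T ^ CARD('d))"

text \<open>\<open>Lim\<close> is meaningful only together with convergence, which has to be stated separately.\<close>

definition berman :: "'w measure \<Rightarrow> ('w \<Rightarrow> real ^ 'd::finite \<Rightarrow> real) \<Rightarrow> real \<Rightarrow> real \<Rightarrow> ennreal" where
  "berman M Z \<delta> x = Lim at_top (berman_mean M Z \<delta> x)"

definition berman_exists :: "'w measure \<Rightarrow> ('w \<Rightarrow> real ^ 'd::finite \<Rightarrow> real) \<Rightarrow> real \<Rightarrow> real \<Rightarrow> bool" where
  "berman_exists M Z \<delta> x \<longleftrightarrow> (berman_mean M Z \<delta> x \<longlongrightarrow> berman M Z \<delta> x) at_top"

text \<open>The canonical space carrying independent i.i.d. sequences of unit exponential variables
  (first components) and of points of \<open>M\<close> (second components); evaluating \<open>Z\<close> at the latter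
  yields the i.i.d. copies of \<open>Z\<close>.\<close>

definition max_stable_space :: "'w measure \<Rightarrow> (nat \<Rightarrow> real \<times> 'w) measure" where
  "max_stable_space M =
     PiM UNIV (\<lambda>_. density lborel (\<lambda>v. ennreal (exponential_density 1 v)) \<Otimes>\<^sub>M M)"

text \<open>Indices start at 0, so \<open>\<Gamma>\<^sub>i\<close> of the usual numbering is the sum of the first \<open>i\<close> entries.\<close>

definition max_stable_field :: "('w \<Rightarrow> 't \<Rightarrow> real) \<Rightarrow> (nat \<Rightarrow> real \<times> 'w) \<Rightarrow> 't \<Rightarrow> ennreal" where
  "max_stable_field Z w t = (SUP i. ennreal (Z (snd (w i)) t / (\<Sum>k\<le>i. fst (w k))))"

text \<open>The law on the product \<open>\<sigma>\<close>-field; equality of two such laws is equality of all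
  finite-dimensional distributions.\<close>

definition field_law :: "'a measure \<Rightarrow> 't set \<Rightarrow> ('a \<Rightarrow> 't \<Rightarrow> ennreal) \<Rightarrow> ('t \<Rightarrow> ennreal) measure" where
  "field_law N I X = distr N (PiM I (\<lambda>_. borel)) (\<lambda>w. restrict (X w) I)"

definition stationary :: "'a measure \<Rightarrow> ('a \<Rightarrow> real ^ 'd \<Rightarrow> ennreal) \<Rightarrow> bool" where
  "stationary N X \<longleftrightarrow> (\<forall>h. field_law N UNIV (\<lambda>w t. X w (t - h)) = field_law N UNIV X)"

text \<open>\<open>Y\<close> is a spectral random field of the restriction to \<open>I\<close> of the max-stable field
  with spectral random field \<open>Z\<close>.\<close>

definition spectral_field_on ::
    "'w measure \<Rightarrow> ('w \<Rightarrow> 't \<Rightarrow> real) \<Rightarrow> 't set \<Rightarrow> ('w \<Rightarrow> 't \<Rightarrow> real) \<Rightarrow> bool" where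
  "spectral_field_on M Z I Y \<longleftrightarrow>
     field_law (max_stable_space M) I (max_stable_field Y)
       = field_law (max_stable_space M) I (max_stable_field Z)"

definition is_Theta ::
    "'w measure \<Rightarrow> ('w \<Rightarrow> real ^ 'd::finite \<Rightarrow> real) \<Rightarrow> ('w \<Rightarrow> real ^ 'd \<Rightarrow> real) \<Rightarrow> bool" where
  "is_Theta M Z \<Theta> \<longleftrightarrow> cadlag_field M \<Theta> \<and>
     (\<forall>A\<in>sets cadlag_algebra. \<P>(\<omega> in M. \<Theta> \<omega> \<in> A) =
        (\<integral>\<omega>. Z \<omega> 0 * indicator A (\<lambda>t. Z \<omega> t / Z \<omega> 0) \<partial>M))"

definition is_V ::
    "'w measure \<Rightarrow> ('w \<Rightarrow> real ^ 'd::finite \<Rightarrow> real) \<Rightarrow> ('w \<Rightarrow> real ^ 'd \<Rightarrow> real) \<Rightarrow> bool" where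
  "is_V M Z V \<longleftrightarrow> cadlag_field M V \<and>
     (let a = \<P>(\<omega> in M. total_mass 0 (Z \<omega>) < \<infinity>)
                / (\<integral>\<omega>. Z \<omega> 0 * indicator {\<omega>. total_mass 0 (Z \<omega>) < \<infinity>} \<omega> \<partial>M)
      in \<forall>A\<in>sets cadlag_algebra.
           \<P>(\<omega> in M. V \<omega> \<in> A) = \<P>(\<omega> in M. (\<lambda>t. a * Z \<omega> t) \<in> A \<bar> total_mass 0 (Z \<omega>) < \<infinity>))"

text \<open>For \<open>\<delta> > 0\<close> the density \<open>p\<close> of \<open>T\<close> is taken with respect to the unscaled counting measure,
  i.e. it is a probability mass function; the values of \<open>Qb\<close> and \<open>Q\<close> off the grid are irrelevant.\<close>

definition is_Q ::
    "'w measure \<Rightarrow> ('w \<Rightarrow> real ^ 'd::finite \<Rightarrow> real) \<Rightarrow> real \<Rightarrow> ('w \<Rightarrow> real ^ 'd \<Rightarrow> real) \<Rightarrow> bool" where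
  "is_Q M Z \<delta> Q \<longleftrightarrow> (\<exists>T p Qb.
     let ref = (if \<delta> = 0 then lborel else count_space (grid \<delta>)) in
       distributed M ref T (\<lambda>s. ennreal (p s)) \<and>
       (\<forall>s\<in>grid \<delta>. 0 < p s) \<and>
       (\<delta> = 0 \<longrightarrow> continuous_on UNIV p) \<and>
       random_field M (grid \<delta>) Qb \<and>
       (AE \<omega> in M. \<forall>t\<in>grid \<delta>. 0 \<le> Qb \<omega> t) \<and>
       (\<delta> = 0 \<longrightarrow> (AE \<omega> in M. Qb \<omega> \<in> cadlag)) \<and>
       prob_space.indep_set M
         {(\<lambda>\<omega>. restrict (Qb \<omega>) (grid \<delta>)) -` A \<inter> space M | A. A \<in> sets (PiM (grid \<delta>) (\<lambda>_. borel))}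
         {T -` B \<inter> space M | B. B \<in> sets ref} \<and>
       spectral_field_on M Z (grid \<delta>) (\<lambda>\<omega> t. Qb \<omega> (t - T \<omega>) / p (T \<omega>)) \<and>
       Q = (\<lambda>\<omega> t. Qb \<omega> t / (if \<delta> = 0 then 1 else \<delta> ^ CARD('d))))"

end

theory Submission
  imports Defs
begin

text \<open>
  Let \<open>\<nu>\<close> be the image of \<open>ds \<otimes> P\<close>, with \<open>s > 0\<close>, under \<open>(s, \<omega>) \<mapsto> Z \<omega> / s\<close>, the exponent measure of
  the max-stable field. As \<open>Z t > s\<close> means \<open>Z t / s > 1\<close>, the integral over all levels \<open>s\<close> in the Berman
  mean is the \<open>\<nu>\<close>-measure of the paths whose excursion above the single level \<open>1\<close> inside the cube of
  side \<open>T\<close> has size more than \<open>x\<close> (\<open>emeasure_exponent_excursion\<close>). The theorem is about the density,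
  per unit volume, of this quantity.

  The law of the max-stable field determines \<open>\<nu>\<close> off the zero path. Indeed \<open>c\<close> times the probability
  that the field exceeds one of finitely many levels \<open>c x\<close> tends to the expectation of the largest
  \<open>Z t / x\<close> as \<open>c\<close> grows (\<open>exceedance_limit\<close>, \<open>spectral_field_on_exponent\<close>); this is the \<open>\<nu>\<close>-measure of
  the paths that exceed one of the levels \<open>x\<close>, and such sets determine \<open>\<nu>\<close> (\<open>exponent_measure_eqI\<close>).
  Hence stationarity says that \<open>\<nu>\<close> is invariant under shifts, and two spectral fields of the same
  max-stable field have the same exponent measure.

  Suppose that \<open>\<nu>\<close> is the sum of all lattice translates of a measure \<open>m\<close>. Then the \<open>\<nu>\<close>-measure of the
  event in the cube is the \<open>m\<close>-integral of the number of lattice translates of the cube that see an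
  excursion of size more than \<open>x\<close>. A path that exceeds \<open>1\<close> in finitely many lattice cells only is seen
  entirely or not at all, except by the translates whose boundary is near; so this number, divided by the
  volume, tends to the indicator of a total excursion of more than \<open>x\<close>, divided by the volume of a cell. The
  convergence is dominated by the number of cells met, which is \<open>m\<close>-integrable because the supremum over
  a cell has finite mean. This is \<open>tiling_limit\<close>.

  In part (i), independence of the pattern and its translation \<open>T\<close>, together with the factor \<open>1 / p T\<close>,
  makes \<open>\<nu>\<close> the mixture of all translates of the exponent measure of the pattern
  (\<open>exponent_measure_translated\<close>); \<open>m\<close> collects the translates by points of one cell.

  In part (ii) the paths of finite and of infinite mass are treated apart. On the former,
  transporting the fraction of the mass that lies in each cell to the origin (\<open>mass_transport\<close>) shows that
  \<open>\<nu>\<close> is again a sum of translates, so a finite density exists (\<open>finite_mass_limit\<close>). On the latter the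
  density is zero (\<open>infinite_mass_limit\<close>): if only finitely many cells saw an exceedance, some cell would
  have the largest supremum, and transporting this peak to the origin shows that then the
  suprema over the cells are summable and the mass is finite. So exceedances recur infinitely often, and
  each of the many exceedances in a large cube has only a small share in the event that there is one.
  Finally, the exponent measure of \<open>V\<close> is the restriction of \<open>\<nu>\<close> to the paths of finite mass divided by
  \<open>E(Z 0; S\<^sub>0 < \<infinity>)\<close>, which is the probability that \<open>\<Theta>\<close> has finite mass (\<open>conditioned_limit\<close>).

  The continuum and the lattices are treated alike: space is tiled by the cells of a lattice, which is the
  grid itself for \<open>\<delta> > 0\<close> and the integer lattice for \<open>\<delta> = 0\<close>.
\<close>

section \<open>Max-stable fields and their exponents\<close>

lemma nn_integral_indicator_less:
  "(\<integral>\<^sup>+s. indicator {0<..} s * indicator {s. ennreal s < y} s \<partial>lborel) = y"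
proof (cases y)
  case (real r)
  have "(\<integral>\<^sup>+s. indicator {0<..} s * indicator {s. ennreal s < y} s \<partial>lborel)
      = (\<integral>\<^sup>+s. indicator {0<..<r} s \<partial>lborel)"
    using real by (intro nn_integral_cong) (auto simp: indicator_def ennreal_less_iff)
  then show ?thesis using real by simp
next
  case top
  have "(\<integral>\<^sup>+s. indicator {0<..} s * indicator {s. ennreal s < y} s \<partial>lborel)
      = (\<integral>\<^sup>+s. indicator {0::real<..} s \<partial>lborel)"
    using top by (intro nn_integral_cong) (auto simp: indicator_def ennreal_less_top)
  also have "\<dots> = top"
  proof (rule ccontr)
    assume "(\<integral>\<^sup>+s. indicator {0::real<..} s \<partial>lborel) \<noteq> top"
    then obtain n where n: "emeasure lborel {0::real<..} < of_nat n"
      using ennreal_Ex_less_of_nat[of "emeasure lborel {0::real<..}"] by (auto simp: less_top)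
    have "of_nat n \<le> emeasure lborel {0::real<..< real n}"
      by (simp add: ennreal_of_nat_eq_real_of_nat)
    also have "\<dots> \<le> emeasure lborel {0::real<..}"
      by (intro emeasure_mono) auto
    finally show False using n by simp
  qed
  finally show ?thesis using top by simp
qed

lemma (in sigma_finite_measure) layer_cake:
  assumes [measurable]: "W \<in> borel_measurable M"
  shows "(\<integral>\<^sup>+s\<in>{0<..}. emeasure M {\<omega>\<in>space M. ennreal s < W \<omega>} \<partial>lborel) = (\<integral>\<^sup>+\<omega>. W \<omega> \<partial>M)"
proof -
  interpret P: pair_sigma_finite M "lborel :: real measure" ..
  have "(\<integral>\<^sup>+\<omega>. W \<omega> \<partial>M) = (\<integral>\<^sup>+\<omega>. (\<integral>\<^sup>+s. indicator {0<..} s * indicator {s. ennreal s < W \<omega>} s \<partial>lborel) \<partial>M)"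
    by (simp add: nn_integral_indicator_less)
  also have "\<dots> = (\<integral>\<^sup>+s. (\<integral>\<^sup>+\<omega>. indicator {0<..} s * indicator {s. ennreal s < W \<omega>} s \<partial>M) \<partial>lborel)"
    by (rule P.Fubini'[symmetric]) measurable
  also have "\<dots> = (\<integral>\<^sup>+s. indicator {0<..} s * (\<integral>\<^sup>+\<omega>. indicator {\<omega>\<in>space M. ennreal s < W \<omega>} \<omega> \<partial>M) \<partial>lborel)"
    by (intro nn_integral_cong, subst nn_integral_cmult[symmetric])
       (auto intro!: nn_integral_cong simp: indicator_def)
  finally show ?thesis by (simp add: mult.commute)
qed

definition unit_exp :: "real measure" where
  "unit_exp = density lborel (\<lambda>v. ennreal (exponential_density 1 v))"

lemma prob_space_unit_exp: "prob_space unit_exp"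
  unfolding unit_exp_def by (rule prob_space_exponential_density) simp

lemma sets_unit_exp [measurable_cong, simp]: "sets unit_exp = sets borel"
  by (simp add: unit_exp_def)

lemma space_unit_exp [simp]: "space unit_exp = UNIV"
  by (simp add: unit_exp_def)

lemma nn_integral_unit_exp:
  assumes [measurable]: "f \<in> borel_measurable borel"
  shows "(\<integral>\<^sup>+v. f v \<partial>unit_exp) = (\<integral>\<^sup>+v. ennreal (exp (- v)) * indicator {0..} v * f v \<partial>lborel)"
  unfolding unit_exp_def
  by (subst nn_integral_density)
     (auto intro!: nn_integral_cong simp: exponential_density_def indicator_def ac_simps)

lemma AE_unit_exp_pos: "AE v in unit_exp. 0 < v"
proof -
  have "AE v in lborel. v \<noteq> (0::real)"
    by (rule AE_lborel_singleton)
  then show ?thesis unfolding unit_exp_def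
    by (subst AE_density) (auto simp: exponential_density_def split: if_splits)
qed

text \<open>The renewal equation in Tonelli form. The density \<open>exp (- z)\<close> of the first point of a unit Poisson
  process and the mass \<open>1 - exp (- z)\<close> of first points before \<open>z\<close>, after each of which the process is
  renewed, add up to the intensity one.\<close>

lemma unit_exp_renewal:
  fixes g :: "real \<Rightarrow> ennreal"
  assumes [measurable]: "g \<in> borel_measurable borel"
  shows "(\<integral>\<^sup>+v. g (u + v) + (\<integral>\<^sup>+y\<in>{0..}. g (u + v + y) \<partial>lborel) \<partial>unit_exp)
           = (\<integral>\<^sup>+y\<in>{0..}. g (u + y) \<partial>lborel)"
proof -
  have shift: "(\<integral>\<^sup>+y\<in>{0..}. g (u + v + y) \<partial>lborel) = (\<integral>\<^sup>+z. g (u + z) * indicator {0..} (z - v) \<partial>lborel)" for v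
    by (subst nn_integral_real_affine[where c = 1 and t = v])
       (auto intro!: nn_integral_cong simp: indicator_def ac_simps)
  have "(\<integral>\<^sup>+v. (\<integral>\<^sup>+y\<in>{0..}. g (u + v + y) \<partial>lborel) \<partial>unit_exp)
      = (\<integral>\<^sup>+v. (\<integral>\<^sup>+z. g (u + z) * (ennreal (exp (- v)) * indicator {0..} v * indicator {0..} (z - v)) \<partial>lborel) \<partial>lborel)"
    unfolding shift
  proof (subst nn_integral_unit_exp, measurable, rule nn_integral_cong)
    fix v :: real
    have "ennreal (exp (- v)) * indicator {0..} v * (\<integral>\<^sup>+z. g (u + z) * indicator {0..} (z - v) \<partial>lborel)
        = (\<integral>\<^sup>+z. ennreal (exp (- v)) * indicator {0..} v * (g (u + z) * indicator {0..} (z - v)) \<partial>lborel)"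
      by (rule nn_integral_cmult[symmetric]) measurable
    then show "ennreal (exp (- v)) * indicator {0..} v * (\<integral>\<^sup>+z. g (u + z) * indicator {0..} (z - v) \<partial>lborel)
        = (\<integral>\<^sup>+z. g (u + z) * (ennreal (exp (- v)) * indicator {0..} v * indicator {0..} (z - v)) \<partial>lborel)"
      by (simp only: mult.assoc mult.commute mult.left_commute)
  qed
  also have "\<dots> = (\<integral>\<^sup>+z. (\<integral>\<^sup>+v. g (u + z) * (ennreal (exp (- v)) * indicator {0..} v * indicator {0..} (z - v)) \<partial>lborel) \<partial>lborel)"
    by (rule lborel_pair.Fubini') measurable
  also have "\<dots> = (\<integral>\<^sup>+z. g (u + z) * (\<integral>\<^sup>+v. ennreal (exp (- v)) * indicator {0..z} v \<partial>lborel) \<partial>lborel)"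
  proof (rule nn_integral_cong)
    fix z :: real
    have "ennreal (exp (- v)) * indicator {0..} v * indicator {0..} (z - v) = ennreal (exp (- v)) * indicator {0..z} v" for v
      by (simp add: indicator_def)
    then show "(\<integral>\<^sup>+v. g (u + z) * (ennreal (exp (- v)) * indicator {0..} v * indicator {0..} (z - v)) \<partial>lborel)
        = g (u + z) * (\<integral>\<^sup>+v. ennreal (exp (- v)) * indicator {0..z} v \<partial>lborel)"
      by (simp add: nn_integral_cmult)
  qed
  also have "\<dots> = (\<integral>\<^sup>+z. g (u + z) * (ennreal (1 - exp (- z)) * indicator {0..} z) \<partial>lborel)"
  proof (intro nn_integral_cong arg_cong2[where f = "(*)"] refl)
    fix z :: real
    show "(\<integral>\<^sup>+v. ennreal (exp (- v)) * indicator {0..z} v \<partial>lborel) = ennreal (1 - exp (- z)) * indicator {0..} z"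
    proof (cases "0 \<le> z")
      case True
      have "(\<integral>\<^sup>+v. ennreal (exp (- v)) * indicator {0..z} v \<partial>lborel) = ennreal (- exp (- z) - (- exp (- 0)))"
        using True
        by (intro nn_integral_FTC_Icc) (auto intro!: derivative_eq_intros)
      with True show ?thesis by simp
    qed (simp add: indicator_def)
  qed
  finally have 1: "(\<integral>\<^sup>+v. (\<integral>\<^sup>+y\<in>{0..}. g (u + v + y) \<partial>lborel) \<partial>unit_exp)
      = (\<integral>\<^sup>+z. g (u + z) * (ennreal (1 - exp (- z)) * indicator {0..} z) \<partial>lborel)" .
  have 2: "(\<integral>\<^sup>+v. g (u + v) \<partial>unit_exp) = (\<integral>\<^sup>+z. g (u + z) * (ennreal (exp (- z)) * indicator {0..} z) \<partial>lborel)"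
    by (subst nn_integral_unit_exp) (auto simp: ac_simps)
  have "(\<integral>\<^sup>+v. g (u + v) + (\<integral>\<^sup>+y\<in>{0..}. g (u + v + y) \<partial>lborel) \<partial>unit_exp)
      = (\<integral>\<^sup>+v. g (u + v) \<partial>unit_exp) + (\<integral>\<^sup>+v. (\<integral>\<^sup>+y\<in>{0..}. g (u + v + y) \<partial>lborel) \<partial>unit_exp)"
    by (rule nn_integral_add) measurable
  also have "\<dots> = (\<integral>\<^sup>+z. g (u + z) * (ennreal (exp (- z)) * indicator {0..} z)
      + g (u + z) * (ennreal (1 - exp (- z)) * indicator {0..} z) \<partial>lborel)"
    unfolding 1 2 by (rule nn_integral_add[symmetric]) measurable
  also have "\<dots> = (\<integral>\<^sup>+y\<in>{0..}. g (u + y) \<partial>lborel)"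
  proof (intro nn_integral_cong)
    fix z :: real
    have "z \<ge> 0 \<Longrightarrow> ennreal (exp (- z)) + ennreal (1 - exp (- z)) = 1"
      by (subst ennreal_plus[symmetric]) auto
    then show "g (u + z) * (ennreal (exp (- z)) * indicator {0..} z)
      + g (u + z) * (ennreal (1 - exp (- z)) * indicator {0..} z) = g (u + z) * indicator {0..} z"
      by (simp add: indicator_def distrib_left[symmetric])
  qed
  finally show ?thesis .
qed

lemma max_stable_space_eq: "max_stable_space M = PiM UNIV (\<lambda>_. unit_exp \<Otimes>\<^sub>M M)"
  by (simp add: max_stable_space_def unit_exp_def)

lemma sets_max_stable_space [measurable_cong]:
  "sets (max_stable_space M) = sets (PiM UNIV (\<lambda>_. borel \<Otimes>\<^sub>M M))"
  unfolding max_stable_space_eq by (intro sets_PiM_cong sets_pair_measure_cong refl sets_unit_exp)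

lemma measurable_max_stable_space:
  assumes [measurable]: "W \<in> borel_measurable M"
  shows "(\<lambda>w. W (snd (w i))) \<in> borel_measurable (max_stable_space M)"
    and "(\<lambda>w. fst (w i)) \<in> borel_measurable (max_stable_space M)"
  unfolding measurable_cong_sets[OF sets_max_stable_space refl] by measurable

lemma AE_max_stable_space_pos:
  assumes "prob_space M"
  shows "AE w in max_stable_space M. \<forall>i. 0 < (\<Sum>k\<le>i. fst (w k))"
proof -
  interpret M: prob_space M by fact
  interpret E: prob_space unit_exp by (rule prob_space_unit_exp)
  interpret P: pair_prob_space unit_exp M ..
  have *: "AE p in unit_exp \<Otimes>\<^sub>M M. 0 < fst p"
  proof (rule P.AE_pair_measure)
    show "AE x in unit_exp. AE y in M. 0 < fst (x, y)"
      using AE_unit_exp_pos by eventually_elim simp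
  qed measurable
  have "AE w in max_stable_space M. \<forall>i. 0 < fst (w i)"
    unfolding max_stable_space_eq AE_all_countable
    by (intro allI AE_PiM_component * P.prob_space_axioms) simp
  then show ?thesis by eventually_elim (auto intro!: sum_pos)
qed

text \<open>The expected number of points of a unit Poisson process that satisfy a condition bounds the
  probability that one does. The offset \<open>u\<close> makes the induction go through: after a first point at \<open>v\<close>
  the remaining points are those of the same process started from \<open>u + v\<close>, and the renewal equation
  recombines the two contributions.\<close>

lemma exceedance_upper:
  fixes W :: "'w \<Rightarrow> ennreal"
  assumes "prob_space M" and [measurable]: "W \<in> borel_measurable M"
  shows "emeasure (max_stable_space M) {w\<in>space (max_stable_space M).
            \<exists>i<n. ennreal (c * (u + (\<Sum>k\<le>i. fst (w k)))) < W (snd (w i))}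
          \<le> (\<integral>\<^sup>+y\<in>{0..}. emeasure M {\<omega>\<in>space M. ennreal (c * (u + y)) < W \<omega>} \<partial>lborel)"
    (is "emeasure ?S (?E n u) \<le> (\<integral>\<^sup>+y\<in>{0..}. ?G (u + y) \<partial>lborel)")
proof (induction n arbitrary: u)
  case 0
  then show ?case by simp
next
  case (Suc n)
  interpret M: prob_space M by fact
  interpret E: prob_space unit_exp by (rule prob_space_unit_exp)
  interpret P: pair_prob_space unit_exp M ..
  note measurable_max_stable_space [measurable]
  interpret sequence_space "unit_exp \<Otimes>\<^sub>M M" ..
  interpret S: prob_space ?S unfolding max_stable_space_eq by (intro prob_space_PiM P.prob_space_axioms)
  have S_eq: "S = ?S" by (simp add: max_stable_space_eq)
  have mE [measurable]: "?E n u \<in> sets ?S" for n u by measurable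
  have mG [measurable]: "?G \<in> borel_measurable borel" by measurable
  let ?f = "\<lambda>(s, \<omega>). case_nat s \<omega> :: nat \<Rightarrow> real \<times> 'w"
  have mf: "?f \<in> (unit_exp \<Otimes>\<^sub>M M) \<Otimes>\<^sub>M S \<rightarrow>\<^sub>M S" by measurable
  have "emeasure ?S (?E (Suc n) u) = emeasure (distr ((unit_exp \<Otimes>\<^sub>M M) \<Otimes>\<^sub>M S) S ?f) (?E (Suc n) u)"
    by (subst PiM_iter) (simp only: S_eq)
  also have "\<dots> = emeasure ((unit_exp \<Otimes>\<^sub>M M) \<Otimes>\<^sub>M S) (?f -` ?E (Suc n) u \<inter> space ((unit_exp \<Otimes>\<^sub>M M) \<Otimes>\<^sub>M S))"
    using mE[of "Suc n" u] mf by (subst emeasure_distr) (simp_all add: S_eq)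
  also have "\<dots> = (\<integral>\<^sup>+p. emeasure S (Pair p -` (?f -` ?E (Suc n) u \<inter> space ((unit_exp \<Otimes>\<^sub>M M) \<Otimes>\<^sub>M S))) \<partial>(unit_exp \<Otimes>\<^sub>M M))"
    using mE[of "Suc n" u] mf
    by (intro sigma_finite_measure.emeasure_pair_measure_alt measurable_sets[OF mf])
       (simp_all add: S_eq S.sigma_finite_measure_axioms)
  also have "\<dots> \<le> (\<integral>\<^sup>+p. indicator {\<omega>\<in>space M. ennreal (c * (u + fst p)) < W \<omega>} (snd p)
                      + emeasure S (?E n (u + fst p)) \<partial>(unit_exp \<Otimes>\<^sub>M M))"
  proof (rule nn_integral_mono)
    fix p assume p: "p \<in> space (unit_exp \<Otimes>\<^sub>M M)"
    show "emeasure S (Pair p -` (?f -` ?E (Suc n) u \<inter> space ((unit_exp \<Otimes>\<^sub>M M) \<Otimes>\<^sub>M S)))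
        \<le> indicator {\<omega>\<in>space M. ennreal (c * (u + fst p)) < W \<omega>} (snd p) + emeasure S (?E n (u + fst p))"
      (is "emeasure S ?L \<le> _")
    proof (cases "ennreal (c * (u + fst p)) < W (snd p)")
      case True
      then have "indicator {\<omega>\<in>space M. ennreal (c * (u + fst p)) < W \<omega>} (snd p) = (1::ennreal)"
        using p by (auto simp: space_pair_measure)
      moreover have "emeasure S ?L \<le> 1" by (rule emeasure_le_1)
      ultimately show ?thesis by (auto intro: add_increasing2)
    next
      case False
      have "?L \<subseteq> ?E n (u + fst p)"
      proof
        fix w assume w: "w \<in> ?L"
        then obtain i where i: "i < Suc n"
          "ennreal (c * (u + (\<Sum>k\<le>i. fst (case_nat p w k)))) < W (snd (case_nat p w i))" by auto
        from False i obtain j where j: "i = Suc j" by (cases i) auto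
        have "(\<Sum>k\<le>i. fst (case_nat p w k)) = fst p + (\<Sum>k\<le>j. fst (w k))"
          unfolding j by (subst sum.atMost_Suc_shift) simp
        with i j w show "w \<in> ?E n (u + fst p)"
          by (auto simp: space_pair_measure S_eq add.assoc split: if_splits)
      qed
      then have "emeasure S ?L \<le> emeasure S (?E n (u + fst p))"
        using mE by (intro emeasure_mono) (auto simp: S_eq)
      then show ?thesis by (simp add: add_increasing)
    qed
  qed
  also have "\<dots> \<le> (\<integral>\<^sup>+p. indicator {\<omega>\<in>space M. ennreal (c * (u + fst p)) < W \<omega>} (snd p)
                      + (\<integral>\<^sup>+y\<in>{0..}. ?G (u + fst p + y) \<partial>lborel) \<partial>(unit_exp \<Otimes>\<^sub>M M))"
    by (intro nn_integral_mono add_left_mono) (simp add: S_eq Suc.IH)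
  also have "\<dots> = (\<integral>\<^sup>+v. (\<integral>\<^sup>+\<omega>. indicator {\<omega>\<in>space M. ennreal (c * (u + v)) < W \<omega>} \<omega>
                      + (\<integral>\<^sup>+y\<in>{0..}. ?G (u + v + y) \<partial>lborel) \<partial>M) \<partial>unit_exp)"
  proof -
    have [measurable]: "(\<lambda>p. indicator {\<omega>\<in>space M. ennreal (c * (u + fst p)) < W \<omega>} (snd p)
           + (\<integral>\<^sup>+y\<in>{0..}. ?G (u + fst p + y) \<partial>lborel)) \<in> borel_measurable (unit_exp \<Otimes>\<^sub>M M)"
      by measurable
    show ?thesis by (subst M.nn_integral_fst[symmetric]) auto
  qed
  also have "\<dots> = (\<integral>\<^sup>+v. ?G (u + v) + (\<integral>\<^sup>+y\<in>{0..}. ?G (u + v + y) \<partial>lborel) \<partial>unit_exp)"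
    by (intro nn_integral_cong, subst nn_integral_add) (auto simp: M.emeasure_space_1)
  also have "\<dots> = (\<integral>\<^sup>+y\<in>{0..}. ?G (u + y) \<partial>lborel)"
    by (rule unit_exp_renewal) measurable
  finally show ?case .
qed

text \<open>For large \<open>c\<close> an exceedance is due to one point of the process only. The mean of \<open>W\<close> is an upper
  bound by the intensity one of the points. The first point alone, of density \<open>exp (- y / c) / c\<close> on the scale
  \<open>y = c v\<close>, gives a lower bound that increases to the same value.\<close>

lemma exceedance_limit:
  fixes W :: "'w \<Rightarrow> ennreal"
  assumes "prob_space M" and [measurable]: "W \<in> borel_measurable M"
  shows "(\<lambda>n. ennreal (Suc n) * emeasure (max_stable_space M) {w\<in>space (max_stable_space M).
            \<exists>i. ennreal (Suc n * (\<Sum>k\<le>i. fst (w k))) < W (snd (w i))})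
          \<longlonglongrightarrow> (\<integral>\<^sup>+\<omega>. W \<omega> \<partial>M)"
proof -
  let ?S = "max_stable_space M"
  note measurable_max_stable_space [measurable]
  let ?B = "\<lambda>c i w. ennreal (c * (\<Sum>k\<le>i. fst (w k))) < W (snd (w i))"
  define G where "G y = emeasure M {\<omega>\<in>space M. ennreal y < W \<omega>}" for y
  interpret M: prob_space M by fact
  interpret E: prob_space unit_exp by (rule prob_space_unit_exp)
  interpret P: pair_prob_space unit_exp M ..
  have [measurable]: "G \<in> borel_measurable borel" unfolding G_def by measurable
  have EW: "(\<integral>\<^sup>+y\<in>{0..}. G y \<partial>lborel) = (\<integral>\<^sup>+\<omega>. W \<omega> \<partial>M)"
  proof -
    have "(\<integral>\<^sup>+y\<in>{0..}. G y \<partial>lborel) = (\<integral>\<^sup>+y\<in>{0<..}. G y \<partial>lborel)"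
      using AE_lborel_singleton[of "0::real"]
      by (intro nn_integral_cong_AE, eventually_elim) (auto simp: indicator_def)
    then show ?thesis using M.layer_cake[of W] by (simp add: G_def)
  qed
  have upper: "ennreal c * emeasure ?S {w\<in>space ?S. \<exists>i. ?B c i w} \<le> (\<integral>\<^sup>+\<omega>. W \<omega> \<partial>M)"
    if c: "c > 0" for c
  proof -
    have "emeasure ?S {w\<in>space ?S. \<exists>i. ?B c i w} = emeasure ?S (\<Union>n. {w\<in>space ?S. \<exists>i<n. ?B c i w})"
      by (rule arg_cong[where f = "emeasure ?S"]) auto
    also have "\<dots> = (SUP n. emeasure ?S {w\<in>space ?S. \<exists>i<n. ?B c i w})"
      by (rule SUP_emeasure_incseq[symmetric]) (measurable, auto simp: incseq_def intro: less_le_trans)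
    also have "\<dots> \<le> (\<integral>\<^sup>+y\<in>{0..}. G (c * y) \<partial>lborel)"
      using exceedance_upper[OF assms, of _ c 0] by (intro SUP_least) (simp add: G_def)
    finally have "ennreal c * emeasure ?S {w\<in>space ?S. \<exists>i. ?B c i w}
        \<le> ennreal c * (\<integral>\<^sup>+y\<in>{0..}. G (c * y) \<partial>lborel)" by (rule mult_left_mono) simp
    also have "\<dots> = (\<integral>\<^sup>+y\<in>{0..}. G y \<partial>lborel)"
      using c by (subst (2) nn_integral_real_affine[where c = c and t = 0])
        (simp_all add: indicator_def zero_le_mult_iff)
    finally show ?thesis by (simp add: EW)
  qed
  have lower: "(\<integral>\<^sup>+y. ennreal (exp (- y / c)) * (G y * indicator {0..} y) \<partial>lborel)
      \<le> ennreal c * emeasure ?S {w\<in>space ?S. \<exists>i. ?B c i w}" if c: "c > 0" for c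
  proof -
    let ?N = "unit_exp \<Otimes>\<^sub>M M"
    have mB: "{p\<in>space ?N. ennreal (c * fst p) < W (snd p)} \<in> sets ?N" by measurable
    have "(\<integral>\<^sup>+y. ennreal (exp (- y / c)) * (G y * indicator {0..} y) \<partial>lborel)
        = ennreal c * (\<integral>\<^sup>+v. ennreal (exp (- v)) * indicator {0..} v * G (c * v) \<partial>lborel)"
      using c by (subst nn_integral_real_affine[where c = c and t = 0])
        (simp_all add: indicator_def zero_le_mult_iff mult.assoc mult.commute[of "of_bool _" "G _"])
    also have "(\<integral>\<^sup>+v. ennreal (exp (- v)) * indicator {0..} v * G (c * v) \<partial>lborel) = (\<integral>\<^sup>+v. G (c * v) \<partial>unit_exp)"
      by (rule nn_integral_unit_exp[symmetric]) measurable
    also have "\<dots> = emeasure ?N {p\<in>space ?N. ennreal (c * fst p) < W (snd p)}"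
      unfolding M.emeasure_pair_measure_alt[OF mB] G_def
      by (intro nn_integral_cong arg_cong[where f = "emeasure M"]) (auto simp: space_pair_measure)
    also have "\<dots> = emeasure (distr ?S ?N (\<lambda>w. w 0)) {p\<in>space ?N. ennreal (c * fst p) < W (snd p)}"
      unfolding max_stable_space_eq by (subst distr_PiM_component) (auto intro: P.prob_space_axioms)
    also have "\<dots> \<le> emeasure ?S {w\<in>space ?S. \<exists>i. ?B c i w}"
    proof (subst emeasure_distr[OF _ mB])
      show "(\<lambda>w. w 0) \<in> ?S \<rightarrow>\<^sub>M ?N" unfolding max_stable_space_eq by measurable
      show "emeasure ?S ((\<lambda>w. w 0) -` {p \<in> space ?N. ennreal (c * fst p) < W (snd p)} \<inter> space ?S)
        \<le> emeasure ?S {w\<in>space ?S. \<exists>i. ?B c i w}"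
        by (rule emeasure_mono) (auto intro!: exI[of _ 0])
    qed
    finally show ?thesis by (simp add: mult_left_mono)
  qed
  have "(\<lambda>n. \<integral>\<^sup>+y. ennreal (exp (- y / Suc n)) * (G y * indicator {0..} y) \<partial>lborel)
      \<longlonglongrightarrow> (\<integral>\<^sup>+y. G y * indicator {0..} y \<partial>lborel)"
  proof (rule nn_integral_LIMSEQ)
    show "incseq (\<lambda>n y. ennreal (exp (- y / Suc n)) * (G y * indicator {0..} y))"
    proof (intro incseq_SucI le_funI)
      fix n y
      have "exp (- y / Suc n) \<le> exp (- y / Suc (Suc n))" if "y \<ge> 0"
      proof -
        have "y / Suc (Suc n) \<le> y / Suc n" using that by (intro divide_left_mono) auto
        then show ?thesis by simp
      qed
      then show "ennreal (exp (- y / Suc n)) * (G y * indicator {0..} y)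
          \<le> ennreal (exp (- y / Suc (Suc n))) * (G y * indicator {0..} y)"
        by (cases "y \<ge> 0") (auto intro!: mult_right_mono ennreal_leI simp: indicator_def)
    qed
    show "(\<lambda>n. ennreal (exp (- y / Suc n)) * (G y * indicator {0..} y)) \<longlonglongrightarrow> G y * indicator {0..} y" for y
    proof -
      have "(\<lambda>n. - y / Suc n) \<longlonglongrightarrow> 0"
        by (rule LIMSEQ_Suc[OF lim_const_over_n])
      then have "(\<lambda>n. ennreal (exp (- y / Suc n))) \<longlonglongrightarrow> ennreal (exp 0)"
        by (intro tendsto_ennrealI tendsto_exp)
      then have "(\<lambda>n. ennreal (exp (- y / Suc n)) * (G y * indicator {0..} y)) \<longlonglongrightarrow> ennreal (exp 0) * (G y * indicator {0..} y)"
        by (intro tendsto_mult_ennreal tendsto_const) auto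
      then show ?thesis by simp
    qed
  qed measurable
  then have "(\<lambda>n. \<integral>\<^sup>+y. ennreal (exp (- y / Suc n)) * (G y * indicator {0..} y) \<partial>lborel)
      \<longlonglongrightarrow> (\<integral>\<^sup>+\<omega>. W \<omega> \<partial>M)" by (simp add: EW)
  then show ?thesis
  proof (rule tendsto_sandwich[rotated 2])
    show "(\<lambda>n. \<integral>\<^sup>+\<omega>. W \<omega> \<partial>M) \<longlonglongrightarrow> (\<integral>\<^sup>+\<omega>. W \<omega> \<partial>M)" by (rule tendsto_const)
    show "\<forall>\<^sub>F n in sequentially. (\<integral>\<^sup>+y. ennreal (exp (- y / real (Suc n))) * (G y * indicator {0..} y) \<partial>lborel)
        \<le> ennreal (real (Suc n)) * emeasure ?S {w\<in>space ?S. \<exists>i. ?B (real (Suc n)) i w}"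
      by (intro always_eventually allI lower) simp
    show "\<forall>\<^sub>F n in sequentially. ennreal (real (Suc n)) * emeasure ?S {w\<in>space ?S. \<exists>i. ?B (real (Suc n)) i w}
        \<le> (\<integral>\<^sup>+\<omega>. W \<omega> \<partial>M)"
      by (intro always_eventually allI upper) simp
  qed
qed

lemma measurable_max_stable_field:
  assumes "(\<lambda>\<omega>. U \<omega> t) \<in> borel_measurable M"
  shows "(\<lambda>w. max_stable_field U w t) \<in> borel_measurable (max_stable_space M)"
proof -
  note measurable_max_stable_space [measurable]
  have [measurable]: "(\<lambda>w. U (snd (w i)) t) \<in> borel_measurable (max_stable_space M)" for i
    by (rule measurable_max_stable_space(1)[OF assms])
  have [measurable]: "(\<lambda>w. fst (w k)) \<in> borel_measurable (max_stable_space M)" for k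
    by (rule measurable_max_stable_space(2)[OF assms])
  show ?thesis unfolding max_stable_field_def by measurable
qed

lemma exceeds_max_stable_field_iff:
  assumes pos: "\<And>i. 0 < (\<Sum>k\<le>i. fst (w k))" and "0 \<le> c" and P: "\<And>t x. (t, x) \<in> P \<Longrightarrow> 0 < x"
  shows "(\<exists>(t, x)\<in>P. ennreal (c * x) < max_stable_field Y w t)
    \<longleftrightarrow> (\<exists>i. ennreal (c * (\<Sum>k\<le>i. fst (w k))) < (SUP (t, x)\<in>P. ennreal (Y (snd (w i)) t / x)))"
proof -
  have "ennreal (c * x) < ennreal (y / g) \<longleftrightarrow> ennreal (c * g) < ennreal (y / x)" if "0 < x" "0 < g" for x y g
    using that assms(2) by (simp add: ennreal_less_iff field_simps)
  then have "ennreal (c * snd p) < ennreal (Y (snd (w i)) (fst p) / (\<Sum>k\<le>i. fst (w k)))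
      \<longleftrightarrow> ennreal (c * (\<Sum>k\<le>i. fst (w k))) < ennreal (Y (snd (w i)) (fst p) / snd p)" if "p \<in> P" for p i
    using pos P that by (cases p) simp
  then show ?thesis
    unfolding max_stable_field_def less_SUP_iff case_prod_beta by blast
qed

text \<open>A finite-dimensional exceedance event of the max-stable field is an exceedance event of the
  points of the spectral field with \<open>W\<close> the largest \<open>Y t / x\<close>; its probability depends on the law only,
  and its limit is the mean of \<open>W\<close>.\<close>

lemma spectral_field_on_exponent:
  fixes Y Z :: "'w \<Rightarrow> 't \<Rightarrow> real"
  assumes "prob_space M" and Y: "random_field M I Y" and Z: "random_field M I Z"
    and law: "spectral_field_on M Z I Y"
    and P: "finite P" "P \<subseteq> I \<times> {0<..}"
  shows "(\<integral>\<^sup>+\<omega>. (SUP (t, x)\<in>P. ennreal (Y \<omega> t / x)) \<partial>M) = (\<integral>\<^sup>+\<omega>. (SUP (t, x)\<in>P. ennreal (Z \<omega> t / x)) \<partial>M)"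
proof -
  let ?S = "max_stable_space M"
  note measurable_max_stable_space [measurable]
  have field: "emeasure ?S {w\<in>space ?S. \<exists>i. ennreal (c * (\<Sum>k\<le>i. fst (w k))) < (SUP (t, x)\<in>P. ennreal (U (snd (w i)) t / x))}
      = emeasure (field_law ?S I (max_stable_field U)) {g\<in>space (PiM I (\<lambda>_. borel)). \<exists>(t, x)\<in>P. ennreal (c * x) < g t}"
    (is "?l = emeasure _ ?A") if U: "random_field M I U" and c: "0 \<le> c" for U :: "'w \<Rightarrow> 't \<Rightarrow> real" and c
  proof -
    have mU [measurable]: "(\<lambda>\<omega>. U \<omega> t) \<in> borel_measurable M" if "t \<in> I" for t
      using U that by (auto simp: random_field_def)
    have mX [measurable]: "(\<lambda>w. max_stable_field U w t) \<in> borel_measurable ?S" if [simp]: "t \<in> I" for t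
      using mU by (intro measurable_max_stable_field) simp
    have mr: "(\<lambda>w. restrict (max_stable_field U w) I) \<in> ?S \<rightarrow>\<^sub>M PiM I (\<lambda>_. borel)"
      by (intro measurable_restrict mX)
    have cP: "countable P" using P by (auto intro: countable_finite)
    have mA: "?A \<in> sets (PiM I (\<lambda>_. borel))"
    proof -
      have "?A = (\<Union>(t, x)\<in>P. {g\<in>space (PiM I (\<lambda>_. borel)). ennreal (c * x) < g t})" by auto
      also have "\<dots> \<in> sets (PiM I (\<lambda>_. borel))"
      proof (rule sets.finite_UN[OF P(1)])
        fix p assume "p \<in> P"
        then have [measurable]: "(\<lambda>g. g (fst p)) \<in> borel_measurable (PiM I (\<lambda>_. borel :: ennreal measure))"
          using P by (intro measurable_component_singleton) auto
        show "(case p of (t, x) \<Rightarrow> {g\<in>space (PiM I (\<lambda>_. borel)). ennreal (c * x) < g t}) \<in> sets (PiM I (\<lambda>_. borel))"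
          unfolding case_prod_beta by measurable
      qed
      finally show ?thesis .
    qed
    have mS: "(\<lambda>\<omega>. SUP (t, x)\<in>P. ennreal (U \<omega> t / x)) \<in> borel_measurable M"
      using P cP by (intro borel_measurable_SUP) auto
    have "emeasure (field_law ?S I (max_stable_field U)) ?A
        = emeasure ?S {w\<in>space ?S. \<exists>(t, x)\<in>P. ennreal (c * x) < max_stable_field U w t}"
    proof -
      have "(\<lambda>w. restrict (max_stable_field U w) I) -` ?A \<inter> space ?S
          = {w\<in>space ?S. \<exists>(t, x)\<in>P. ennreal (c * x) < restrict (max_stable_field U w) I t}"
        by (auto simp: space_PiM)
      also have "\<dots> = {w\<in>space ?S. \<exists>(t, x)\<in>P. ennreal (c * x) < max_stable_field U w t}"
        using P(2) by (intro Collect_cong conj_cong bex_cong refl) auto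
      finally show ?thesis
        unfolding field_law_def by (simp only: emeasure_distr[OF mr mA])
    qed
    also have "\<dots> = ?l"
    proof (rule emeasure_eq_AE)
      show "AE w in ?S. w \<in> {w \<in> space ?S. \<exists>(t, x)\<in>P. ennreal (c * x) < max_stable_field U w t} \<longleftrightarrow>
         w \<in> {w\<in>space ?S. \<exists>i. ennreal (c * (\<Sum>k\<le>i. fst (w k))) < (SUP (t, x)\<in>P. ennreal (U (snd (w i)) t / x))}"
        using AE_max_stable_space_pos[OF assms(1)]
      proof eventually_elim
        case (elim w)
        have "(\<exists>(t, x)\<in>P. ennreal (c * x) < max_stable_field U w t)
          \<longleftrightarrow> (\<exists>i. ennreal (c * (\<Sum>k\<le>i. fst (w k))) < (SUP (t, x)\<in>P. ennreal (U (snd (w i)) t / x)))"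
          using elim P c by (intro exceeds_max_stable_field_iff) auto
        then show ?case by simp
      qed
      have "{w \<in> space ?S. \<exists>(t, x)\<in>P. ennreal (c * x) < max_stable_field U w t}
          = (\<Union>(t, x)\<in>P. {w \<in> space ?S. ennreal (c * x) < max_stable_field U w t})" by auto
      also have "\<dots> \<in> sets ?S"
      proof (rule sets.finite_UN[OF P(1)])
        fix p assume "p \<in> P"
        then have [measurable]: "(\<lambda>w. max_stable_field U w (fst p)) \<in> borel_measurable ?S"
          using P by (intro mX) auto
        show "(case p of (t, x) \<Rightarrow> {w \<in> space ?S. ennreal (c * x) < max_stable_field U w t}) \<in> sets ?S"
          unfolding case_prod_beta by measurable
      qed
      finally show "{w \<in> space ?S. \<exists>(t, x)\<in>P. ennreal (c * x) < max_stable_field U w t} \<in> sets ?S" .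
      show "{w\<in>space ?S. \<exists>i. ennreal (c * (\<Sum>k\<le>i. fst (w k))) < (SUP (t, x)\<in>P. ennreal (U (snd (w i)) t / x))} \<in> sets ?S"
      proof -
        have "{w\<in>space ?S. \<exists>i. ennreal (c * (\<Sum>k\<le>i. fst (w k))) < V (snd (w i))} \<in> sets ?S"
          if [measurable]: "V \<in> borel_measurable M" for V :: "'w \<Rightarrow> ennreal"
          by measurable
        from this[OF mS] show ?thesis .
      qed
    qed
    finally show ?thesis ..
  qed
  have lim: "(\<lambda>n. ennreal (Suc n) * emeasure (field_law ?S I (max_stable_field U))
        {g\<in>space (PiM I (\<lambda>_. borel)). \<exists>(t, x)\<in>P. ennreal (Suc n * x) < g t})
      \<longlonglongrightarrow> (\<integral>\<^sup>+\<omega>. (SUP (t, x)\<in>P. ennreal (U \<omega> t / x)) \<partial>M)"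
    if U: "random_field M I U" for U :: "'w \<Rightarrow> 't \<Rightarrow> real"
  proof -
    have "(\<lambda>\<omega>. SUP (t, x)\<in>P. ennreal (U \<omega> t / x)) \<in> borel_measurable M"
    proof (intro borel_measurable_SUP countable_finite P(1))
      fix p assume "p \<in> P"
      then have [measurable]: "(\<lambda>\<omega>. U \<omega> (fst p)) \<in> borel_measurable M"
        using P U by (auto simp: random_field_def)
      show "(\<lambda>\<omega>. case p of (t, x) \<Rightarrow> ennreal (U \<omega> t / x)) \<in> borel_measurable M"
        unfolding case_prod_beta by measurable
    qed
    from exceedance_limit[OF assms(1) this] show ?thesis
      by (simp only: field[OF U of_nat_0_le_iff])
  qed
  show ?thesis
    by (rule LIMSEQ_unique[OF lim[OF Y, unfolded law[unfolded spectral_field_on_def]] lim[OF Z]])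
qed

section \<open>The path space\<close>

lemma space_cadlag_algebra [simp]: "space cadlag_algebra = cadlag"
  by (simp add: cadlag_algebra_def space_restrict_space space_PiM)

lemma measurable_cadlag_algebraI:
  assumes "\<And>\<omega>. \<omega> \<in> space N \<Longrightarrow> f \<omega> \<in> cadlag" and "\<And>t. (\<lambda>\<omega>. f \<omega> t) \<in> borel_measurable N"
  shows "f \<in> N \<rightarrow>\<^sub>M cadlag_algebra"
  unfolding cadlag_algebra_def using assms
  by (intro measurable_restrict_space2 measurable_PiM_single') auto

lemma measurable_cadlag_eval: "(\<lambda>f. f t) \<in> borel_measurable cadlag_algebra"
  unfolding cadlag_algebra_def
  by (intro measurable_restrict_space1 measurable_component_singleton) simp

lemma measurable_cadlag_apply:
  assumes "f \<in> N \<rightarrow>\<^sub>M cadlag_algebra"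
  shows "(\<lambda>\<omega>. f \<omega> t) \<in> borel_measurable N"
  by (rule measurable_compose[OF assms measurable_cadlag_eval])

lemma cadlag_nonneg: "f \<in> cadlag \<Longrightarrow> 0 \<le> f t"
  by (simp add: cadlag_def)

lemma cadlag_zero [simp]: "(\<lambda>_. 0) \<in> cadlag"
  by (auto simp: cadlag_def)

lemma cadlag_scale:
  assumes "f \<in> cadlag" "0 \<le> c"
  shows "(\<lambda>t. c * f t) \<in> cadlag"
  unfolding cadlag_def mem_Collect_eq
proof (intro conjI allI)
  show "0 \<le> c * f t" for t using assms by (simp add: cadlag_nonneg)
  fix t I
  obtain l where "(f \<longlongrightarrow> l) (at t within quadrant I t)"
    using assms unfolding cadlag_def by blast
  then have "((\<lambda>t. c * f t) \<longlongrightarrow> c * l) (at t within quadrant I t)"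
    by (intro tendsto_mult tendsto_const)
  then show "\<exists>l. ((\<lambda>t. c * f t) \<longlongrightarrow> l) (at t within quadrant I t)" ..
next
  show "((\<lambda>t. c * f t) \<longlongrightarrow> c * f t) (at t within {s. \<forall>i. t $ i \<le> s $ i})" for t
    using assms by (intro tendsto_mult tendsto_const) (simp add: cadlag_def)
qed

lemma cadlag_divide: "f \<in> cadlag \<Longrightarrow> 0 \<le> s \<Longrightarrow> (\<lambda>t. f t / s) \<in> cadlag"
  using cadlag_scale[of f "inverse s"] by (simp add: divide_inverse mult.commute[of "inverse s"])

lemma tendsto_shift_within:
  fixes f :: "real ^ 'd::finite \<Rightarrow> real"
  assumes "(f \<longlongrightarrow> l) (at (t - h) within S)" and "(\<lambda>s. s - h) ` T \<subseteq> S"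
  shows "((\<lambda>s. f (s - h)) \<longlongrightarrow> l) (at t within T)"
proof -
  have "filterlim (\<lambda>s. s - h) (at (t - h) within S) (at t within T)"
    unfolding filterlim_at using assms(2)
    by (auto simp: eventually_at_filter intro!: always_eventually tendsto_intros)
  from filterlim_compose[OF assms(1) this] show ?thesis .
qed

lemma cadlag_shift:
  assumes "f \<in> cadlag"
  shows "(\<lambda>t. f (t - h)) \<in> cadlag"
  unfolding cadlag_def mem_Collect_eq
proof (intro conjI allI)
  show "0 \<le> f (t - h)" for t using assms by (simp add: cadlag_nonneg)
  fix t I
  obtain l where "(f \<longlongrightarrow> l) (at (t - h) within quadrant I (t - h))"
    using assms unfolding cadlag_def by blast
  then have "((\<lambda>t. f (t - h)) \<longlongrightarrow> l) (at t within quadrant I t)"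
    by (rule tendsto_shift_within) (auto simp: quadrant_def split: if_splits)
  then show "\<exists>l. ((\<lambda>t. f (t - h)) \<longlongrightarrow> l) (at t within quadrant I t)" ..
next
  fix t
  have "(f \<longlongrightarrow> f (t - h)) (at (t - h) within {s. \<forall>i. (t - h) $ i \<le> s $ i})"
    using assms unfolding cadlag_def by blast
  then show "((\<lambda>t. f (t - h)) \<longlongrightarrow> f (t - h)) (at t within {s. \<forall>i. t $ i \<le> s $ i})"
    by (rule tendsto_shift_within) auto
qed

lemma measurable_cadlag_shift:
  "(\<lambda>f t. f (t - h)) \<in> cadlag_algebra \<rightarrow>\<^sub>M cadlag_algebra"
  by (rule measurable_cadlag_algebraI) (auto simp: cadlag_shift measurable_cadlag_eval)

definition rat_point :: "nat \<Rightarrow> ('d::finite \<Rightarrow> int) \<Rightarrow> real ^ 'd" where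
  "rat_point n k = (\<chi> i. of_int (k i) / real (Suc n))"

definition rat_points :: "(real ^ 'd::finite) set" where
  "rat_points = range (\<lambda>(n, k). rat_point n k)"

text \<open>Rounding goes strictly upwards in every coordinate, so that the approximations
  differ from the point and approach it from the orthant in which paths are continuous.\<close>

definition round_up :: "nat \<Rightarrow> real ^ 'd::finite \<Rightarrow> real ^ 'd" where
  "round_up n t = rat_point n (\<lambda>i. \<lfloor>real (Suc n) * t $ i\<rfloor> + 1)"

lemma countable_rat_points: "countable rat_points"
  by (simp add: rat_points_def)

lemma round_up_in_rat_points: "round_up n t \<in> rat_points"
  by (auto simp: round_up_def rat_points_def)

lemma round_up_bounds: "t $ i < round_up n t $ i" "round_up n t $ i \<le> t $ i + 1 / real (Suc n)"
proof -
  have p: "real (Suc n) > 0" by simp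
  show "t $ i < round_up n t $ i"
    unfolding round_up_def rat_point_def using p
    by (simp add: pos_less_divide_eq mult.commute del: of_nat_Suc)
  have "round_up n t $ i \<le> (real (Suc n) * t $ i + 1) / real (Suc n)"
    unfolding round_up_def rat_point_def by (simp add: divide_right_mono del: of_nat_Suc)
  also have "\<dots> = t $ i + 1 / real (Suc n)" by (simp add: add_divide_distrib del: of_nat_Suc)
  finally show "round_up n t $ i \<le> t $ i + 1 / real (Suc n)" .
qed

lemma round_up_tendsto: "(\<lambda>n. round_up n t) \<longlonglongrightarrow> t"
proof (rule vec_tendstoI)
  fix i
  show "(\<lambda>n. round_up n t $ i) \<longlonglongrightarrow> t $ i"
  proof (rule tendsto_sandwich)
    show "(\<lambda>n. t $ i) \<longlonglongrightarrow> t $ i" by (rule tendsto_const)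
    have "(\<lambda>n. t $ i + 1 / real (Suc n)) \<longlonglongrightarrow> t $ i + 0"
      by (intro tendsto_add tendsto_const LIMSEQ_Suc[OF lim_const_over_n])
    then show "(\<lambda>n. t $ i + 1 / real (Suc n)) \<longlonglongrightarrow> t $ i" by simp
    show "\<forall>\<^sub>F n in sequentially. t $ i \<le> round_up n t $ i"
      by (intro always_eventually allI less_imp_le round_up_bounds)
    show "\<forall>\<^sub>F n in sequentially. round_up n t $ i \<le> t $ i + 1 / real (Suc n)"
      by (intro always_eventually allI round_up_bounds)
  qed
qed

lemma cadlag_round_up:
  assumes "f \<in> cadlag"
  shows "(\<lambda>n. f (round_up n t)) \<longlonglongrightarrow> f t"
proof -
  have "filterlim (\<lambda>n. round_up n t) (at t within {s. \<forall>i. t $ i \<le> s $ i}) sequentially"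
    unfolding filterlim_at
  proof (intro conjI round_up_tendsto always_eventually allI)
    fix n
    show "round_up n t \<in> {s. \<forall>i. t $ i \<le> s $ i}"
      using round_up_bounds(1)[of t _ n] by (auto intro: less_imp_le)
    show "round_up n t \<noteq> t" using round_up_bounds(1)[of t undefined n] by auto
  qed
  moreover have "(f \<longlongrightarrow> f t) (at t within {s. \<forall>i. t $ i \<le> s $ i})"
    using assms by (simp add: cadlag_def)
  ultimately show ?thesis by (rule filterlim_compose[rotated])
qed

lemma cadlag_eq_zeroI:
  assumes f: "f \<in> cadlag" and 0: "\<And>t. t \<in> rat_points \<Longrightarrow> f t = 0"
  shows "f = (\<lambda>_. 0)"
proof
  fix t
  have "(\<lambda>n. f (round_up n t)) = (\<lambda>n. 0)" using 0 round_up_in_rat_points by blast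
  then show "f t = 0" using cadlag_round_up[OF f, of t] LIMSEQ_unique[OF _ tendsto_const] by metis
qed

lemma measurable_round_up_index:
  "(\<lambda>t i. \<lfloor>real (Suc n) * t $ i\<rfloor> + 1) \<in> (borel :: (real ^ 'd::finite) measure) \<rightarrow>\<^sub>M count_space (UNIV :: ('d \<Rightarrow> int) set)"
proof (subst measurable_count_space_eq_countable, simp, intro conjI ballI)
  fix k :: "'d \<Rightarrow> int"
  have "(\<lambda>t i. \<lfloor>real (Suc n) * t $ i\<rfloor> + 1) -` {k} \<inter> space borel
      = {t \<in> space (borel :: (real ^ 'd) measure). \<forall>i\<in>UNIV. \<lfloor>real (Suc n) * t $ i\<rfloor> + 1 = k i}"
    by (auto simp: fun_eq_iff)
  also have "\<dots> \<in> sets borel" by measurable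
  finally show "(\<lambda>t i. \<lfloor>real (Suc n) * t $ i\<rfloor> + 1) -` {k} \<inter> space (borel :: (real ^ 'd) measure) \<in> sets borel" .
qed simp

text \<open>Right continuity makes a path recoverable from countably many of its values, so a random
  path is a jointly measurable field.\<close>

lemma measurable_cadlag_pair:
  "(\<lambda>(f, t). f t) \<in> borel_measurable (cadlag_algebra \<Otimes>\<^sub>M (borel :: (real ^ 'd::finite) measure))"
proof (rule borel_measurable_LIMSEQ_real)
  fix n
  have "(\<lambda>p. (\<lambda>k p. fst p (rat_point n k)) (\<lambda>i. \<lfloor>real (Suc n) * snd p $ i\<rfloor> + 1) p)
      \<in> borel_measurable (cadlag_algebra \<Otimes>\<^sub>M (borel :: (real ^ 'd) measure))"
  proof (rule measurable_compose_countable[where f = "\<lambda>k p. fst p (rat_point n k)"])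
    show "(\<lambda>p. (\<lambda>i. \<lfloor>real (Suc n) * snd p $ i\<rfloor> + 1))
        \<in> cadlag_algebra \<Otimes>\<^sub>M (borel :: (real ^ 'd) measure) \<rightarrow>\<^sub>M count_space UNIV"
      by (rule measurable_compose[OF measurable_snd measurable_round_up_index])
  qed (rule measurable_compose[OF measurable_fst measurable_cadlag_eval])
  then show "(\<lambda>p. fst p (round_up n (snd p))) \<in> borel_measurable (cadlag_algebra \<Otimes>\<^sub>M (borel :: (real ^ 'd) measure))"
    unfolding round_up_def .
next
  fix p :: "(real ^ 'd \<Rightarrow> real) \<times> (real ^ 'd)"
  assume "p \<in> space (cadlag_algebra \<Otimes>\<^sub>M borel)"
  then show "(\<lambda>n. fst p (round_up n (snd p))) \<longlonglongrightarrow> (case p of (f, t) \<Rightarrow> f t)"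
    by (auto simp: space_pair_measure intro: cadlag_round_up)
qed

lemma measurable_cadlag_field_pair:
  assumes "f \<in> N \<rightarrow>\<^sub>M cadlag_algebra" "g \<in> N \<rightarrow>\<^sub>M borel"
  shows "(\<lambda>\<omega>. f \<omega> (g \<omega>)) \<in> borel_measurable N"
  using measurable_compose[OF measurable_Pair[OF assms] measurable_cadlag_pair] unfolding prod.case .

section \<open>The exponent measure\<close>

abbreviation scales :: "real measure" where
  "scales \<equiv> restrict_space lborel {0<..}"

text \<open>The points \<open>\<Gamma>\<^sub>i\<close> form a Poisson process of unit intensity on the half-line, so this is the intensity of
  the process of the paths \<open>Z\<^sup>(\<^sup>i\<^sup>) / \<Gamma>\<^sub>i\<close> whose pointwise maximum is the max-stable field.\<close>

definition exponent_measure :: "'w measure \<Rightarrow> ('w \<Rightarrow> real ^ 'd::finite \<Rightarrow> real) \<Rightarrow> (real ^ 'd \<Rightarrow> real) measure" where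
  "exponent_measure M Z = distr (scales \<Otimes>\<^sub>M M) cadlag_algebra (\<lambda>(s, \<omega>) t. Z \<omega> t / s)"

lemma sets_exponent_measure [measurable_cong, simp]: "sets (exponent_measure M Z) = sets cadlag_algebra"
  by (simp add: exponent_measure_def)

lemma space_exponent_measure [simp]: "space (exponent_measure M Z) = cadlag"
  by (simp add: exponent_measure_def)

lemma measurable_fst_scales: "(\<lambda>p. fst p) \<in> borel_measurable (scales \<Otimes>\<^sub>M M)"
proof -
  have "(\<lambda>s. s) \<in> lborel \<rightarrow>\<^sub>M (borel::real measure)"
    by (rule measurable_ident_sets, rule sets_lborel)
  from measurable_compose[OF measurable_fst measurable_restrict_space1[OF this]] show ?thesis .
qed

lemma measurable_rescaled_field:
  assumes "Z \<in> M \<rightarrow>\<^sub>M cadlag_algebra"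
  shows "(\<lambda>(s, \<omega>) t. Z \<omega> t / s) \<in> scales \<Otimes>\<^sub>M M \<rightarrow>\<^sub>M cadlag_algebra"
proof (rule measurable_cadlag_algebraI)
  fix p assume p: "p \<in> space (scales \<Otimes>\<^sub>M M)"
  obtain s \<omega> where so: "p = (s, \<omega>)" by (cases p)
  then have "Z \<omega> \<in> cadlag" "0 < s"
    using p measurable_space[OF assms] by (auto simp: space_pair_measure space_restrict_space)
  then show "(case p of (s, \<omega>) \<Rightarrow> \<lambda>t. Z \<omega> t / s) \<in> cadlag"
    by (simp add: so cadlag_divide)
next
  fix t
  have [measurable]: "(\<lambda>\<omega>. Z \<omega> t) \<in> borel_measurable M" by (rule measurable_cadlag_apply[OF assms])
  have "(\<lambda>p. fst p) \<in> borel_measurable (scales \<Otimes>\<^sub>M M)"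
    by (rule measurable_fst_scales)
  moreover have "(\<lambda>p. Z (snd p) t) \<in> borel_measurable (scales \<Otimes>\<^sub>M M)"
    by (rule measurable_compose[OF measurable_snd measurable_cadlag_apply[OF assms]])
  ultimately show "(\<lambda>p. (case p of (s, \<omega>) \<Rightarrow> \<lambda>t. Z \<omega> t / s) t) \<in> borel_measurable (scales \<Otimes>\<^sub>M M)"
    unfolding case_prod_beta by (rule borel_measurable_divide[rotated])
qed

lemma nn_integral_exponent_measure:
  assumes "sigma_finite_measure M" "Z \<in> M \<rightarrow>\<^sub>M cadlag_algebra" and [measurable]: "\<Phi> \<in> borel_measurable cadlag_algebra"
  shows "(\<integral>\<^sup>+f. \<Phi> f \<partial>exponent_measure M Z) = (\<integral>\<^sup>+s\<in>{0<..}. (\<integral>\<^sup>+\<omega>. \<Phi> (\<lambda>t. Z \<omega> t / s) \<partial>M) \<partial>lborel)"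
proof -
  interpret sigma_finite_measure M by fact
  note [measurable] = measurable_rescaled_field[OF assms(2)]
  have "(\<integral>\<^sup>+f. \<Phi> f \<partial>exponent_measure M Z)
      = (\<integral>\<^sup>+p. \<Phi> ((\<lambda>(s, \<omega>) t. Z \<omega> t / s) p) \<partial>(scales \<Otimes>\<^sub>M M))"
    unfolding exponent_measure_def by (rule nn_integral_distr) measurable
  also have "\<dots> = (\<integral>\<^sup>+s. (\<integral>\<^sup>+\<omega>. \<Phi> ((\<lambda>(s, \<omega>) t. Z \<omega> t / s) (s, \<omega>)) \<partial>M) \<partial>scales)"
    by (rule nn_integral_fst[symmetric]) measurable
  finally show ?thesis by (simp add: nn_integral_restrict_space)
qed

lemma emeasure_exponent_measure:
  assumes "sigma_finite_measure M" "Z \<in> M \<rightarrow>\<^sub>M cadlag_algebra" and [measurable]: "A \<in> sets cadlag_algebra"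
  shows "emeasure (exponent_measure M Z) A
    = (\<integral>\<^sup>+s\<in>{0<..}. emeasure M {\<omega>\<in>space M. (\<lambda>t. Z \<omega> t / s) \<in> A} \<partial>lborel)"
proof -
  have "emeasure (exponent_measure M Z) A = (\<integral>\<^sup>+f. indicator A f \<partial>exponent_measure M Z)" by simp
  also have "\<dots> = (\<integral>\<^sup>+s\<in>{0<..}. (\<integral>\<^sup>+\<omega>. indicator A (\<lambda>t. Z \<omega> t / s) \<partial>M) \<partial>lborel)"
    by (rule nn_integral_exponent_measure[OF assms(1,2)]) measurable
  also have "\<dots> = (\<integral>\<^sup>+s\<in>{0<..}. emeasure M {\<omega>\<in>space M. (\<lambda>t. Z \<omega> t / s) \<in> A} \<partial>lborel)"
  proof (intro nn_integral_cong)
    fix s :: real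
    have "(\<integral>\<^sup>+\<omega>. indicator A (\<lambda>t. Z \<omega> t / s) \<partial>M) = emeasure M {\<omega>\<in>space M. (\<lambda>t. Z \<omega> t / s) \<in> A}" if "s > 0"
    proof -
      have "(\<lambda>\<omega> t. Z \<omega> t / s) \<in> M \<rightarrow>\<^sub>M cadlag_algebra"
        using measurable_compose[OF measurable_Pair1' measurable_rescaled_field[OF assms(2)], of s] that
        by (simp add: space_restrict_space)
      then have "{\<omega>\<in>space M. (\<lambda>t. Z \<omega> t / s) \<in> A} \<in> sets M" by measurable
      moreover have "(\<integral>\<^sup>+\<omega>. indicator A (\<lambda>t. Z \<omega> t / s) \<partial>M)
          = (\<integral>\<^sup>+\<omega>. indicator {\<omega>\<in>space M. (\<lambda>t. Z \<omega> t / s) \<in> A} \<omega> \<partial>M)"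
        by (rule nn_integral_cong) (simp add: indicator_def)
      ultimately show ?thesis by (simp only: nn_integral_indicator)
    qed
    then show "(\<integral>\<^sup>+\<omega>. indicator A (\<lambda>t. Z \<omega> t / s) \<partial>M) * indicator {0<..} s
       = emeasure M {\<omega>\<in>space M. (\<lambda>t. Z \<omega> t / s) \<in> A} * indicator {0<..} s"
      by (cases "0 < s") simp_all
  qed
  finally show ?thesis .
qed

lemma sets_exceed: "countable P \<Longrightarrow> {f\<in>cadlag. \<exists>(t, x)\<in>P. x < f t} \<in> sets cadlag_algebra"
proof -
  assume P: "countable P"
  have *: "{f\<in>space cadlag_algebra. x < f t} \<in> sets cadlag_algebra" for x and t :: "real ^ 'd::finite"
    using measurable_cadlag_eval[of t] by measurable
  have "{f\<in>cadlag. \<exists>(t, x)\<in>P. x < f t} = (\<Union>p\<in>P. {f\<in>space cadlag_algebra. snd p < f (fst p)})"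
    by (auto simp: case_prod_beta)
  also have "\<dots> \<in> sets cadlag_algebra"
    using P by (rule sets.countable_UN'') (rule *)
  finally show ?thesis .
qed

section \<open>The exponent measure determined by its exponents\<close>

lemma measurable_exponent_functional:
  assumes P: "finite P" and Z: "\<And>t. (\<lambda>\<omega>. Z \<omega> t) \<in> borel_measurable M"
  shows "(\<lambda>\<omega>. SUP (t, x)\<in>P. ennreal (Z \<omega> t / x)) \<in> borel_measurable M"
proof (intro borel_measurable_SUP countable_finite P)
  fix p assume "p \<in> P"
  show "(\<lambda>\<omega>. case p of (t, x) \<Rightarrow> ennreal (Z \<omega> t / x)) \<in> borel_measurable M"
    unfolding case_prod_beta using Z[of "fst p"] by measurable
qed

text \<open>The path \<open>Z / s\<close> exceeds one of the levels if and only if \<open>s\<close> is less than the largest \<open>Z t / x\<close>, and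
  integrating the indicator of this over \<open>s\<close> gives that value.\<close>

lemma emeasure_exponent_measure_exceed:
  assumes "prob_space M" "Z \<in> M \<rightarrow>\<^sub>M cadlag_algebra" and P: "finite P" "P \<subseteq> UNIV \<times> {0<..}"
  shows "emeasure (exponent_measure M Z) {f\<in>cadlag. \<exists>(t, x)\<in>P. x < f t}
    = (\<integral>\<^sup>+\<omega>. (SUP (t, x)\<in>P. ennreal (Z \<omega> t / x)) \<partial>M)"
proof -
  interpret prob_space M by fact
  have [measurable]: "(\<lambda>\<omega>. Z \<omega> t) \<in> borel_measurable M" for t by (rule measurable_cadlag_apply[OF assms(2)])
  let ?W = "\<lambda>\<omega>. (SUP (t, x)\<in>P. ennreal (Z \<omega> t / x))"
  have W: "?W \<in> borel_measurable M"
    by (rule measurable_exponent_functional[OF P(1)]) measurable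
  have *: "(\<lambda>t. Z \<omega> t / s) \<in> {f\<in>cadlag. \<exists>(t, x)\<in>P. x < f t} \<longleftrightarrow> ennreal s < ?W \<omega>"
    if "\<omega> \<in> space M" "0 < s" for \<omega> s
  proof -
    have "Z \<omega> \<in> cadlag" using measurable_space[OF assms(2) that(1)] by simp
    then have "(\<lambda>t. Z \<omega> t / s) \<in> cadlag" using that by (intro cadlag_divide) auto
    moreover have "snd p < Z \<omega> (fst p) / s \<longleftrightarrow> ennreal s < ennreal (Z \<omega> (fst p) / snd p)" if "p \<in> P" for p
    proof -
      have "0 < snd p" using P that by auto
      then show ?thesis using \<open>0 < s\<close> by (simp add: ennreal_less_iff field_simps)
    qed
    ultimately show ?thesis unfolding less_SUP_iff case_prod_beta by blast
  qed
  have "emeasure (exponent_measure M Z) {f\<in>cadlag. \<exists>(t, x)\<in>P. x < f t}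
      = (\<integral>\<^sup>+s\<in>{0<..}. emeasure M {\<omega>\<in>space M. (\<lambda>t. Z \<omega> t / s) \<in> {f\<in>cadlag. \<exists>(t, x)\<in>P. x < f t}} \<partial>lborel)"
    by (rule emeasure_exponent_measure[OF sigma_finite_measure_axioms assms(2) sets_exceed[OF countable_finite[OF P(1)]]])
  also have "\<dots> = (\<integral>\<^sup>+s\<in>{0<..}. emeasure M {\<omega>\<in>space M. ennreal s < ?W \<omega>} \<partial>lborel)"
  proof (rule nn_integral_cong)
    fix s :: real
    have "{\<omega>\<in>space M. (\<lambda>t. Z \<omega> t / s) \<in> {f\<in>cadlag. \<exists>(t, x)\<in>P. x < f t}} = {\<omega>\<in>space M. ennreal s < ?W \<omega>}" if "0 < s"
      using *[OF _ that] by (intro Collect_cong conj_cong refl)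
    then show "emeasure M {\<omega>\<in>space M. (\<lambda>t. Z \<omega> t / s) \<in> {f\<in>cadlag. \<exists>(t, x)\<in>P. x < f t}} * indicator {0<..} s
        = emeasure M {\<omega>\<in>space M. ennreal s < ?W \<omega>} * indicator {0<..} s"
      by (cases "0 < s") simp_all
  qed
  also have "\<dots> = (\<integral>\<^sup>+\<omega>. ?W \<omega> \<partial>M)" by (rule layer_cake[OF W])
  finally show ?thesis .
qed

lemma exponent_measure_exceed_finite:
  assumes "prob_space M" "Z \<in> M \<rightarrow>\<^sub>M cadlag_algebra" and P: "finite P" "P \<subseteq> UNIV \<times> {0<..}"
    and fin: "\<And>t. (\<integral>\<^sup>+\<omega>. ennreal (Z \<omega> t) \<partial>M) < \<infinity>"
  shows "emeasure (exponent_measure M Z) {f\<in>cadlag. \<exists>(t, x)\<in>P. x < f t} < \<infinity>"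
proof -
  have [measurable]: "(\<lambda>\<omega>. Z \<omega> t) \<in> borel_measurable M" for t by (rule measurable_cadlag_apply[OF assms(2)])
  have "emeasure (exponent_measure M Z) {f\<in>cadlag. \<exists>(t, x)\<in>P. x < f t}
      = (\<integral>\<^sup>+\<omega>. (SUP (t, x)\<in>P. ennreal (Z \<omega> t / x)) \<partial>M)"
    by (rule emeasure_exponent_measure_exceed[OF assms(1-4)])
  also have "\<dots> \<le> (\<integral>\<^sup>+\<omega>. (\<Sum>p\<in>P. ennreal (1 / snd p) * ennreal (Z \<omega> (fst p))) \<partial>M)"
  proof (intro nn_integral_mono SUP_least)
    fix \<omega> p assume "p \<in> P"
    then have "(case p of (t, x) \<Rightarrow> ennreal (Z \<omega> t / x)) = ennreal (1 / snd p) * ennreal (Z \<omega> (fst p))"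
      using P by (auto simp: case_prod_beta ennreal_mult'[symmetric])
    also have "\<dots> \<le> (\<Sum>p\<in>P. ennreal (1 / snd p) * ennreal (Z \<omega> (fst p)))"
      using P(1) \<open>p \<in> P\<close> by (intro member_le_sum) auto
    finally show "(case p of (t, x) \<Rightarrow> ennreal (Z \<omega> t / x)) \<le> (\<Sum>p\<in>P. ennreal (1 / snd p) * ennreal (Z \<omega> (fst p)))" .
  qed
  also have "\<dots> = (\<Sum>p\<in>P. ennreal (1 / snd p) * (\<integral>\<^sup>+\<omega>. ennreal (Z \<omega> (fst p)) \<partial>M))"
    by (simp add: nn_integral_sum nn_integral_cmult)
  also have "\<dots> < \<infinity>"
    using fin P(1) by (simp add: ennreal_mult_less_top)
  finally show ?thesis .
qed

lemma sets_cadlag_algebra_eq: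
  "sets cadlag_algebra = sigma_sets cadlag
     {{f \<in> cadlag. \<forall>(t, x)\<in>P. f t \<le> x} | P :: ((real ^ 'd::finite) \<times> real) set. finite P}"
  (is "_ = sigma_sets _ ?E")
proof
  have sub: "?E \<subseteq> Pow cadlag" by auto
  have "?E \<subseteq> sets cadlag_algebra"
  proof clarify
    fix P :: "((real ^ 'd) \<times> real) set" assume "finite P"
    have "{f \<in> cadlag. \<forall>(t, x)\<in>P. f t \<le> x} = cadlag - {f\<in>cadlag. \<exists>(t, x)\<in>P. x < f t}" by fastforce
    also have "\<dots> \<in> sets cadlag_algebra"
      using sets.Diff[OF sets.top[of cadlag_algebra] sets_exceed[OF countable_finite[OF \<open>finite P\<close>]]] by simp
    finally show "{f \<in> cadlag. \<forall>(t, x)\<in>P. f t \<le> x} \<in> sets cadlag_algebra" .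
  qed
  then show "sigma_sets cadlag ?E \<subseteq> sets cadlag_algebra"
    using sets.sigma_sets_subset[of ?E cadlag_algebra] by simp
  have id: "(\<lambda>f. f) \<in> sigma cadlag ?E \<rightarrow>\<^sub>M cadlag_algebra"
  proof (rule measurable_cadlag_algebraI)
    fix t :: "real ^ 'd"
    show "(\<lambda>f. f t) \<in> borel_measurable (sigma cadlag ?E)"
      unfolding borel_measurable_iff_le
    proof
      fix a
      have "{f \<in> space (sigma cadlag ?E). f t \<le> a} = {f \<in> cadlag. \<forall>(t, x)\<in>{(t, a)}. f t \<le> x}"
        using sub by (auto simp: space_measure_of)
      also have "\<dots> \<in> sigma_sets cadlag ?E"
        by (intro sigma_sets.Basic CollectI exI[of _ "{(t, a)}"]) auto
      finally show "{f \<in> space (sigma cadlag ?E). f t \<le> a} \<in> sets (sigma cadlag ?E)"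
        using sub by (simp add: sets_measure_of)
    qed
  qed (use sub in \<open>simp add: space_measure_of\<close>)
  show "sets cadlag_algebra \<subseteq> sigma_sets cadlag ?E"
  proof
    fix A :: "(real ^ 'd \<Rightarrow> real) set" assume A: "A \<in> sets cadlag_algebra"
    from measurable_sets[OF id A] sets.sets_into_space[OF A] sub
    show "A \<in> sigma_sets cadlag ?E" by (simp add: space_measure_of sets_measure_of Int_absorb2)
  qed
qed

text \<open>The sets \<open>{f. \<forall>(t, x)\<in>P. f t \<le> x}\<close> form a generator stable under intersection, but they have
  infinite measure; they are cut down to the finite-measure set of paths that exceed one of finitely
  many levels, where the difference of two sets of exceeding paths gives their measure. These sets
  exhaust the nonzero paths, hence the condition on \<open>\<Phi>\<close>.\<close>

lemma exponent_measure_eqI: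
  fixes Y Z :: "'w \<Rightarrow> real ^ 'd::finite \<Rightarrow> real"
  assumes "prob_space M" and mY: "Y \<in> M \<rightarrow>\<^sub>M cadlag_algebra" and mZ: "Z \<in> M \<rightarrow>\<^sub>M cadlag_algebra"
    and eq: "\<And>P. finite P \<Longrightarrow> P \<subseteq> UNIV \<times> {0<..} \<Longrightarrow>
      (\<integral>\<^sup>+\<omega>. (SUP (t, x)\<in>P. ennreal (Y \<omega> t / x)) \<partial>M) = (\<integral>\<^sup>+\<omega>. (SUP (t, x)\<in>P. ennreal (Z \<omega> t / x)) \<partial>M)"
    and fin: "\<And>t. (\<integral>\<^sup>+\<omega>. ennreal (Z \<omega> t) \<partial>M) < \<infinity>"
    and \<Phi>: "\<Phi> \<in> borel_measurable cadlag_algebra" "\<Phi> (\<lambda>_. 0) = 0"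
  shows "(\<integral>\<^sup>+f. \<Phi> f \<partial>exponent_measure M Y) = (\<integral>\<^sup>+f. \<Phi> f \<partial>exponent_measure M Z)"
proof -
  define U where "U P = {f\<in>cadlag. \<exists>(t, x)\<in>P. x < f t}" for P :: "((real ^ 'd) \<times> real) set"
  define C where "C P = {f\<in>cadlag. \<forall>(t, x)\<in>P. f t \<le> x}" for P :: "((real ^ 'd) \<times> real) set"
  let ?\<mu> = "exponent_measure M Y" and ?\<nu> = "exponent_measure M Z"
  have mU [measurable]: "U P \<in> sets cadlag_algebra" if "finite P" for P
    unfolding U_def using that by (intro sets_exceed countable_finite)
  have CU: "C P = cadlag - U P" for P unfolding C_def U_def by fastforce
  have mC: "C P \<in> sets cadlag_algebra" if "finite P" for P
    unfolding CU using sets.Diff[OF sets.top[of cadlag_algebra] mU[OF that]] by simp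
  have U_eq: "emeasure ?\<mu> (U P) = emeasure ?\<nu> (U P)" if "finite P" "P \<subseteq> UNIV \<times> {0<..}" for P
    unfolding U_def
    by (simp add: emeasure_exponent_measure_exceed[OF assms(1) mY that]
        emeasure_exponent_measure_exceed[OF assms(1) mZ that] eq[OF that])
  have U_fin: "emeasure ?\<nu> (U P) < \<infinity>" if "finite P" "P \<subseteq> UNIV \<times> {0<..}" for P
    unfolding U_def by (rule exponent_measure_exceed_finite[OF assms(1) mZ that fin])
  have CQ_pos: "emeasure ?\<mu> (C P \<inter> U Q) = emeasure ?\<nu> (C P \<inter> U Q)"
    if P: "finite P" "P \<subseteq> UNIV \<times> {0<..}" and Q: "finite Q" "Q \<subseteq> UNIV \<times> {0<..}" for P Q
  proof -
    have *: "C P \<inter> U Q = U (P \<union> Q) - U P" by (auto simp: CU U_def)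
    have PQ: "finite (P \<union> Q)" "P \<union> Q \<subseteq> UNIV \<times> {0<..}" using P Q by auto
    have diff: "emeasure \<kappa> (U (P \<union> Q) - U P) = emeasure \<kappa> (U (P \<union> Q)) - emeasure \<kappa> (U P)"
      if "sets \<kappa> = sets cadlag_algebra" "emeasure \<kappa> (U P) \<noteq> \<infinity>" for \<kappa>
    proof (rule emeasure_Diff[OF that(2)])
      show "U (P \<union> Q) \<in> sets \<kappa>" "U P \<in> sets \<kappa>"
        unfolding that(1) by (rule mU[OF PQ(1)], rule mU[OF P(1)])
      show "U P \<subseteq> U (P \<union> Q)" unfolding U_def by blast
    qed
    have "emeasure ?\<nu> (U P) \<noteq> \<infinity>" using U_fin[OF P] by simp
    then show ?thesis
      unfolding * using diff[of ?\<mu>] diff[of ?\<nu>] U_eq[OF P] U_eq[OF PQ] by simp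
  qed
  have CQ: "emeasure ?\<mu> (C P \<inter> U Q) = emeasure ?\<nu> (C P \<inter> U Q)"
    if P: "finite P" and Q: "finite Q" "Q \<subseteq> UNIV \<times> {0<..}" for P Q
  proof (cases "\<exists>(t, x)\<in>P. x < 0")
    case True
    then obtain t x where tx: "(t, x) \<in> P" "x < 0" by auto
    have "f \<notin> C P" for f
    proof
      assume "f \<in> C P"
      then have "f \<in> cadlag" "f t \<le> x" using tx(1) by (auto simp: C_def)
      with cadlag_nonneg[of f t] tx(2) show False by simp
    qed
    then have "C P = {}" by blast
    then show ?thesis by simp
  next
    case False
    \<comment> \<open>The exponents concern positive levels only; a level zero is approached from above.\<close>
    define P' where "P' n = (\<lambda>(t, x). (t, x + 1 / real (Suc n))) ` P" for n
    have P': "finite (P' n)" "P' n \<subseteq> UNIV \<times> {0<..}" for n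
    proof -
      show "finite (P' n)" using P by (simp add: P'_def)
      have "0 < x + 1 / real (Suc n)" if "(t, x) \<in> P" for t x
        using False that by (intro add_nonneg_pos) (auto simp: not_less)
      then show "P' n \<subseteq> UNIV \<times> {0<..}" by (auto simp: P'_def)
    qed
    have int: "C P \<inter> U Q = (\<Inter>n. C (P' n) \<inter> U Q)"
    proof -
      have "f t \<le> x \<longleftrightarrow> (\<forall>n. f t \<le> x + 1 / real (Suc n))" for f and t :: "real ^ 'd" and x :: real
      proof
        assume *: "\<forall>n. f t \<le> x + 1 / real (Suc n)"
        have "(\<lambda>n. x + 1 / real (Suc n)) \<longlonglongrightarrow> x + 0"
          by (intro tendsto_add tendsto_const LIMSEQ_Suc[OF lim_const_over_n])
        then show "f t \<le> x" using * by (intro LIMSEQ_le_const[of _ x "f t"]) auto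
      next
        assume "f t \<le> x"
        then show "\<forall>n. f t \<le> x + 1 / real (Suc n)" by (simp add: add_increasing2)
      qed
      note eq = this
      have "C P = (\<Inter>n. C (P' n))"
      proof -
        have "f \<in> C P \<longleftrightarrow> f \<in> cadlag \<and> (\<forall>p\<in>P. \<forall>n. f (fst p) \<le> snd p + 1 / real (Suc n))" for f
          unfolding eq[of f _ _, symmetric] by (auto simp: C_def case_prod_beta)
        moreover have "f \<in> C (P' n) \<longleftrightarrow> f \<in> cadlag \<and> (\<forall>p\<in>P. f (fst p) \<le> snd p + 1 / real (Suc n))" for f n
          by (auto simp: C_def P'_def case_prod_beta)
        ultimately show ?thesis by blast
      qed
      then show ?thesis by blast
    qed
    have dec: "decseq (\<lambda>n. C (P' n) \<inter> U Q)"
    proof (intro decseq_SucI)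
      fix n
      have "1 / real (Suc (Suc n)) \<le> 1 / real (Suc n)" by (intro divide_left_mono) auto
      then have "f t \<le> x + 1 / real (Suc n)" if "f t \<le> x + 1 / real (Suc (Suc n))" for f and t :: "real ^ 'd" and x
        using that by linarith
      then have "C (P' (Suc n)) \<subseteq> C (P' n)"
        unfolding C_def P'_def by auto
      then show "C (P' (Suc n)) \<inter> U Q \<subseteq> C (P' n) \<inter> U Q" by blast
    qed
    have lim: "(\<lambda>n. emeasure \<kappa> (C (P' n) \<inter> U Q)) \<longlonglongrightarrow> emeasure \<kappa> (C P \<inter> U Q)"
      if "sets \<kappa> = sets cadlag_algebra" "emeasure \<kappa> (U Q) < \<infinity>" for \<kappa>
      unfolding int
    proof (rule Lim_emeasure_decseq[OF _ dec])
      show "range (\<lambda>n. C (P' n) \<inter> U Q) \<subseteq> sets \<kappa>" using that mC[OF P'(1)] mU[OF Q(1)] by auto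
      show "emeasure \<kappa> (C (P' n) \<inter> U Q) \<noteq> \<infinity>" for n
        using that mU[OF Q(1)] emeasure_mono[of "C (P' n) \<inter> U Q" "U Q" \<kappa>] by (auto simp: top_unique)
    qed
    have "(\<lambda>n. emeasure ?\<mu> (C (P' n) \<inter> U Q)) \<longlonglongrightarrow> emeasure ?\<mu> (C P \<inter> U Q)"
      using U_fin[OF Q] U_eq[OF Q] by (intro lim) auto
    moreover have "(\<lambda>n. emeasure ?\<mu> (C (P' n) \<inter> U Q)) \<longlonglongrightarrow> emeasure ?\<nu> (C P \<inter> U Q)"
      unfolding CQ_pos[OF P' Q] using U_fin[OF Q] by (intro lim) auto
    ultimately show ?thesis by (rule LIMSEQ_unique)
  qed
  \<comment> \<open>A nonzero path exceeds \<open>1 / (n + 1)\<close> at one of the first \<open>n\<close> rational points for large \<open>n\<close>.\<close>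
  define Q where "Q n = (\<lambda>t. (t, 1 / real (Suc n))) ` from_nat_into (rat_points :: (real ^ 'd) set) ` {..n}" for n
  have Q: "finite (Q n)" "Q n \<subseteq> UNIV \<times> {0<..}" for n by (auto simp: Q_def)
  have dens: "density ?\<mu> (indicator (U (Q n))) = density ?\<nu> (indicator (U (Q n)))" (is "?M1 = ?M2") for n
  proof (rule measure_eqI_generator_eq[where \<Omega> = cadlag and A = "\<lambda>_. cadlag"])
    let ?E = "{{f \<in> cadlag. \<forall>(t, x)\<in>P. f t \<le> x} | P :: ((real ^ 'd) \<times> real) set. finite P}"
    show "Int_stable ?E"
    proof (rule Int_stableI)
      fix a b assume "a \<in> ?E" "b \<in> ?E"
      then obtain P P' where "finite P" "finite P'" "a = C P" "b = C P'" by (auto simp: C_def)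
      moreover have "C P \<inter> C P' = C (P \<union> P')" by (auto simp: C_def)
      ultimately show "a \<inter> b \<in> ?E" unfolding C_def by blast
    qed
    show "?E \<subseteq> Pow cadlag" by auto
    have em: "emeasure (density \<kappa> (indicator (U (Q n)))) (C P) = emeasure \<kappa> (C P \<inter> U (Q n))"
      if "finite P" "sets \<kappa> = sets cadlag_algebra" for P \<kappa>
      using that mU[OF Q(1)] mC[OF that(1)]
      by (subst emeasure_density)
         (auto simp: nn_integral_indicator[symmetric] indicator_inter_arith[symmetric] Int_commute simp del: nn_integral_indicator)
    show "emeasure ?M1 X = emeasure ?M2 X" if "X \<in> ?E" for X
    proof -
      from that obtain P where "finite P" "X = C P" by (auto simp: C_def)
      then show ?thesis using CQ[OF _ Q, of P n] by (simp add: em)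
    qed
    show "sets ?M1 = sigma_sets cadlag ?E" "sets ?M2 = sigma_sets cadlag ?E"
      by (simp_all add: sets_cadlag_algebra_eq)
    show "range (\<lambda>_. cadlag) \<subseteq> ?E" by (auto intro!: exI[of _ "{}"])
    have C0: "cadlag = C {}" by (auto simp: C_def)
    have "emeasure ?M1 cadlag = emeasure ?\<mu> (U (Q n))"
      unfolding C0 by (subst em) (simp_all add: C0[symmetric] U_def Int_absorb1)
    then show "emeasure ?M1 cadlag \<noteq> \<infinity>" using U_eq[OF Q, of n] U_fin[OF Q, of n] by simp
  qed auto
  have cut: "(\<integral>\<^sup>+f. \<Phi> f \<partial>\<kappa>) = (SUP n. (\<integral>\<^sup>+f. \<Phi> f \<partial>density \<kappa> (indicator (U (Q n)))))"
    if \<kappa>: "sets \<kappa> = sets cadlag_algebra" for \<kappa>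
  proof -
    have sp: "space \<kappa> = cadlag" using sets_eq_imp_space_eq[OF \<kappa>] by simp
    have [measurable]: "\<Phi> \<in> borel_measurable \<kappa>" "\<And>n. U (Q n) \<in> sets \<kappa>"
      using \<Phi> mU Q \<kappa> measurable_cong_sets[OF \<kappa> refl] by auto
    have UQ: "f \<in> U (Q n) \<longleftrightarrow> f \<in> cadlag \<and> (\<exists>m\<le>n. 1 / real (Suc n) < f (from_nat_into rat_points m))" for f n
      by (auto simp: U_def Q_def simp del: of_nat_Suc)
    have inc: "incseq (\<lambda>n. U (Q n))"
    proof (rule incseq_SucI)
      fix n
      have "1 / real (Suc (Suc n)) \<le> 1 / real (Suc n)" by (intro divide_left_mono) auto
      then have "1 / real (Suc (Suc n)) < f t" if "1 / real (Suc n) < f t" for f and t :: "real ^ 'd"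
        using that by linarith
      then show "U (Q n) \<subseteq> U (Q (Suc n))"
        using UQ by (metis le_SucI subsetI)
    qed
    have "(\<integral>\<^sup>+f. \<Phi> f \<partial>\<kappa>) = (\<integral>\<^sup>+f. (SUP n. indicator (U (Q n)) f * \<Phi> f) \<partial>\<kappa>)"
    proof (rule nn_integral_cong)
      fix f assume "f \<in> space \<kappa>"
      then have f: "f \<in> cadlag" by (simp add: sp)
      show "\<Phi> f = (SUP n. indicator (U (Q n)) f * \<Phi> f)"
      proof (cases "\<exists>n. f \<in> U (Q n)")
        case True
        then obtain n where "f \<in> U (Q n)" ..
        then show ?thesis
          by (intro antisym SUP_upper2[of n] SUP_least) (auto simp: indicator_def)
      next
        case False
        have "f t = 0" if "t \<in> rat_points" for t
        proof (rule ccontr)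
          assume "f t \<noteq> 0"
          then have "0 < f t" using cadlag_nonneg[OF f, of t] by simp
          then obtain n where n: "1 / real (Suc n) < f t" using nat_approx_posE by blast
          from that obtain m where m: "t = from_nat_into rat_points m"
            using from_nat_into_surj[OF countable_rat_points] by blast
          have "1 / real (Suc (max m n)) \<le> 1 / real (Suc n)" by (intro divide_left_mono) auto
          with n m have "f \<in> U (Q (max m n))" using f unfolding UQ by (intro conjI exI[of _ m]) auto
          with False show False by blast
        qed
        then have "f = (\<lambda>_. 0)" by (rule cadlag_eq_zeroI[OF f])
        then show ?thesis using \<Phi>(2) by simp
      qed
    qed
    also have "\<dots> = (SUP n. \<integral>\<^sup>+f. indicator (U (Q n)) f * \<Phi> f \<partial>\<kappa>)"
    proof (rule nn_integral_monotone_convergence_SUP)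
      show "incseq (\<lambda>n f. indicator (U (Q n)) f * \<Phi> f)"
        using incseq_SucD[OF inc]
        by (intro incseq_SucI le_funI mult_right_mono) (auto simp: indicator_def)
    qed measurable
    also have "\<dots> = (SUP n. (\<integral>\<^sup>+f. \<Phi> f \<partial>density \<kappa> (indicator (U (Q n)))))"
      by (simp add: nn_integral_density)
    finally show ?thesis .
  qed
  show ?thesis unfolding cut[OF sets_exponent_measure] dens ..
qed

text \<open>Stationarity says that the shifted field is a spectral field of the same max-stable field.\<close>

lemma exponent_measure_shift:
  fixes Z :: "'w \<Rightarrow> real ^ 'd::finite \<Rightarrow> real"
  assumes "prob_space M" and mZ: "Z \<in> M \<rightarrow>\<^sub>M cadlag_algebra"
    and st: "stationary (max_stable_space M) (max_stable_field Z)"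
    and fin: "\<And>t. (\<integral>\<^sup>+\<omega>. ennreal (Z \<omega> t) \<partial>M) < \<infinity>"
    and \<Phi> [measurable]: "\<Phi> \<in> borel_measurable cadlag_algebra" and \<Phi>0: "\<Phi> (\<lambda>_. 0) = 0"
  shows "(\<integral>\<^sup>+f. \<Phi> (\<lambda>t. f (t - h)) \<partial>exponent_measure M Z) = (\<integral>\<^sup>+f. \<Phi> f \<partial>exponent_measure M Z)"
proof -
  let ?Y = "\<lambda>\<omega> t. Z \<omega> (t - h)"
  interpret prob_space M by fact
  have mY: "?Y \<in> M \<rightarrow>\<^sub>M cadlag_algebra"
    by (rule measurable_compose[OF mZ measurable_cadlag_shift])
  have law: "spectral_field_on M Z UNIV ?Y"
    using st unfolding stationary_def spectral_field_on_def max_stable_field_def by simp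
  have "(\<integral>\<^sup>+f. \<Phi> f \<partial>exponent_measure M Z) = (\<integral>\<^sup>+f. \<Phi> f \<partial>exponent_measure M ?Y)"
    by (rule exponent_measure_eqI[symmetric, OF assms(1) mY mZ _ fin \<Phi> \<Phi>0])
       (rule spectral_field_on_exponent[OF assms(1) _ _ law],
        auto simp: random_field_def intro: measurable_cadlag_apply[OF mZ])
  also have "\<dots> = (\<integral>\<^sup>+s\<in>{0<..}. (\<integral>\<^sup>+\<omega>. \<Phi> (\<lambda>t. Z \<omega> (t - h) / s) \<partial>M) \<partial>lborel)"
    by (rule nn_integral_exponent_measure[OF sigma_finite_measure_axioms mY \<Phi>])
  also have "\<dots> = (\<integral>\<^sup>+f. \<Phi> (\<lambda>t. f (t - h)) \<partial>exponent_measure M Z)"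
    by (rule nn_integral_exponent_measure[symmetric, OF sigma_finite_measure_axioms mZ measurable_compose[OF measurable_cadlag_shift \<Phi>]])
  finally show ?thesis ..
qed

section \<open>Lattice cells and windows\<close>

text \<open>The side of the cells that tile the space. In the continuum unit cells are an arbitrary choice.\<close>

definition mesh :: "real \<Rightarrow> real" where
  "mesh \<delta> = (if \<delta> = 0 then 1 else \<delta>)"

definition lattice_point :: "real \<Rightarrow> ('d::finite \<Rightarrow> int) \<Rightarrow> real ^ 'd" where
  "lattice_point L k = (\<chi> i. L * of_int (k i))"

definition cell :: "real \<Rightarrow> ('d::finite \<Rightarrow> int) \<Rightarrow> (real ^ 'd) set" where
  "cell L k = {t. \<forall>i. L * of_int (k i) \<le> t $ i \<and> t $ i < L * (of_int (k i) + 1)}"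

lemma mesh_pos: "0 \<le> \<delta> \<Longrightarrow> 0 < mesh \<delta>"
  by (simp add: mesh_def)

lemma lattice_point_nth [simp]: "lattice_point L k $ i = L * of_int (k i)"
  by (simp add: lattice_point_def)

lemma lattice_point_in_grid: "lattice_point (mesh \<delta>) k \<in> grid \<delta>"
  by (auto simp: grid_def mesh_def)

lemma bij_betw_lattice_point: "\<delta> > 0 \<Longrightarrow> bij_betw (lattice_point \<delta>) UNIV (grid \<delta>)"
proof (rule bij_betwI')
  fix t :: "real ^ 'd" assume "\<delta> > 0" "t \<in> grid \<delta>"
  then have "\<forall>i. \<exists>k::int. t $ i = \<delta> * of_int k" by (simp add: grid_def)
  then obtain k where "\<forall>i. t $ i = \<delta> * of_int (k i)" by metis
  then show "\<exists>k\<in>UNIV. t = lattice_point \<delta> k" by (auto simp: vec_eq_iff)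
qed (auto simp: vec_eq_iff fun_eq_iff grid_def)

lemma in_cell_iff: "0 < L \<Longrightarrow> t \<in> cell L k \<longleftrightarrow> k = (\<lambda>i. \<lfloor>t $ i / L\<rfloor>)"
proof -
  assume L: "0 < L"
  have "L * of_int (k i) \<le> t $ i \<and> t $ i < L * (of_int (k i) + 1) \<longleftrightarrow> \<lfloor>t $ i / L\<rfloor> = k i" for i
    using L by (simp add: floor_eq_iff field_simps)
  then show ?thesis by (auto simp: cell_def fun_eq_iff)
qed

lemma UN_cell: "0 < L \<Longrightarrow> (\<Union>k. cell L k) = UNIV"
  by (auto simp: in_cell_iff)

lemma sets_cell [measurable, simp]:
  fixes k :: "'d::finite \<Rightarrow> int"
  shows "cell L k \<in> sets borel"
proof -
  have "cell L k = {t \<in> space (borel :: (real ^ 'd) measure). \<forall>i\<in>UNIV. L * of_int (k i) \<le> t $ i \<and> t $ i < L * (of_int (k i) + 1)}"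
    by (auto simp: cell_def)
  also have "\<dots> \<in> sets borel" by measurable
  finally show ?thesis .
qed

lemma cell_translate: "t + lattice_point L k \<in> cell L j \<longleftrightarrow> t \<in> cell L (\<lambda>i. j i - k i)"
  by (auto simp: cell_def algebra_simps)

lemma sets_cube [measurable, simp]: "(cube T :: (real ^ 'd::finite) set) \<in> sets borel"
proof -
  have "(cube T :: (real ^ 'd) set) = {t \<in> space (borel :: (real ^ 'd) measure). \<forall>i\<in>UNIV. 0 \<le> t $ i \<and> t $ i \<le> T}"
    by (auto simp: cube_def)
  also have "\<dots> \<in> sets borel" by measurable
  finally show ?thesis .
qed

text \<open>As a Borel measure on the whole space, the reference measure allows the lattices and the continuum
  to be instances of one situation: a measure that is invariant under the lattice and gives each cell its
  volume.\<close>

definition grid_measure :: "real \<Rightarrow> (real ^ 'd::finite) measure" where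
  "grid_measure \<delta> = distr (lam \<delta>) borel (\<lambda>t. t)"

lemma sets_grid_measure [measurable_cong, simp]: "sets (grid_measure \<delta>) = sets borel"
  by (simp add: grid_measure_def)

lemma space_grid_measure [simp]: "space (grid_measure \<delta>) = UNIV"
  by (simp add: grid_measure_def)

lemma space_lam: "space (lam \<delta>) = grid \<delta>"
  by (simp add: lam_def grid_def space_scale_measure)

lemma measurable_lam_ident: "(\<lambda>t. t) \<in> lam \<delta> \<rightarrow>\<^sub>M (borel :: (real ^ 'd::finite) measure)"
proof (cases "\<delta> = 0")
  case True
  show ?thesis unfolding lam_def if_P[OF True] by (rule measurable_ident_sets) simp
next
  case False
  show ?thesis unfolding lam_def if_not_P[OF False]
    by (subst measurable_cong_sets[OF sets_scale_measure refl]) simp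
qed

lemma nn_integral_grid_measure:
  "g \<in> borel_measurable borel \<Longrightarrow> (\<integral>\<^sup>+t. g t \<partial>grid_measure \<delta>) = (\<integral>\<^sup>+t. g t \<partial>lam \<delta>)"
  unfolding grid_measure_def by (rule nn_integral_distr[OF measurable_lam_ident]) simp

lemma grid_measure_0: "grid_measure 0 = lborel"
  unfolding grid_measure_def lam_def by (simp add: distr_id2)

lemma nn_integral_grid_measure_pos:
  assumes "\<delta> > 0" and [measurable]: "g \<in> borel_measurable borel"
  shows "(\<integral>\<^sup>+t. g t \<partial>(grid_measure \<delta> :: (real ^ 'd::finite) measure))
    = ennreal (\<delta> ^ CARD('d)) * (\<integral>\<^sup>+k. g (lattice_point \<delta> k) \<partial>count_space UNIV)"
proof -
  have "(\<integral>\<^sup>+t. g t \<partial>(grid_measure \<delta> :: (real ^ 'd) measure))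
      = (\<integral>\<^sup>+t. g t \<partial>scale_measure (ennreal (\<delta> ^ CARD('d))) (count_space (grid \<delta>)))"
    using assms by (simp add: nn_integral_grid_measure lam_def)
  also have "\<dots> = ennreal (\<delta> ^ CARD('d)) * (\<integral>\<^sup>+t. g t \<partial>count_space (grid \<delta>))"
    by (rule nn_integral_scale_measure) simp
  also have "(\<integral>\<^sup>+t. g t \<partial>count_space (grid \<delta>)) = (\<integral>\<^sup>+k. g (lattice_point \<delta> k) \<partial>count_space UNIV)"
    by (rule nn_integral_bij_count_space[symmetric, OF bij_betw_lattice_point[OF assms(1)]])
  finally show ?thesis .
qed

lemma emeasure_lborel_cell:
  fixes k :: "'d::finite \<Rightarrow> int"
  assumes L: "0 < L"
  shows "emeasure lborel (cell L k) = ennreal (L ^ CARD('d))"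
proof -
  let ?a = "\<chi> i. L * of_int (k i) :: real ^ 'd" and ?b = "\<chi> i. L * (of_int (k i) + 1) :: real ^ 'd"
  have le: "\<forall>b\<in>Basis. ?a \<bullet> b \<le> ?b \<bullet> b" using L by (auto simp: Basis_vec_def inner_axis)
  have "(\<Prod>b\<in>Basis. (?b - ?a) \<bullet> b) = (\<Prod>b\<in>(Basis :: (real ^ 'd) set). L)"
    by (rule prod.cong) (auto simp: Basis_vec_def inner_axis distrib_left)
  then have prod: "(\<Prod>b\<in>Basis. (?b - ?a) \<bullet> b) = L ^ CARD('d)" by simp
  have "box ?a ?b \<subseteq> cell L k" "cell L k \<subseteq> cbox ?a ?b"
    by (auto simp: cell_def mem_box_cart less_imp_le)
  then have "emeasure lborel (box ?a ?b) \<le> emeasure lborel (cell L k)"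
      "emeasure lborel (cell L k) \<le> emeasure lborel (cbox ?a ?b)"
    by (auto intro!: emeasure_mono)
  then show ?thesis
    using le prod by (simp add: emeasure_lborel_box_eq emeasure_lborel_cbox_eq)
qed

lemma emeasure_grid_measure_cell:
  fixes k :: "'d::finite \<Rightarrow> int"
  assumes "0 \<le> \<delta>"
  shows "emeasure (grid_measure \<delta>) (cell (mesh \<delta>) k) = ennreal (mesh \<delta> ^ CARD('d))"
proof (cases "\<delta> = 0")
  case True
  then show ?thesis by (simp add: grid_measure_0 mesh_def emeasure_lborel_cell)
next
  case False
  then have \<delta>: "\<delta> > 0" using assms by simp
  have "lattice_point \<delta> j \<in> cell \<delta> k \<longleftrightarrow> j = k" for j
    using \<delta> by (auto simp: in_cell_iff)
  then have "(\<integral>\<^sup>+j. indicator (cell \<delta> k) (lattice_point \<delta> j) \<partial>count_space UNIV) = (\<integral>\<^sup>+j. indicator {k} j \<partial>count_space UNIV)"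
    by (intro nn_integral_cong) (simp add: indicator_def)
  also have "\<dots> = 1" by simp
  finally have "emeasure (grid_measure \<delta>) (cell \<delta> k) = ennreal (\<delta> ^ CARD('d))"
    using \<delta> nn_integral_grid_measure_pos[OF \<delta>, of "indicator (cell \<delta> k)"] by simp
  then show ?thesis using False by (simp add: mesh_def)
qed

lemma sigma_finite_grid_measure: "0 \<le> \<delta> \<Longrightarrow> sigma_finite_measure (grid_measure \<delta> :: (real ^ 'd::finite) measure)"
proof
  assume \<delta>: "0 \<le> \<delta>"
  show "\<exists>A. countable A \<and> A \<subseteq> sets (grid_measure \<delta> :: (real ^ 'd) measure) \<and> \<Union> A = space (grid_measure \<delta>) \<and>
      (\<forall>a\<in>A. emeasure (grid_measure \<delta>) a \<noteq> \<infinity>)"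
    using UN_cell[OF mesh_pos[OF \<delta>]]
    by (intro exI[of _ "range (cell (mesh \<delta>))"]) (auto simp: emeasure_grid_measure_cell[OF \<delta>])
qed

lemma nn_integral_grid_measure_shift:
  fixes h :: "real ^ 'd::finite"
  assumes "0 \<le> \<delta>" and h: "h \<in> grid \<delta>" and [measurable]: "g \<in> borel_measurable borel"
  shows "(\<integral>\<^sup>+t. g (t + h) \<partial>grid_measure \<delta>) = (\<integral>\<^sup>+t. g t \<partial>grid_measure \<delta>)"
proof (cases "\<delta> = 0")
  case True
  have "(\<integral>\<^sup>+t. g t \<partial>lborel) = (\<integral>\<^sup>+t. g t \<partial>distr lborel borel ((+) h))"
    by (simp add: lborel_distr_plus)
  also have "\<dots> = (\<integral>\<^sup>+t. g (h + t) \<partial>lborel)" by (rule nn_integral_distr) measurable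
  finally show ?thesis by (simp add: True grid_measure_0 add.commute)
next
  case False
  then have \<delta>: "\<delta> > 0" using assms by simp
  from h obtain j where j: "h = lattice_point \<delta> j"
    using bij_betw_lattice_point[OF \<delta>] by (auto simp: bij_betw_def)
  have bij: "bij_betw (\<lambda>k i. k i + j i) (UNIV :: ('d \<Rightarrow> int) set) UNIV"
    by (rule bij_betw_byWitness[where f' = "\<lambda>k i. k i - j i"]) auto
  have "lattice_point \<delta> k + h = lattice_point \<delta> (\<lambda>i. k i + j i)" for k
    by (simp add: vec_eq_iff j distrib_left)
  then show ?thesis
    using nn_integral_bij_count_space[OF bij, of "\<lambda>k. g (lattice_point \<delta> k)"]
    by (simp add: nn_integral_grid_measure_pos[OF \<delta>])
qed

definition exceed_mass :: "real \<Rightarrow> (real ^ 'd::finite) set \<Rightarrow> (real ^ 'd \<Rightarrow> real) \<Rightarrow> ennreal" where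
  "exceed_mass \<delta> A f = emeasure (grid_measure \<delta>) {t\<in>A. 1 < f t}"

lemma borel_measurable_cadlag: "f \<in> cadlag \<Longrightarrow> f \<in> borel_measurable (borel :: (real ^ 'd::finite) measure)"
proof -
  assume "f \<in> cadlag"
  then have "(\<lambda>t. f) \<in> (borel :: (real ^ 'd) measure) \<rightarrow>\<^sub>M cadlag_algebra" by simp
  from measurable_cadlag_field_pair[OF this measurable_ident_sets[OF refl]] show ?thesis .
qed

lemma sets_exceed_level:
  assumes "f \<in> cadlag" "A \<in> sets borel"
  shows "{t\<in>A. c < f t} \<in> sets borel"
proof -
  have [measurable]: "f \<in> borel_measurable borel" by (rule borel_measurable_cadlag[OF assms(1)])
  have "{t\<in>A. c < f t} = A \<inter> {t\<in>space borel. c < f t}" by auto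
  also have "\<dots> \<in> sets borel" using assms(2) by measurable
  finally show ?thesis .
qed

lemma excursion_eq:
  assumes f: "f \<in> cadlag" and A: "A \<in> sets borel"
  shows "excursion \<delta> A f s = emeasure (grid_measure \<delta>) {t\<in>A. s < f t}"
proof -
  have S: "{t\<in>A. s < f t} \<in> sets borel" by (rule sets_exceed_level[OF f A])
  have "excursion \<delta> A f s = (\<integral>\<^sup>+t. indicator {t\<in>A. s < f t} t \<partial>lam \<delta>)"
    unfolding excursion_def
    by (intro nn_integral_cong) (auto simp: indicator_def space_lam)
  also have "\<dots> = (\<integral>\<^sup>+t. indicator {t\<in>A. s < f t} t \<partial>grid_measure \<delta>)"
    by (rule nn_integral_grid_measure[symmetric, OF borel_measurable_indicator[OF S]])
  also have "\<dots> = emeasure (grid_measure \<delta>) {t\<in>A. s < f t}"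
    by (rule nn_integral_indicator) (simp only: sets_grid_measure S)
  finally show ?thesis .
qed

lemma measurable_cadlag_emeasure:
  assumes "0 \<le> \<delta>" "A \<in> sets borel"
  shows "(\<lambda>f. emeasure (grid_measure \<delta>) {t\<in>A. c < f t}) \<in> borel_measurable (cadlag_algebra :: (real ^ 'd::finite \<Rightarrow> real) measure)"
proof -
  interpret sigma_finite_measure "grid_measure \<delta> :: (real ^ 'd) measure"
    by (rule sigma_finite_grid_measure[OF assms(1)])
  let ?P = "cadlag_algebra \<Otimes>\<^sub>M (grid_measure \<delta> :: (real ^ 'd) measure)"
  let ?Q = "{p \<in> space ?P. snd p \<in> A \<and> c < fst p (snd p)}"
  have [measurable]: "(\<lambda>p. fst p (snd p)) \<in> borel_measurable ?P"
    by (rule measurable_cadlag_field_pair[OF measurable_fst])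
       (rule measurable_compose[OF measurable_snd measurable_ident_sets], simp)
  have [measurable]: "A \<in> sets (grid_measure \<delta>)" using assms(2) by simp
  have "?Q \<in> sets ?P" by measurable
  from measurable_emeasure_Pair[OF this]
  have "(\<lambda>f. emeasure (grid_measure \<delta>) (Pair f -` ?Q)) \<in> borel_measurable cadlag_algebra" .
  moreover have "Pair f -` ?Q = {t\<in>A. c < f t}" if "f \<in> cadlag" for f
    using that by (auto simp: space_pair_measure)
  ultimately show ?thesis
    by (subst measurable_cong[of _ _ "\<lambda>f. emeasure (grid_measure \<delta>) (Pair f -` ?Q)"]) simp_all
qed

lemma measurable_exceed_mass:
  "0 \<le> \<delta> \<Longrightarrow> A \<in> sets borel \<Longrightarrow> exceed_mass \<delta> A \<in> borel_measurable cadlag_algebra"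
  unfolding exceed_mass_def[abs_def] by (rule measurable_cadlag_emeasure)

abbreviation exceed_event :: "real \<Rightarrow> real \<Rightarrow> (real ^ 'd::finite) set \<Rightarrow> (real ^ 'd \<Rightarrow> real) set" where
  "exceed_event \<delta> x A \<equiv> {f\<in>cadlag. ennreal x < exceed_mass \<delta> A f}"

lemma sets_exceed_event:
  assumes "0 \<le> \<delta>" "A \<in> sets borel"
  shows "exceed_event \<delta> x A \<in> sets cadlag_algebra"
proof -
  have [measurable]: "exceed_mass \<delta> A \<in> borel_measurable cadlag_algebra"
    by (rule measurable_exceed_mass[OF assms])
  have "{f\<in>space cadlag_algebra. ennreal x < exceed_mass \<delta> A f} \<in> sets cadlag_algebra" by measurable
  then show ?thesis by simp
qed

lemma exceed_mass_shift:
  fixes h :: "real ^ 'd::finite"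
  assumes "0 \<le> \<delta>" and h: "h \<in> grid \<delta>" and f: "f \<in> cadlag" and A: "A \<in> sets borel"
  shows "exceed_mass \<delta> A (\<lambda>t. f (t - h)) = exceed_mass \<delta> {t. t + h \<in> A} f"
proof -
  let ?B = "{t\<in>A. 1 < f (t - h)}"
  have B: "?B \<in> sets borel" by (rule sets_exceed_level[OF cadlag_shift[OF f] A])
  have B': "{t. t + h \<in> ?B} \<in> sets borel"
  proof -
    have "(\<lambda>t. t + h) \<in> borel \<rightarrow>\<^sub>M borel" by measurable
    from measurable_sets[OF this B] show ?thesis by (simp add: vimage_def)
  qed
  have "exceed_mass \<delta> A (\<lambda>t. f (t - h)) = (\<integral>\<^sup>+t. indicator ?B t \<partial>grid_measure \<delta>)"
    unfolding exceed_mass_def by (rule nn_integral_indicator[symmetric]) (simp only: sets_grid_measure B)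
  also have "\<dots> = (\<integral>\<^sup>+t. indicator ?B (t + h) \<partial>grid_measure \<delta>)"
    by (rule nn_integral_grid_measure_shift[symmetric, OF assms(1) h borel_measurable_indicator[OF B]])
  also have "\<dots> = (\<integral>\<^sup>+t. indicator {t. t + h \<in> ?B} t \<partial>grid_measure \<delta>)"
    by (intro nn_integral_cong) (simp add: indicator_def)
  also have "\<dots> = exceed_mass \<delta> {t. t + h \<in> A} f"
  proof -
    have "{t. t + h \<in> ?B} = {t \<in> {t. t + h \<in> A}. 1 < f t}" by auto
    then show ?thesis
      unfolding exceed_mass_def using B' by (subst nn_integral_indicator) (simp_all only: sets_grid_measure)
  qed
  finally show ?thesis .
qed

text \<open>The cells without exceedances are countably many and contribute a null set, so only what the
  window covers of the other cells counts.\<close>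

lemma exceed_mass_mono_cells:
  assumes "0 \<le> \<delta>" and f: "f \<in> cadlag" and A: "A \<in> sets borel" and B: "B \<in> sets borel"
    and null: "\<And>j t. t \<in> A \<Longrightarrow> t \<notin> B \<Longrightarrow> t \<in> cell (mesh \<delta>) j \<Longrightarrow> exceed_mass \<delta> (cell (mesh \<delta>) j) f = 0"
  shows "exceed_mass \<delta> A f \<le> exceed_mass \<delta> B f"
proof -
  let ?J = "{j. exceed_mass \<delta> (cell (mesh \<delta>) j) f = 0}"
  let ?N = "\<Union>j\<in>?J. {t\<in>cell (mesh \<delta>) j. 1 < f t}"
  have N: "?N \<in> null_sets (grid_measure \<delta>)"
  proof (rule null_sets_UN')
    fix j assume "j \<in> ?J"
    then show "{t\<in>cell (mesh \<delta>) j. 1 < f t} \<in> null_sets (grid_measure \<delta>)"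
      using sets_exceed_level[OF f sets_cell, of "mesh \<delta>" j 1]
      by (intro null_setsI) (simp_all add: exceed_mass_def)
  qed simp
  have mB: "{t\<in>B. 1 < f t} \<in> sets (grid_measure \<delta>)" using sets_exceed_level[OF f B, of 1] by simp
  have "{t\<in>A. 1 < f t} \<subseteq> {t\<in>B. 1 < f t} \<union> ?N"
  proof
    fix t assume t: "t \<in> {t\<in>A. 1 < f t}"
    have "t \<in> cell (mesh \<delta>) (\<lambda>i. \<lfloor>t $ i / mesh \<delta>\<rfloor>)"
      by (simp add: in_cell_iff[OF mesh_pos[OF assms(1)]])
    with null[of t] t show "t \<in> {t\<in>B. 1 < f t} \<union> ?N" by blast
  qed
  then have "emeasure (grid_measure \<delta>) {t\<in>A. 1 < f t} \<le> emeasure (grid_measure \<delta>) ({t\<in>B. 1 < f t} \<union> ?N)"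
    by (rule emeasure_mono) (rule sets.Un[OF mB null_setsD2[OF N]])
  then have "exceed_mass \<delta> A f \<le> emeasure (grid_measure \<delta>) ({t\<in>B. 1 < f t} \<union> ?N)"
    by (simp only: exceed_mass_def)
  also have "\<dots> = exceed_mass \<delta> B f"
    using emeasure_Un_null_set[OF mB N] by (simp only: exceed_mass_def)
  finally show ?thesis .
qed

section \<open>Counting windows\<close>

lemma emeasure_count_box:
  "emeasure (count_space UNIV) {k :: 'd::finite \<Rightarrow> int. \<forall>i. a i \<le> k i \<and> k i < a i + c} = ennreal (max 0 (of_int c) ^ CARD('d))"
proof -
  have eq: "{k :: 'd \<Rightarrow> int. \<forall>i. a i \<le> k i \<and> k i < a i + c} = PiE UNIV (\<lambda>i. {a i..<a i + c})"
    by (auto simp: PiE_UNIV_domain)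
  have "card (PiE UNIV (\<lambda>i::'d. {a i..<a i + c})) = nat c ^ CARD('d)"
    by (subst card_PiE) simp_all
  moreover have "finite (PiE UNIV (\<lambda>i::'d. {a i..<a i + c}))" by (intro finite_PiE) auto
  moreover have "real (nat c) = max 0 (of_int c)" by simp
  ultimately show ?thesis unfolding eq
    by (subst emeasure_count_space_finite) (auto simp: ennreal_of_nat_eq_real_of_nat)
qed

lemma floor_div_asymp:
  fixes L :: real
  assumes L: "0 < L"
  shows "((\<lambda>T. (max 0 (of_int (\<lfloor>T / L\<rfloor> + c)) / T) ^ d) \<longlongrightarrow> (1 / L) ^ d) at_top"
proof -
  have inv: "((\<lambda>T::real. a / T) \<longlongrightarrow> 0) at_top" for a :: real
    by (intro tendsto_divide_0[OF tendsto_const] filterlim_at_top_imp_at_infinity filterlim_ident)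
  have "((\<lambda>T. of_int (\<lfloor>T / L\<rfloor> + c) / T) \<longlongrightarrow> 1 / L) at_top"
  proof (rule tendsto_sandwich)
    show "\<forall>\<^sub>F T in at_top. 1 / L + (of_int c - 1) / T \<le> of_int (\<lfloor>T / L\<rfloor> + c) / T"
      using eventually_gt_at_top[of 0]
    proof eventually_elim
      case (elim T)
      have "T / L + (of_int c - 1) \<le> of_int (\<lfloor>T / L\<rfloor> + c)" by simp
      then have "(T / L + (of_int c - 1)) / T \<le> of_int (\<lfloor>T / L\<rfloor> + c) / T" using elim by (intro divide_right_mono) auto
      then show ?case using elim L by (simp add: add_divide_distrib)
    qed
    show "\<forall>\<^sub>F T in at_top. of_int (\<lfloor>T / L\<rfloor> + c) / T \<le> 1 / L + of_int c / T"
      using eventually_gt_at_top[of 0]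
    proof eventually_elim
      case (elim T)
      have "of_int (\<lfloor>T / L\<rfloor> + c) \<le> T / L + of_int c" by simp
      then have "of_int (\<lfloor>T / L\<rfloor> + c) / T \<le> (T / L + of_int c) / T" using elim by (intro divide_right_mono) auto
      then show ?case using elim L by (simp add: add_divide_distrib)
    qed
    show "((\<lambda>T. 1 / L + (of_int c - 1) / T) \<longlongrightarrow> 1 / L) at_top"
      using tendsto_add[OF tendsto_const inv[of "of_int c - 1"], of "1 / L"] by simp
    show "((\<lambda>T. 1 / L + of_int c / T) \<longlongrightarrow> 1 / L) at_top"
      using tendsto_add[OF tendsto_const inv[of "of_int c"], of "1 / L"] by simp
  qed
  from tendsto_max[OF tendsto_const[of 0] this]
  have *: "((\<lambda>T. max 0 (of_int (\<lfloor>T / L\<rfloor> + c) / T)) \<longlongrightarrow> 1 / L) at_top" using L by simp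
  have "((\<lambda>T. max 0 (of_int (\<lfloor>T / L\<rfloor> + c)) / T) \<longlongrightarrow> 1 / L) at_top"
    by (rule Lim_transform_eventually[OF *])
       (use eventually_gt_at_top[of 0] in eventually_elim, simp add: max_def divide_le_0_iff zero_le_divide_iff)
  then show ?thesis by (rule tendsto_power)
qed

definition window :: "real \<Rightarrow> real \<Rightarrow> ('d::finite \<Rightarrow> int) \<Rightarrow> (real ^ 'd) set" where
  "window L T k = {t. t + lattice_point L k \<in> cube T}"

lemma sets_window [measurable, simp]:
  fixes k :: "'d::finite \<Rightarrow> int"
  shows "window L T k \<in> sets borel"
proof -
  have "(\<lambda>t. t + lattice_point L k) \<in> borel \<rightarrow>\<^sub>M borel" by measurable
  from measurable_sets[OF this sets_cube] show ?thesis by (simp add: vimage_def window_def)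
qed

lemma in_window_iff: "t \<in> window L T k \<longleftrightarrow> (\<forall>i. 0 \<le> t $ i + L * of_int (k i) \<and> t $ i + L * of_int (k i) \<le> T)"
  by (simp add: window_def cube_def)

lemma window_meets_cell:
  assumes L: "0 < L" and t: "t \<in> cell L j" "t \<in> window L T k"
  shows "- j i \<le> k i \<and> k i < - j i + (\<lfloor>T / L\<rfloor> + 1)"
proof -
  have 1: "L * of_int (j i) \<le> t $ i" "t $ i < L * (of_int (j i) + 1)" using t(1) by (auto simp: cell_def)
  have 2: "0 \<le> t $ i + L * of_int (k i)" "t $ i + L * of_int (k i) \<le> T" using t(2) by (auto simp: in_window_iff)
  have "0 < L * (of_int (j i) + 1 + of_int (k i))" using 1 2 by (simp add: distrib_left)
  then have "0 < real_of_int (j i + 1 + k i)" using L by (simp add: zero_less_mult_iff)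
  then have a: "- j i \<le> k i" by linarith
  have "of_int (j i + k i) * L \<le> T" using 1 2 by (simp add: distrib_left mult.commute)
  then have "of_int (j i + k i) \<le> T / L" using L by (simp add: pos_le_divide_eq)
  then have "j i + k i \<le> \<lfloor>T / L\<rfloor>" by (simp add: le_floor_iff)
  with a show ?thesis by linarith
qed

lemma cell_subset_window:
  assumes L: "0 < L" and k: "\<And>i. - j i \<le> k i \<and> k i + 1 + j i \<le> \<lfloor>T / L\<rfloor>"
  shows "cell L j \<subseteq> window L T k"
proof
  fix t assume "t \<in> cell L j"
  then have t: "L * of_int (j i) \<le> t $ i" "t $ i < L * (of_int (j i) + 1)" for i by (auto simp: cell_def)
  show "t \<in> window L T k" unfolding in_window_iff
  proof
    fix i
    have "0 \<le> real_of_int (j i + k i)" using k[of i] by simp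
    then have "0 \<le> L * (of_int (j i) + of_int (k i))" using L by simp
    moreover have "real_of_int (k i + 1 + j i) \<le> T / L" using k[of i] by (simp add: le_floor_iff)
    then have "of_int (k i + 1 + j i) * L \<le> T" using L by (simp add: pos_le_divide_eq)
    ultimately show "0 \<le> t $ i + L * of_int (k i) \<and> t $ i + L * of_int (k i) \<le> T"
      using t[of i] by (auto simp: algebra_simps)
  qed
qed

definition window_count :: "real \<Rightarrow> real \<Rightarrow> real \<Rightarrow> (real ^ 'd::finite \<Rightarrow> real) \<Rightarrow> ennreal" where
  "window_count \<delta> x T f = emeasure (count_space UNIV) {k. ennreal x < exceed_mass \<delta> (window (mesh \<delta>) T k) f}"

definition exceed_cells :: "real \<Rightarrow> (real ^ 'd::finite \<Rightarrow> real) \<Rightarrow> ('d \<Rightarrow> int) set" where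
  "exceed_cells \<delta> f = {j. exceed_mass \<delta> (cell (mesh \<delta>) j) f \<noteq> 0}"

lemma window_sees_cell:
  assumes "0 \<le> \<delta>" "f \<in> cadlag" "ennreal x < exceed_mass \<delta> (window (mesh \<delta>) T k) f"
  obtains j where "j \<in> exceed_cells \<delta> f" "\<And>i. - j i \<le> k i \<and> k i < - j i + (\<lfloor>T / mesh \<delta>\<rfloor> + 1)"
proof -
  have "\<exists>j t. t \<in> window (mesh \<delta>) T k \<and> t \<in> cell (mesh \<delta>) j \<and> j \<in> exceed_cells \<delta> f"
  proof (rule ccontr)
    assume *: "\<not> ?thesis"
    have "exceed_mass \<delta> (window (mesh \<delta>) T k) f \<le> exceed_mass \<delta> {} f"
      by (rule exceed_mass_mono_cells[OF assms(1,2)]) (use * in \<open>auto simp: exceed_cells_def\<close>)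
    also have "\<dots> = 0" by (simp add: exceed_mass_def)
    finally show False using assms(3) by simp
  qed
  then show ?thesis using window_meets_cell[OF mesh_pos[OF assms(1)]] that by blast
qed

text \<open>Each cell with exceedances is met by at most \<open>(T / mesh \<delta> + 1)\<^sup>d\<close> windows, and a window that meets none of
  them sees nothing.\<close>

lemma window_count_le:
  fixes f :: "real ^ 'd::finite \<Rightarrow> real"
  assumes "0 \<le> \<delta>" "f \<in> cadlag" and T: "mesh \<delta> \<le> T"
  shows "window_count \<delta> x T f
    \<le> emeasure (count_space UNIV) (exceed_cells \<delta> f) * ennreal (max 0 (of_int (\<lfloor>T / mesh \<delta>\<rfloor> + 1)) ^ CARD('d))"
proof (cases "finite (exceed_cells \<delta> f)")
  case True
  let ?B = "\<lambda>j. {k :: 'd \<Rightarrow> int. \<forall>i. - j i \<le> k i \<and> k i < - j i + (\<lfloor>T / mesh \<delta>\<rfloor> + 1)}"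
  have "window_count \<delta> x T f \<le> emeasure (count_space UNIV) (\<Union>j\<in>exceed_cells \<delta> f. ?B j)"
    unfolding window_count_def
  proof (rule emeasure_mono)
    show "{k. ennreal x < exceed_mass \<delta> (window (mesh \<delta>) T k) f} \<subseteq> (\<Union>j\<in>exceed_cells \<delta> f. ?B j)"
    proof
      fix k assume "k \<in> {k. ennreal x < exceed_mass \<delta> (window (mesh \<delta>) T k) f}"
      then obtain j where "j \<in> exceed_cells \<delta> f" "\<And>i. - j i \<le> k i \<and> k i < - j i + (\<lfloor>T / mesh \<delta>\<rfloor> + 1)"
        using window_sees_cell[OF assms(1,2)] by blast
      then show "k \<in> (\<Union>j\<in>exceed_cells \<delta> f. ?B j)" by blast
    qed
  qed simp
  also have "\<dots> \<le> (\<Sum>j\<in>exceed_cells \<delta> f. emeasure (count_space UNIV) (?B j))"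
    by (rule emeasure_subadditive_finite[OF True]) simp
  also have "\<dots> = of_nat (card (exceed_cells \<delta> f)) * ennreal (max 0 (of_int (\<lfloor>T / mesh \<delta>\<rfloor> + 1)) ^ CARD('d))"
    by (simp only: emeasure_count_box sum_constant)
  finally show ?thesis using True by (simp add: emeasure_count_space_finite)
next
  case False
  have L: "0 < mesh \<delta>" by (rule mesh_pos[OF assms(1)])
  have "0 \<le> T / mesh \<delta>" using T L by simp
  then have "0 \<le> \<lfloor>T / mesh \<delta>\<rfloor>" by simp
  then have "0 < real_of_int (\<lfloor>T / mesh \<delta>\<rfloor> + 1)" by linarith
  \<comment> \<open>The bound is infinite here, provided that the factor does not vanish: this is where \<open>T\<close> must not be small.\<close>
  then have "max 0 (real_of_int (\<lfloor>T / mesh \<delta>\<rfloor> + 1)) \<noteq> 0" by linarith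
  then show ?thesis using False by (simp add: ennreal_top_mult)
qed

text \<open>A path that exceeds the level in finitely many cells only is seen completely or not at all by a
  window whose boundary is far from these cells, and the other windows are too few to matter.\<close>

lemma window_count_tendsto:
  fixes f :: "real ^ 'd::finite \<Rightarrow> real"
  assumes "0 \<le> \<delta>" and f: "f \<in> cadlag" and fin: "finite (exceed_cells \<delta> f)"
  shows "((\<lambda>T. window_count \<delta> x T f / ennreal (T ^ CARD('d)))
    \<longlongrightarrow> indicator {f. ennreal x < exceed_mass \<delta> UNIV f} f * ennreal ((1 / mesh \<delta>) ^ CARD('d))) at_top"
proof (cases "ennreal x < exceed_mass \<delta> UNIV f")
  case False
  have "exceed_mass \<delta> (window (mesh \<delta>) T k) f \<le> exceed_mass \<delta> UNIV f" for T and k :: "'d \<Rightarrow> int"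
    by (rule exceed_mass_mono_cells[OF assms(1,2)]) auto
  then have "\<not> ennreal x < exceed_mass \<delta> (window (mesh \<delta>) T k) f" for T and k :: "'d \<Rightarrow> int"
    using False by (meson less_le_trans)
  then have "window_count \<delta> x T f = 0" for T by (simp add: window_count_def)
  then show ?thesis using False by simp
next
  case True
  let ?L = "mesh \<delta>"
  have L: "0 < ?L" by (rule mesh_pos[OF assms(1)])
  have "\<exists>R. \<forall>j\<in>exceed_cells \<delta> f. \<forall>i. \<bar>j i\<bar> \<le> R"
  proof -
    have "finite ((\<lambda>(j, i). \<bar>j i\<bar>) ` (exceed_cells \<delta> f \<times> UNIV))" using fin by simp
    then obtain R where "\<forall>y\<in>(\<lambda>(j, i). \<bar>j i\<bar>) ` (exceed_cells \<delta> f \<times> UNIV). y \<le> R"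
      using finite_has_maximal by (metis Max_ge)
    then show ?thesis by (intro exI[of _ R]) auto
  qed
  then obtain R where R: "\<bar>j i\<bar> \<le> R" if "j \<in> exceed_cells \<delta> f" for j i by blast
  \<comment> \<open>All cells with exceedances have indices within \<open>R\<close>. Windows translated by \<open>k\<close> with all coordinates in
    \<open>[R, \<lfloor>T / L\<rfloor> - R)\<close> contain them; those with a coordinate outside \<open>[- R, \<lfloor>T / L\<rfloor> + R + 1)\<close> meet none of them.\<close>
  let ?lo = "\<lambda>T. max 0 (of_int (\<lfloor>T / ?L\<rfloor> + (- 2 * R))) :: real"
  let ?hi = "\<lambda>T. max 0 (of_int (\<lfloor>T / ?L\<rfloor> + (2 * R + 1))) :: real"
  have lo: "ennreal (?lo T ^ CARD('d)) \<le> window_count \<delta> x T f" for T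
  proof -
    have "{k :: 'd \<Rightarrow> int. \<forall>i. R \<le> k i \<and> k i < R + (\<lfloor>T / ?L\<rfloor> + (- 2 * R))}
        \<subseteq> {k. ennreal x < exceed_mass \<delta> (window ?L T k) f}"
    proof
      fix k :: "'d \<Rightarrow> int" assume k: "k \<in> {k. \<forall>i. R \<le> k i \<and> k i < R + (\<lfloor>T / ?L\<rfloor> + (- 2 * R))}"
      have "exceed_mass \<delta> UNIV f \<le> exceed_mass \<delta> (window ?L T k) f"
      proof (rule exceed_mass_mono_cells[OF assms(1) f])
        fix j t assume t: "t \<notin> window ?L T k" "t \<in> cell ?L j"
        show "exceed_mass \<delta> (cell ?L j) f = 0"
        proof (rule ccontr)
          assume "exceed_mass \<delta> (cell ?L j) f \<noteq> 0"
          then have "\<bar>j i\<bar> \<le> R" for i by (intro R) (simp add: exceed_cells_def)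
          then have "- j i \<le> k i \<and> k i + 1 + j i \<le> \<lfloor>T / ?L\<rfloor>" for i
            using k by (auto simp: abs_le_iff) (smt (verit, best))+
          then have "cell ?L j \<subseteq> window ?L T k" by (rule cell_subset_window[OF L])
          with t show False by blast
        qed
      qed auto
      then show "k \<in> {k. ennreal x < exceed_mass \<delta> (window ?L T k) f}" using True by (auto intro: less_le_trans)
    qed
    then have "emeasure (count_space UNIV) {k :: 'd \<Rightarrow> int. \<forall>i. R \<le> k i \<and> k i < R + (\<lfloor>T / ?L\<rfloor> + (- 2 * R))}
        \<le> window_count \<delta> x T f"
      unfolding window_count_def by (rule emeasure_mono) simp
    then show ?thesis by (simp only: emeasure_count_box)
  qed
  have hi: "window_count \<delta> x T f \<le> ennreal (?hi T ^ CARD('d))" for T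
  proof -
    have "{k. ennreal x < exceed_mass \<delta> (window ?L T k) f}
        \<subseteq> {k :: 'd \<Rightarrow> int. \<forall>i. - R \<le> k i \<and> k i < - R + (\<lfloor>T / ?L\<rfloor> + (2 * R + 1))}"
    proof
      fix k assume "k \<in> {k. ennreal x < exceed_mass \<delta> (window ?L T k) f}"
      then obtain j where j: "j \<in> exceed_cells \<delta> f" "\<And>i. - j i \<le> k i \<and> k i < - j i + (\<lfloor>T / ?L\<rfloor> + 1)"
        using window_sees_cell[OF assms(1) f] by blast
      have "- R \<le> k i \<and> k i < - R + (\<lfloor>T / ?L\<rfloor> + (2 * R + 1))" for i
        using R[OF j(1), of i] j(2)[of i] by linarith
      then show "k \<in> {k. \<forall>i. - R \<le> k i \<and> k i < - R + (\<lfloor>T / ?L\<rfloor> + (2 * R + 1))}" by blast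
    qed
    then have "window_count \<delta> x T f
        \<le> emeasure (count_space UNIV) {k :: 'd \<Rightarrow> int. \<forall>i. - R \<le> k i \<and> k i < - R + (\<lfloor>T / ?L\<rfloor> + (2 * R + 1))}"
      unfolding window_count_def by (rule emeasure_mono) simp
    then show ?thesis by (simp only: emeasure_count_box)
  qed
  have div: "ennreal (y ^ CARD('d)) / ennreal (T ^ CARD('d)) = ennreal ((y / T) ^ CARD('d))" if "0 \<le> y" "0 < T" for y T :: real
    using that by (simp add: divide_ennreal power_divide)
  have "((\<lambda>T. window_count \<delta> x T f / ennreal (T ^ CARD('d))) \<longlongrightarrow> ennreal ((1 / ?L) ^ CARD('d))) at_top"
  proof (rule tendsto_sandwich)
    show "\<forall>\<^sub>F T in at_top. ennreal ((?lo T / T) ^ CARD('d)) \<le> window_count \<delta> x T f / ennreal (T ^ CARD('d))"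
      using eventually_gt_at_top[of 0]
    proof eventually_elim
      case (elim T)
      show ?case using divide_right_mono_ennreal[OF lo, of T "ennreal (T ^ CARD('d))"] elim by (subst div[symmetric]) simp_all
    qed
    show "\<forall>\<^sub>F T in at_top. window_count \<delta> x T f / ennreal (T ^ CARD('d)) \<le> ennreal ((?hi T / T) ^ CARD('d))"
      using eventually_gt_at_top[of 0]
    proof eventually_elim
      case (elim T)
      show ?case using divide_right_mono_ennreal[OF hi, of T "ennreal (T ^ CARD('d))"] elim by (subst div[symmetric]) simp_all
    qed
    show "((\<lambda>T. ennreal ((?lo T / T) ^ CARD('d))) \<longlongrightarrow> ennreal ((1 / ?L) ^ CARD('d))) at_top"
      by (rule tendsto_ennrealI[OF floor_div_asymp[OF L]])
    show "((\<lambda>T. ennreal ((?hi T / T) ^ CARD('d))) \<longlongrightarrow> ennreal ((1 / ?L) ^ CARD('d))) at_top"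
      by (rule tendsto_ennrealI[OF floor_div_asymp[OF L]])
  qed
  then show ?thesis using True by simp
qed

section \<open>Densities of sums of lattice translates\<close>

lemma nn_integral_count_space_suminf:
  fixes g :: "'i::countable \<Rightarrow> ennreal"
  shows "(\<integral>\<^sup>+k. g k \<partial>count_space UNIV) = (\<Sum>n. g (from_nat n) * indicator (range (to_nat :: 'i \<Rightarrow> nat)) n)"
proof -
  have "bij_betw (to_nat :: 'i \<Rightarrow> nat) UNIV (range (to_nat :: 'i \<Rightarrow> nat))" by (simp add: bij_betw_def)
  from nn_integral_bij_count_space[OF this, of "\<lambda>n. g (from_nat n)"]
  have "(\<integral>\<^sup>+k. g k \<partial>count_space UNIV) = (\<integral>\<^sup>+n. g (from_nat n) \<partial>count_space (range (to_nat :: 'i \<Rightarrow> nat)))"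
    by simp
  also have "\<dots> = (\<integral>\<^sup>+n. g (from_nat n) * indicator (range (to_nat :: 'i \<Rightarrow> nat)) n \<partial>count_space UNIV)"
    by (rule nn_integral_count_space_indicator) simp
  finally show ?thesis by (simp add: nn_integral_count_space_nat)
qed

lemma borel_measurable_nn_integral_count_space:
  fixes g :: "'i::countable \<Rightarrow> 'a \<Rightarrow> ennreal"
  assumes [measurable]: "\<And>k. g k \<in> borel_measurable N"
  shows "(\<lambda>x. \<integral>\<^sup>+k. g k x \<partial>count_space UNIV) \<in> borel_measurable N"
  unfolding nn_integral_count_space_suminf by measurable

lemma nn_integral_count_space_uminus:
  fixes g :: "('d::finite \<Rightarrow> int) \<Rightarrow> ennreal"
  shows "(\<integral>\<^sup>+k. g (\<lambda>i. - k i) \<partial>count_space UNIV) = (\<integral>\<^sup>+k. g k \<partial>count_space UNIV)"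
  by (rule nn_integral_bij_count_space) (rule bij_betw_byWitness[where f' = "\<lambda>k i. - k i"], auto)

lemma cell_shift: "{t. t + lattice_point L k \<in> cell L j} = cell L (\<lambda>i. j i - k i)"
  by (auto simp: cell_translate)

text \<open>By the decomposition of \<open>\<nu>\<close> into translates, the measure of the event in the cube is the integral of
  the number of windows that see more than \<open>x\<close>, and \<open>window_count_tendsto\<close> gives its pointwise limit. The
  dominating function is the number of cells with exceedances. Its integral is finite: by the same
  decomposition it is the \<open>\<nu>\<close>-measure of an exceedance in the cell at the origin.\<close>

theorem tiling_limit:
  fixes m \<nu> :: "(real ^ 'd::finite \<Rightarrow> real) measure"
  assumes \<delta>: "0 \<le> \<delta>" and m [measurable_cong]: "sets m = sets cadlag_algebra"
    and transport: "\<And>A. A \<in> sets cadlag_algebra \<Longrightarrow> (\<lambda>_. 0) \<notin> A \<Longrightarrow>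
      emeasure \<nu> A = (\<integral>\<^sup>+k. emeasure m {f\<in>cadlag. (\<lambda>t. f (t - lattice_point (mesh \<delta>) k)) \<in> A} \<partial>count_space UNIV)"
    and fin: "emeasure \<nu> {f\<in>cadlag. exceed_mass \<delta> (cell (mesh \<delta>) (\<lambda>_. 0)) f \<noteq> 0} < \<infinity>"
  shows "((\<lambda>T. emeasure \<nu> (exceed_event \<delta> x (cube T)) / ennreal (T ^ CARD('d)))
      \<longlongrightarrow> emeasure m (exceed_event \<delta> x UNIV) * ennreal ((1 / mesh \<delta>) ^ CARD('d))) at_top"
    and "emeasure m (exceed_event \<delta> x UNIV) < \<infinity>"
proof -
  let ?L = "mesh \<delta>"
  have L: "0 < ?L" by (rule mesh_pos[OF \<delta>])
  have sp: "space m = cadlag" using sets_eq_imp_space_eq[OF m] by simp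
  have mE: "exceed_mass \<delta> A \<in> borel_measurable m" if "A \<in> sets borel" for A
    using measurable_exceed_mass[OF \<delta> that] by (simp add: measurable_cong_sets[OF m refl])
  have zero: "exceed_mass \<delta> A (\<lambda>_. 0) = 0" for A by (simp add: exceed_mass_def)
  define N where "N f = (\<integral>\<^sup>+j. indicator {f\<in>cadlag. exceed_mass \<delta> (cell ?L j) f \<noteq> 0} f \<partial>count_space UNIV)"
    for f :: "real ^ 'd \<Rightarrow> real"
  have sC: "{f\<in>cadlag. exceed_mass \<delta> (cell ?L j) f \<noteq> 0} \<in> sets m" for j :: "'d \<Rightarrow> int"
  proof -
    have [measurable]: "exceed_mass \<delta> (cell ?L j) \<in> borel_measurable m" by (rule mE) simp
    have "{f\<in>space m. exceed_mass \<delta> (cell ?L j) f \<noteq> 0} \<in> sets m" by measurable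
    then show ?thesis by (simp add: sp)
  qed
  have sW: "exceed_event \<delta> x A \<in> sets m" if "A \<in> sets borel" for A
    using sets_exceed_event[OF \<delta> that] by (simp only: m)
  have mN [measurable]: "N \<in> borel_measurable m"
    unfolding N_def[abs_def] using sC by (intro borel_measurable_nn_integral_count_space) simp
  have N_eq: "N f = emeasure (count_space UNIV) (exceed_cells \<delta> f)" if "f \<in> cadlag" for f
  proof -
    have "N f = (\<integral>\<^sup>+j. indicator (exceed_cells \<delta> f) j \<partial>count_space UNIV)"
      unfolding N_def using that by (intro nn_integral_cong) (simp add: indicator_def exceed_cells_def)
    then show ?thesis by simp
  qed
  have shift: "exceed_mass \<delta> A (\<lambda>t. f (t - lattice_point ?L k)) = exceed_mass \<delta> {t. t + lattice_point ?L k \<in> A} f"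
    if "f \<in> cadlag" "A \<in> sets borel" for f A k
    by (rule exceed_mass_shift[OF \<delta> lattice_point_in_grid that])
  have "(\<integral>\<^sup>+f. N f \<partial>m) = (\<integral>\<^sup>+j. emeasure m {f\<in>cadlag. exceed_mass \<delta> (cell ?L j) f \<noteq> 0} \<partial>count_space UNIV)"
    unfolding N_def using sC by (subst nn_integral_count_space_nn_integral) simp_all
  also have "\<dots> = (\<integral>\<^sup>+k. emeasure m {f\<in>cadlag. exceed_mass \<delta> (cell ?L (\<lambda>i. - k i)) f \<noteq> 0} \<partial>count_space UNIV)"
    by (rule nn_integral_count_space_uminus[symmetric])
  also have "\<dots> = emeasure \<nu> {f\<in>cadlag. exceed_mass \<delta> (cell ?L (\<lambda>_::'d. 0)) f \<noteq> 0}"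
  proof (subst transport)
    show "{f \<in> cadlag. exceed_mass \<delta> (cell ?L (\<lambda>_::'d. 0)) f \<noteq> 0} \<in> sets cadlag_algebra"
      using sC[of "\<lambda>_. 0"] by (simp add: m)
    show "(\<lambda>_. 0) \<notin> {f \<in> cadlag. exceed_mass \<delta> (cell ?L (\<lambda>_::'d. 0)) f \<noteq> 0}" by (simp add: zero)
    show "(\<integral>\<^sup>+k. emeasure m {f\<in>cadlag. exceed_mass \<delta> (cell ?L (\<lambda>i. - k i)) f \<noteq> 0} \<partial>count_space UNIV)
      = (\<integral>\<^sup>+k. emeasure m {f\<in>cadlag. (\<lambda>t. f (t - lattice_point ?L k)) \<in>
            {f \<in> cadlag. exceed_mass \<delta> (cell ?L (\<lambda>_::'d. 0)) f \<noteq> 0}} \<partial>count_space UNIV)"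
      by (intro nn_integral_cong arg_cong[where f = "emeasure m"] Collect_cong conj_cong refl)
         (simp add: shift cadlag_shift cell_shift)
  qed
  finally have N_fin: "(\<integral>\<^sup>+f. N f \<partial>m) < \<infinity>" using fin by simp
  then have AE_fin: "AE f in m. N f \<noteq> \<infinity>" by (intro nn_integral_PInf_AE) auto
  let ?W = "\<lambda>T f. \<integral>\<^sup>+k. indicator (exceed_event \<delta> x (window ?L T k)) f \<partial>count_space UNIV"
  have W_eq: "?W T f = window_count \<delta> x T f" if "f \<in> cadlag" for T f
  proof -
    have "?W T f = (\<integral>\<^sup>+k. indicator {k. ennreal x < exceed_mass \<delta> (window ?L T k) f} k \<partial>count_space UNIV)"
      using that by (intro nn_integral_cong) (simp add: indicator_def)
    then show ?thesis by (simp add: window_count_def)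
  qed
  have mW [measurable]: "?W T \<in> borel_measurable m" for T
    using sW by (intro borel_measurable_nn_integral_count_space) simp
  have \<nu>W: "emeasure \<nu> (exceed_event \<delta> x (cube T)) = (\<integral>\<^sup>+f. ?W T f \<partial>m)" for T
  proof -
    have "(\<integral>\<^sup>+f. ?W T f \<partial>m)
        = (\<integral>\<^sup>+k. emeasure m (exceed_event \<delta> x (window ?L T k)) \<partial>count_space UNIV)"
      using sW by (subst nn_integral_count_space_nn_integral) simp_all
    also have "\<dots> = emeasure \<nu> (exceed_event \<delta> x (cube T))"
    proof (subst transport)
      show "exceed_event \<delta> x (cube T :: (real ^ 'd) set) \<in> sets cadlag_algebra"
        using sW[OF sets_cube] by (simp add: m)
      show "(\<lambda>_. 0) \<notin> (exceed_event \<delta> x (cube T :: (real ^ 'd) set))" by (simp add: zero)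
      show "(\<integral>\<^sup>+k. emeasure m (exceed_event \<delta> x (window ?L T k)) \<partial>count_space UNIV)
        = (\<integral>\<^sup>+k. emeasure m {f\<in>cadlag. (\<lambda>t. f (t - lattice_point ?L k)) \<in>
            exceed_event \<delta> x (cube T)} \<partial>count_space UNIV)"
        by (intro nn_integral_cong arg_cong[where f = "emeasure m"] Collect_cong conj_cong refl)
           (simp add: shift cadlag_shift window_def)
    qed
    finally show ?thesis ..
  qed
  define c where "c = ennreal ((1 / ?L) ^ CARD('d))"
  have UNIV_le: "indicator {f. ennreal x < exceed_mass \<delta> UNIV f} f \<le> N f" if f: "f \<in> cadlag" for f
  proof (cases "exceed_cells \<delta> f = {}")
    case True
    have "exceed_mass \<delta> UNIV f \<le> exceed_mass \<delta> {} f"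
      by (rule exceed_mass_mono_cells[OF \<delta> f]) (use True in \<open>auto simp: exceed_cells_def\<close>)
    then have "exceed_mass \<delta> UNIV f = 0" by (simp add: exceed_mass_def)
    then show ?thesis by simp
  next
    case False
    then obtain j where "j \<in> exceed_cells \<delta> f" by blast
    then have "emeasure (count_space UNIV) {j} \<le> N f" unfolding N_eq[OF f] by (intro emeasure_mono) auto
    then have "1 \<le> N f" by simp
    then show ?thesis by (simp add: indicator_def)
  qed
  have "emeasure m (exceed_event \<delta> x UNIV)
      = (\<integral>\<^sup>+f. indicator (exceed_event \<delta> x UNIV) f \<partial>m)"
    using sW[of UNIV] by simp
  also have "\<dots> \<le> (\<integral>\<^sup>+f. N f \<partial>m)"
    using UNIV_le by (intro nn_integral_mono) (auto simp: sp indicator_def split: if_splits)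
  finally show "emeasure m (exceed_event \<delta> x UNIV) < \<infinity>"
    using N_fin by (simp add: less_le_trans le_less_trans)
  let ?g = "\<lambda>T f. if ?L \<le> T then ?W T f / ennreal (T ^ CARD('d)) else 0"
  have "((\<lambda>T. \<integral>\<^sup>+f. ?g T f \<partial>m) \<longlongrightarrow> (\<integral>\<^sup>+f. indicator (exceed_event \<delta> x UNIV) f * c \<partial>m)) at_top"
  proof (rule tendsto_at_topI_sequentially)
    fix X :: "nat \<Rightarrow> real" assume X: "filterlim X at_top sequentially"
    show "(\<lambda>n. \<integral>\<^sup>+f. ?g (X n) f \<partial>m) \<longlonglongrightarrow> (\<integral>\<^sup>+f. indicator (exceed_event \<delta> x UNIV) f * c \<partial>m)"
    proof (rule nn_integral_dominated_convergence[where w = "\<lambda>f. N f * ennreal ((2 / ?L) ^ CARD('d))"])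
      show "?g (X n) \<in> borel_measurable m" for n by measurable
      show "(\<lambda>f. indicator (exceed_event \<delta> x UNIV) f * c) \<in> borel_measurable m"
        using sW[of UNIV] by simp
      show "(\<lambda>f. N f * ennreal ((2 / ?L) ^ CARD('d))) \<in> borel_measurable m" by measurable
      have "(\<integral>\<^sup>+f. N f * ennreal ((2 / ?L) ^ CARD('d)) \<partial>m) = (\<integral>\<^sup>+f. N f \<partial>m) * ennreal ((2 / ?L) ^ CARD('d))"
        by (rule nn_integral_multc) measurable
      then show "(\<integral>\<^sup>+f. N f * ennreal ((2 / ?L) ^ CARD('d)) \<partial>m) < \<infinity>"
        using N_fin by (simp add: ennreal_mult_less_top)
      show "AE f in m. ?g (X n) f \<le> N f * ennreal ((2 / ?L) ^ CARD('d))" for n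
      proof (rule AE_I2)
        fix f assume "f \<in> space m"
        then have f: "f \<in> cadlag" by (simp add: sp)
        have "?W T f / ennreal (T ^ CARD('d)) \<le> N f * ennreal ((2 / ?L) ^ CARD('d))" if T: "?L \<le> T" for T
        proof -
          let ?y = "max 0 (of_int (\<lfloor>T / ?L\<rfloor> + 1)) :: real"
          have T0: "0 < T" using T L by simp
          \<comment> \<open>\<open>\<lfloor>T / L\<rfloor> + 1 \<le> 2 T / L\<close> once \<open>T \<ge> L\<close>.\<close>
          have "1 \<le> T / ?L" using T L by simp
          then have "?y \<le> 2 / ?L * T" by simp linarith
          then have "?y / T \<le> 2 / ?L" using T0 by (simp add: pos_divide_le_eq del: of_int_add)
          then have pw: "(?y / T) ^ CARD('d) \<le> (2 / ?L) ^ CARD('d)" using T0 by (intro power_mono) auto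
          have "?W T f / ennreal (T ^ CARD('d)) \<le> N f * ennreal (?y ^ CARD('d)) / ennreal (T ^ CARD('d))"
            unfolding W_eq[OF f] N_eq[OF f]
            by (rule divide_right_mono_ennreal[OF window_count_le[OF \<delta> f T]])
          also have "\<dots> = N f * ennreal ((?y / T) ^ CARD('d))"
            using T0 by (simp add: ennreal_times_divide[symmetric] divide_ennreal power_divide del: of_int_add)
          also have "\<dots> \<le> N f * ennreal ((2 / ?L) ^ CARD('d))"
            by (intro mult_left_mono ennreal_leI pw) simp
          finally show ?thesis .
        qed
        then show "?g (X n) f \<le> N f * ennreal ((2 / ?L) ^ CARD('d))" by simp
      qed
      show "AE f in m. (\<lambda>n. ?g (X n) f) \<longlonglongrightarrow> indicator (exceed_event \<delta> x UNIV) f * c"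
        using AE_fin AE_space
      proof eventually_elim
        case (elim f)
        then have f: "f \<in> cadlag" by (simp add: sp)
        have "finite (exceed_cells \<delta> f)"
          using elim(1) unfolding N_eq[OF f] by (simp add: emeasure_count_space split: if_splits)
        from window_count_tendsto[OF \<delta> f this, of x]
        have "((\<lambda>T. ?g T f) \<longlongrightarrow> indicator {f. ennreal x < exceed_mass \<delta> UNIV f} f * c) at_top"
          unfolding c_def
          by (rule Lim_transform_eventually)
             (use eventually_ge_at_top[of ?L] in eventually_elim, simp add: W_eq[OF f])
        from filterlim_compose[OF this X] show ?case using f by (simp add: indicator_def)
      qed
    qed
  qed
  moreover have "\<forall>\<^sub>F T in at_top. (\<integral>\<^sup>+f. ?g T f \<partial>m)
      = emeasure \<nu> (exceed_event \<delta> x (cube T)) / ennreal (T ^ CARD('d))"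
    using eventually_ge_at_top[of ?L]
  proof eventually_elim
    case (elim T)
    then show ?case unfolding \<nu>W by (simp add: nn_integral_divide)
  qed
  ultimately have "((\<lambda>T. emeasure \<nu> (exceed_event \<delta> x (cube T)) / ennreal (T ^ CARD('d)))
      \<longlongrightarrow> (\<integral>\<^sup>+f. indicator (exceed_event \<delta> x UNIV) f * c \<partial>m)) at_top"
    by (rule Lim_transform_eventually)
  moreover have "(\<integral>\<^sup>+f. indicator (exceed_event \<delta> x UNIV) f * c \<partial>m)
      = emeasure m (exceed_event \<delta> x UNIV) * c"
    using sW[of UNIV] by (simp add: nn_integral_multc)
  ultimately show "((\<lambda>T. emeasure \<nu> (exceed_event \<delta> x (cube T)) / ennreal (T ^ CARD('d)))
      \<longlongrightarrow> emeasure m (exceed_event \<delta> x UNIV) * ennreal ((1 / ?L) ^ CARD('d))) at_top"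
    by (simp add: c_def)
qed

section \<open>Mass transport\<close>

definition cell_sup :: "real \<Rightarrow> ('d::finite \<Rightarrow> int) \<Rightarrow> (real ^ 'd \<Rightarrow> real) \<Rightarrow> ennreal" where
  "cell_sup L k f = (SUP t\<in>cell L k. ennreal (f t))"

definition cell_mass :: "real \<Rightarrow> ('d::finite \<Rightarrow> int) \<Rightarrow> (real ^ 'd \<Rightarrow> real) \<Rightarrow> ennreal" where
  "cell_mass L k f = (\<integral>\<^sup>+t\<in>cell L k. ennreal (f t) \<partial>lborel)"

lemma total_mass_0: "total_mass 0 f = (\<integral>\<^sup>+t. ennreal (f t) \<partial>lborel)"
  by (simp add: total_mass_def lam_def)

lemma cell_sup_rat:
  fixes f :: "real ^ 'd::finite \<Rightarrow> real"
  assumes f: "f \<in> cadlag"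
  shows "cell_sup L k f = (SUP t\<in>cell L k \<inter> rat_points. ennreal (f t))"
  unfolding cell_sup_def
proof (intro antisym SUP_least)
  fix t assume t: "t \<in> cell L k"
  show "ennreal (f t) \<le> (SUP t\<in>cell L k \<inter> rat_points. ennreal (f t))"
  proof (rule tendsto_upperbound)
    show "(\<lambda>n. ennreal (f (round_up n t))) \<longlonglongrightarrow> ennreal (f t)"
      by (rule tendsto_ennrealI[OF cadlag_round_up[OF f]])
    have "\<forall>\<^sub>F n in sequentially. round_up n t $ i < L * (of_int (k i) + 1)" for i
    proof -
      have "(\<lambda>n. round_up n t $ i) \<longlonglongrightarrow> t $ i" by (rule tendsto_vec_nth[OF round_up_tendsto])
      moreover have "t $ i < L * (of_int (k i) + 1)" using t by (auto simp: cell_def)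
      ultimately show ?thesis by (rule order_tendstoD(2))
    qed
    then have "\<forall>\<^sub>F n in sequentially. \<forall>i. round_up n t $ i < L * (of_int (k i) + 1)"
      by (simp add: eventually_all_finite)
    then show "\<forall>\<^sub>F n in sequentially. ennreal (f (round_up n t)) \<le> (SUP t\<in>cell L k \<inter> rat_points. ennreal (f t))"
    proof eventually_elim
      case (elim n)
      have "L * of_int (k i) \<le> round_up n t $ i" for i
        using t round_up_bounds(1)[of t i n] by (auto simp: cell_def intro: order_trans less_imp_le)
      then have "round_up n t \<in> cell L k \<inter> rat_points"
        using elim round_up_in_rat_points by (auto simp: cell_def)
      then show ?case by (rule SUP_upper)
    qed
  qed simp
next
  fix t assume "t \<in> cell L k \<inter> rat_points"
  then show "ennreal (f t) \<le> (SUP t\<in>cell L k. ennreal (f t))" by (intro SUP_upper) auto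
qed

lemma measurable_cell_sup: "cell_sup L k \<in> borel_measurable (cadlag_algebra :: (real ^ 'd::finite \<Rightarrow> real) measure)"
proof -
  have "(\<lambda>f. SUP t\<in>cell L k \<inter> rat_points. ennreal (f t)) \<in> borel_measurable (cadlag_algebra :: (real ^ 'd \<Rightarrow> real) measure)"
  proof (rule borel_measurable_SUP)
    show "countable (cell L k \<inter> rat_points)" using countable_rat_points by blast
    show "(\<lambda>f. ennreal (f t)) \<in> borel_measurable cadlag_algebra" for t :: "real ^ 'd"
      by (rule measurable_compose[OF measurable_cadlag_eval measurable_ennreal])
  qed
  then show ?thesis
    by (subst measurable_cong[of _ _ "\<lambda>f. SUP t\<in>cell L k \<inter> rat_points. ennreal (f t)"]) (simp_all add: cell_sup_rat)
qed

lemma measurable_cadlag_integral: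
  assumes "A \<in> sets borel"
  shows "(\<lambda>f. \<integral>\<^sup>+t\<in>A. ennreal (f t) \<partial>lborel) \<in> borel_measurable (cadlag_algebra :: (real ^ 'd::finite \<Rightarrow> real) measure)"
proof -
  have 1: "(\<lambda>p. fst p (snd p)) \<in> borel_measurable (cadlag_algebra \<Otimes>\<^sub>M (lborel :: (real ^ 'd) measure))"
    by (rule measurable_cadlag_field_pair[OF measurable_fst])
       (rule measurable_compose[OF measurable_snd measurable_ident_sets], simp)
  have 2: "(\<lambda>p. indicator A (snd p) :: ennreal) \<in> borel_measurable (cadlag_algebra \<Otimes>\<^sub>M (lborel :: (real ^ 'd) measure))"
    by (rule measurable_compose[OF measurable_snd borel_measurable_indicator]) (simp add: assms)
  have "(\<lambda>p. ennreal (fst p (snd p)) * indicator A (snd p)) \<in> borel_measurable (cadlag_algebra \<Otimes>\<^sub>M (lborel :: (real ^ 'd) measure))"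
    using 1 2 by (intro borel_measurable_times_ennreal measurable_compose[OF 1 measurable_ennreal])
  from lborel.borel_measurable_nn_integral_fst[OF this] show ?thesis by simp
qed

lemma measurable_cell_mass: "cell_mass L k \<in> borel_measurable cadlag_algebra"
  unfolding cell_mass_def[abs_def] by (rule measurable_cadlag_integral[OF sets_cell])

lemma measurable_total_mass: "total_mass 0 \<in> borel_measurable cadlag_algebra"
  using measurable_cadlag_integral[of UNIV] by (simp add: total_mass_0[abs_def])

definition finite_mass :: "(real ^ 'd::finite \<Rightarrow> real) set" where
  "finite_mass = {f\<in>cadlag. total_mass 0 f < \<infinity>}"

lemma sets_finite_mass: "finite_mass \<in> sets (cadlag_algebra :: (real ^ 'd::finite \<Rightarrow> real) measure)"
proof -
  have [measurable]: "total_mass 0 \<in> borel_measurable (cadlag_algebra :: (real ^ 'd \<Rightarrow> real) measure)" by (rule measurable_total_mass)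
  have "{f\<in>space (cadlag_algebra :: (real ^ 'd \<Rightarrow> real) measure). total_mass 0 f < \<infinity>} \<in> sets cadlag_algebra" by measurable
  then show ?thesis by (simp add: finite_mass_def)
qed

definition infinite_mass :: "(real ^ 'd::finite \<Rightarrow> real) set" where
  "infinite_mass = {f\<in>cadlag. total_mass 0 f = top}"

lemma sets_infinite_mass: "infinite_mass \<in> sets (cadlag_algebra :: (real ^ 'd::finite \<Rightarrow> real) measure)"
proof -
  have [measurable]: "total_mass 0 \<in> borel_measurable (cadlag_algebra :: (real ^ 'd \<Rightarrow> real) measure)" by (rule measurable_total_mass)
  have "{f\<in>space (cadlag_algebra :: (real ^ 'd \<Rightarrow> real) measure). total_mass 0 f = top} \<in> sets cadlag_algebra" by measurable
  then show ?thesis by (simp add: infinite_mass_def)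
qed

lemma cell_sup_shift: "cell_sup L k (\<lambda>t. f (t - lattice_point L j)) = cell_sup L (\<lambda>i. k i - j i) f"
proof -
  have "cell L k = (\<lambda>t. t + lattice_point L j) ` cell L (\<lambda>i. k i - j i)"
  proof (intro antisym subsetI)
    fix t assume "t \<in> cell L k"
    then have "t - lattice_point L j \<in> cell L (\<lambda>i. k i - j i)"
      using cell_translate[of "t - lattice_point L j" L j k] by simp
    then show "t \<in> (\<lambda>t. t + lattice_point L j) ` cell L (\<lambda>i. k i - j i)"
      by (intro image_eqI[of _ _ "t - lattice_point L j"]) simp_all
  qed (auto simp: cell_translate)
  then show ?thesis by (simp add: cell_sup_def image_image)
qed

lemma total_mass_shift:
  fixes f :: "real ^ 'd::finite \<Rightarrow> real"
  assumes f: "f \<in> cadlag"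
  shows "total_mass 0 (\<lambda>t. f (t - h)) = total_mass 0 f"
proof -
  have [measurable]: "(\<lambda>t. f (t - h)) \<in> borel_measurable borel" by (rule borel_measurable_cadlag[OF cadlag_shift[OF f]])
  have "(\<integral>\<^sup>+t. ennreal (f (t - h)) \<partial>lborel) = (\<integral>\<^sup>+t. ennreal (f (t - h)) \<partial>distr lborel borel ((+) h))"
    by (simp add: lborel_distr_plus)
  also have "\<dots> = (\<integral>\<^sup>+t. ennreal (f ((h + t) - h)) \<partial>lborel)"
    by (rule nn_integral_distr) measurable
  finally show ?thesis by (simp add: total_mass_0)
qed

lemma cell_mass_back:
  fixes f :: "real ^ 'd::finite \<Rightarrow> real"
  assumes f: "f \<in> cadlag"
  shows "cell_mass L j (\<lambda>t. f (t + lattice_point L k)) = cell_mass L (\<lambda>i. j i + k i) f"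
proof -
  let ?h = "lattice_point L k"
  have [measurable]: "f \<in> borel_measurable borel" by (rule borel_measurable_cadlag[OF f])
  have [measurable]: "(\<lambda>t. ennreal (f t) * indicator (cell L (\<lambda>i. j i + k i)) t) \<in> borel_measurable borel"
    by measurable
  have "cell_mass L (\<lambda>i. j i + k i) f
      = (\<integral>\<^sup>+t. ennreal (f t) * indicator (cell L (\<lambda>i. j i + k i)) t \<partial>distr lborel borel ((+) ?h))"
    by (simp add: lborel_distr_plus cell_mass_def)
  also have "\<dots> = (\<integral>\<^sup>+t. ennreal (f (?h + t)) * indicator (cell L (\<lambda>i. j i + k i)) (?h + t) \<partial>lborel)"
    by (rule nn_integral_distr) measurable
  also have "\<dots> = cell_mass L j (\<lambda>t. f (t + ?h))"
    unfolding cell_mass_def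
    by (intro nn_integral_cong arg_cong2[where f = "(*)"]) (simp_all add: add.commute indicator_def cell_translate)
  finally show ?thesis ..
qed

lemma total_mass_cells:
  fixes f :: "real ^ 'd::finite \<Rightarrow> real"
  assumes L: "0 < L" and f: "f \<in> cadlag"
  shows "total_mass 0 f = (\<integral>\<^sup>+k. cell_mass L k f \<partial>count_space UNIV)"
proof -
  have [measurable]: "f \<in> borel_measurable borel" by (rule borel_measurable_cadlag[OF f])
  have "(\<integral>\<^sup>+k. cell_mass L k f \<partial>count_space UNIV)
      = (\<integral>\<^sup>+t. (\<integral>\<^sup>+k. ennreal (f t) * indicator (cell L k) t \<partial>count_space UNIV) \<partial>lborel)"
    unfolding cell_mass_def by (subst nn_integral_count_space_nn_integral) simp_all
  also have "\<dots> = (\<integral>\<^sup>+t. ennreal (f t) \<partial>lborel)"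
  proof (rule nn_integral_cong)
    fix t :: "real ^ 'd"
    have "(\<integral>\<^sup>+k. ennreal (f t) * indicator (cell L k) t \<partial>count_space UNIV)
        = (\<integral>\<^sup>+k. ennreal (f t) * indicator {\<lambda>i. \<lfloor>t $ i / L\<rfloor>} k \<partial>count_space UNIV)"
      by (intro nn_integral_cong) (simp add: indicator_def in_cell_iff[OF L])
    also have "\<dots> = ennreal (f t)" by (simp add: nn_integral_cmult)
    finally show "(\<integral>\<^sup>+k. ennreal (f t) * indicator (cell L k) t \<partial>count_space UNIV) = ennreal (f t)" .
  qed
  finally show ?thesis by (simp add: total_mass_0)
qed

lemma cell_mass_le_sup:
  assumes "0 \<le> L"
  shows "cell_mass L k f \<le> cell_sup L k f * emeasure lborel (cell L k)"
proof -
  have "cell_mass L k f \<le> (\<integral>\<^sup>+t. cell_sup L k f * indicator (cell L k) t \<partial>lborel)"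
    unfolding cell_mass_def cell_sup_def
    by (intro nn_integral_mono) (auto simp: indicator_def intro: SUP_upper)
  then show ?thesis by (simp add: nn_integral_cmult)
qed

text \<open>By right continuity a positive value persists on a small box, which has positive volume.\<close>

lemma total_mass_0_imp_zero:
  fixes f :: "real ^ 'd::finite \<Rightarrow> real"
  assumes f: "f \<in> cadlag" and 0: "total_mass 0 f = 0"
  shows "f = (\<lambda>_. 0)"
proof (rule ext, rule ccontr)
  fix t assume "f t \<noteq> 0"
  then have pos: "0 < f t" using cadlag_nonneg[OF f, of t] by simp
  have [measurable]: "f \<in> borel_measurable borel" by (rule borel_measurable_cadlag[OF f])
  have "AE t in lborel. ennreal (f t) = 0"
    using 0 by (subst (asm) total_mass_0, subst (asm) nn_integral_0_iff_AE) simp_all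
  then have null: "emeasure lborel {s\<in>space lborel. ennreal (f s) \<noteq> 0} = 0"
    by (subst (asm) AE_iff_measurable[OF _ refl]) simp_all
  have "(f \<longlongrightarrow> f t) (at t within {s. \<forall>i. t $ i \<le> s $ i})" using f by (simp add: cadlag_def)
  from order_tendstoD(1)[OF this pos]
  obtain e where e: "0 < e" "\<And>s. \<forall>i. t $ i \<le> s $ i \<Longrightarrow> s \<noteq> t \<Longrightarrow> dist s t < e \<Longrightarrow> 0 < f s"
    unfolding eventually_at by auto
  define r where "r = e / (2 * real CARD('d))"
  have r: "0 < r" using e(1) by (simp add: r_def)
  let ?b = "t + (\<chi> i. r)"
  have "box t ?b \<subseteq> {s\<in>space lborel. ennreal (f s) \<noteq> 0}"
  proof
    fix s assume "s \<in> box t ?b"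
    then have s: "t $ i < s $ i" "s $ i < t $ i + r" for i by (auto simp: mem_box_cart)
    have "dist s t \<le> (\<Sum>i\<in>UNIV. \<bar>(s - t) $ i\<bar>)" unfolding dist_norm by (rule norm_le_l1_cart)
    also have "\<dots> \<le> (\<Sum>i\<in>(UNIV :: 'd set). r)" using s by (intro sum_mono) (auto simp: abs_le_iff less_imp_le algebra_simps)
    also have "\<dots> < e" using e(1) by (simp add: r_def)
    finally have "0 < f s" using s(1) by (intro e(2)) (auto simp: less_imp_le)
    then show "s \<in> {s\<in>space lborel. ennreal (f s) \<noteq> 0}" by simp
  qed
  then have "emeasure lborel (box t ?b) \<le> emeasure lborel {s\<in>space lborel. ennreal (f s) \<noteq> 0}"
    by (rule emeasure_mono) measurable
  then have "emeasure lborel (box t ?b) \<le> 0" by (simp only: null)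
  moreover have "0 < emeasure lborel (box t ?b)"
  proof -
    have "\<forall>b\<in>Basis. t \<bullet> b \<le> ?b \<bullet> b" using r by (auto simp: Basis_vec_def inner_axis)
    moreover have "0 < (\<Prod>b\<in>Basis. (?b - t) \<bullet> b)" using r by (intro prod_pos) (auto simp: Basis_vec_def inner_axis)
    ultimately show ?thesis by (simp add: emeasure_lborel_box_eq)
  qed
  ultimately show False by simp
qed

text \<open>A spectral field all of whose paths are in the path space, so that it is a measurable map into it.\<close>

locale spectral_field = prob_space M for M :: "'w measure" +
  fixes Z :: "'w \<Rightarrow> real ^ 'd::finite \<Rightarrow> real" and \<delta> :: real
  assumes mZ: "Z \<in> M \<rightarrow>\<^sub>M cadlag_algebra"
    and stat: "stationary (max_stable_space M) (max_stable_field Z)"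
    and mean: "\<And>t. (\<integral>\<^sup>+\<omega>. ennreal (Z \<omega> t) \<partial>M) = 1"
    and sup_fin: "\<And>T. T > 0 \<Longrightarrow> (\<integral>\<^sup>+\<omega>. (SUP t\<in>cube T. ennreal (Z \<omega> t)) \<partial>M) < \<infinity>"
    and \<delta>: "0 \<le> \<delta>"
begin

abbreviation "\<nu> \<equiv> exponent_measure M Z"
abbreviation "L \<equiv> mesh \<delta>"

lemma L_pos: "0 < L" by (rule mesh_pos[OF \<delta>])

lemma exponent_shift:
  "\<Phi> \<in> borel_measurable cadlag_algebra \<Longrightarrow> \<Phi> (\<lambda>_. 0) = 0 \<Longrightarrow>
    (\<integral>\<^sup>+f. \<Phi> (\<lambda>t. f (t - h)) \<partial>\<nu>) = (\<integral>\<^sup>+f. \<Phi> f \<partial>\<nu>)"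
  by (rule exponent_measure_shift[OF prob_space_axioms mZ stat]) (simp_all add: mean)

lemma measurable_back:
  "\<Phi> \<in> borel_measurable cadlag_algebra \<Longrightarrow> (\<lambda>f. \<Phi> (\<lambda>t. f (t + h))) \<in> borel_measurable cadlag_algebra"
  using measurable_compose[OF measurable_cadlag_shift[of "- h"], of \<Phi> borel] by simp

text \<open>The weights that the lattice translates of a path get from \<open>u\<close>, divided by their sum \<open>U\<close>, add up to
  one. Shift invariance moves the part of weight with index \<open>k\<close> to the origin, so \<open>\<nu>\<close> is the sum of
  the translates of the measure with density \<open>u / U\<close>, as far as \<open>U\<close> is positive and finite.\<close>

lemma mass_transport:
  assumes u: "u \<in> borel_measurable cadlag_algebra"
    and \<Phi>: "\<Phi> \<in> borel_measurable cadlag_algebra" and \<Phi>0: "\<Phi> (\<lambda>_. 0) = 0"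
  defines "U \<equiv> \<lambda>f. (\<integral>\<^sup>+k. u (\<lambda>t. f (t + lattice_point L k)) \<partial>count_space UNIV)"
  shows "(\<integral>\<^sup>+f. \<Phi> f * indicator {f. 0 < U f \<and> U f < \<infinity>} f \<partial>\<nu>)
    = (\<integral>\<^sup>+k. (\<integral>\<^sup>+f. \<Phi> (\<lambda>t. f (t - lattice_point L k)) * (u f / U f) \<partial>\<nu>) \<partial>count_space UNIV)"
proof -
  have mu: "(\<lambda>f. u (\<lambda>t. f (t + lattice_point L k))) \<in> borel_measurable cadlag_algebra" for k
    by (rule measurable_back[OF u])
  have mU: "U \<in> borel_measurable cadlag_algebra"
    unfolding U_def using mu by (rule borel_measurable_nn_integral_count_space)
  have U_shift: "U (\<lambda>t. f (t - lattice_point L j)) = U f" for f and j :: "'d \<Rightarrow> int"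
  proof -
    have bij: "bij_betw (\<lambda>k i. k i - j i) (UNIV :: ('d \<Rightarrow> int) set) UNIV"
      by (rule bij_betw_byWitness[where f' = "\<lambda>k i. k i + j i"]) auto
    have "t + lattice_point L k - lattice_point L j = t + lattice_point L (\<lambda>i. k i - j i)" for t k
      by (simp add: vec_eq_iff algebra_simps)
    then show ?thesis
      unfolding U_def using nn_integral_bij_count_space[OF bij, of "\<lambda>k. u (\<lambda>t. f (t + lattice_point L k))"]
      by (simp only:)
  qed
  let ?\<Psi> = "\<lambda>k f. \<Phi> f * (u (\<lambda>t. f (t + lattice_point L k)) / U f)"
  have m\<Psi>: "?\<Psi> k \<in> borel_measurable cadlag_algebra" for k
    using \<Phi> mu mU by (intro borel_measurable_times_ennreal borel_measurable_divide_ennreal)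
  have "(\<integral>\<^sup>+k. (\<integral>\<^sup>+f. \<Phi> (\<lambda>t. f (t - lattice_point L k)) * (u f / U f) \<partial>\<nu>) \<partial>count_space UNIV)
      = (\<integral>\<^sup>+k. (\<integral>\<^sup>+f. ?\<Psi> k (\<lambda>t. f (t - lattice_point L k)) \<partial>\<nu>) \<partial>count_space UNIV)"
    by (simp add: U_shift)
  also have "\<dots> = (\<integral>\<^sup>+k. (\<integral>\<^sup>+f. ?\<Psi> k f \<partial>\<nu>) \<partial>count_space UNIV)"
    by (intro nn_integral_cong exponent_shift m\<Psi>) (simp add: \<Phi>0)
  also have "\<dots> = (\<integral>\<^sup>+f. (\<integral>\<^sup>+k. ?\<Psi> k f \<partial>count_space UNIV) \<partial>\<nu>)"
    using m\<Psi> by (subst nn_integral_count_space_nn_integral) simp_all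
  also have "\<dots> = (\<integral>\<^sup>+f. \<Phi> f * indicator {f. 0 < U f \<and> U f < \<infinity>} f \<partial>\<nu>)"
  proof (rule nn_integral_cong)
    fix f
    have "(\<integral>\<^sup>+k. ?\<Psi> k f \<partial>count_space UNIV) = \<Phi> f * (U f / U f)"
      unfolding U_def by (simp add: nn_integral_cmult nn_integral_divide)
    also have "U f / U f = indicator {f. 0 < U f \<and> U f < \<infinity>} f"
      by (cases "U f = 0"; cases "U f = top")
         (simp_all add: ennreal_divide_self less_top zero_less_iff_neq_zero)
    finally show "(\<integral>\<^sup>+k. ?\<Psi> k f \<partial>count_space UNIV) = \<Phi> f * indicator {f. 0 < U f \<and> U f < \<infinity>} f" .
  qed
  finally show ?thesis ..
qed

lemma cell_sup_rescale: "0 < s \<Longrightarrow> cell_sup L k (\<lambda>t. f t / s) = cell_sup L k f / ennreal s"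
  if "f \<in> cadlag" for f
proof -
  assume s: "0 < s"
  have "cell_sup L k (\<lambda>t. f t / s) = (SUP t\<in>cell L k. ennreal (f t) / ennreal s)"
    unfolding cell_sup_def using s cadlag_nonneg[OF that] by (simp add: divide_ennreal)
  also have "\<dots> = cell_sup L k f / ennreal s"
    unfolding cell_sup_def divide_ennreal_def
    by (rule SUP_mult_right_ennreal[symmetric])
  finally show ?thesis .
qed

lemma one_less_cell_sup_rescale:
  assumes "f \<in> cadlag" "0 < s"
  shows "1 < cell_sup L k (\<lambda>t. f t / s) \<longleftrightarrow> ennreal s < cell_sup L k f"
proof -
  have "1 < ennreal (f t / s) \<longleftrightarrow> ennreal s < ennreal (f t)" for t
    using assms cadlag_nonneg[OF assms(1), of t]
    by (simp add: ennreal_less_iff pos_less_divide_eq flip: ennreal_1)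
  then show ?thesis by (simp add: cell_sup_def less_SUP_iff)
qed

lemma measurable_cell_sup_field: "(\<lambda>\<omega>. cell_sup L k (Z \<omega>)) \<in> borel_measurable M"
  by (rule measurable_compose[OF mZ measurable_cell_sup])

lemma Z_cadlag: "\<omega> \<in> space M \<Longrightarrow> Z \<omega> \<in> cadlag"
  using measurable_space[OF mZ] by simp

lemma sets_cell_sup: "{f\<in>cadlag. 1 < cell_sup L k f} \<in> sets cadlag_algebra"
proof -
  have [measurable]: "cell_sup L k \<in> borel_measurable cadlag_algebra" by (rule measurable_cell_sup)
  have "{f\<in>space cadlag_algebra. 1 < cell_sup L k f} \<in> sets cadlag_algebra" by measurable
  then show ?thesis by simp
qed

lemma exponent_cell_sup:
  "emeasure \<nu> {f\<in>cadlag. 1 < cell_sup L k f} = (\<integral>\<^sup>+\<omega>. cell_sup L k (Z \<omega>) \<partial>M)"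
proof -
  have "emeasure \<nu> {f\<in>cadlag. 1 < cell_sup L k f}
      = (\<integral>\<^sup>+s\<in>{0<..}. emeasure M {\<omega>\<in>space M. (\<lambda>t. Z \<omega> t / s) \<in> {f\<in>cadlag. 1 < cell_sup L k f}} \<partial>lborel)"
    by (rule emeasure_exponent_measure[OF sigma_finite_measure_axioms mZ sets_cell_sup])
  also have "\<dots> = (\<integral>\<^sup>+s\<in>{0<..}. emeasure M {\<omega>\<in>space M. ennreal s < cell_sup L k (Z \<omega>)} \<partial>lborel)"
  proof (rule nn_integral_cong)
    fix s :: real
    have "{\<omega>\<in>space M. (\<lambda>t. Z \<omega> t / s) \<in> {f\<in>cadlag. 1 < cell_sup L k f}} = {\<omega>\<in>space M. ennreal s < cell_sup L k (Z \<omega>)}"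
      if "0 < s"
      using that Z_cadlag by (intro Collect_cong conj_cong refl) (simp add: cadlag_divide one_less_cell_sup_rescale)
    then show "emeasure M {\<omega>\<in>space M. (\<lambda>t. Z \<omega> t / s) \<in> {f\<in>cadlag. 1 < cell_sup L k f}} * indicator {0<..} s
        = emeasure M {\<omega>\<in>space M. ennreal s < cell_sup L k (Z \<omega>)} * indicator {0<..} s"
      by (cases "0 < s") simp_all
  qed
  also have "\<dots> = (\<integral>\<^sup>+\<omega>. cell_sup L k (Z \<omega>) \<partial>M)"
    by (rule layer_cake[OF measurable_cell_sup_field])
  finally show ?thesis .
qed

text \<open>The closed cube of side \<open>L\<close>, over which the supremum has finite mean, contains the cell at the origin.\<close>

lemma exponent_cell_sup_finite: "emeasure \<nu> {f\<in>cadlag. 1 < cell_sup L (\<lambda>_. 0) f} < \<infinity>"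
proof -
  have sub: "cell L (\<lambda>_. 0) \<subseteq> (cube L :: (real ^ 'd) set)" by (auto simp: cell_def cube_def less_imp_le)
  have "(\<integral>\<^sup>+\<omega>. cell_sup L (\<lambda>_. 0) (Z \<omega>) \<partial>M) \<le> (\<integral>\<^sup>+\<omega>. (SUP t\<in>cube L. ennreal (Z \<omega> t)) \<partial>M)"
    unfolding cell_sup_def by (intro nn_integral_mono SUP_subset_mono sub) simp
  then show ?thesis unfolding exponent_cell_sup using sup_fin[OF L_pos] by (rule le_less_trans)
qed

lemma exceed_mass_imp_cell_sup: "exceed_mass \<delta> (cell L k) f \<noteq> 0 \<Longrightarrow> 1 < cell_sup L k f"
proof (rule ccontr)
  assume a: "exceed_mass \<delta> (cell L k) f \<noteq> 0" and "\<not> 1 < cell_sup L k f"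
  then have "\<not> 1 < f t" if "t \<in> cell L k" for t
    using that by (auto simp: cell_sup_def less_SUP_iff ennreal_less_iff simp flip: ennreal_1)
  then have "{t\<in>cell L k. 1 < f t} = {}" by blast
  with a show False by (simp add: exceed_mass_def)
qed

end

section \<open>Paths of finite mass\<close>

lemma divide_left_mono_ennreal:
  fixes a b c :: ennreal
  assumes "b \<le> c"
  shows "a / c \<le> a / b"
proof -
  have "inverse c \<le> inverse b"
  proof (cases b)
    case (real r)
    show ?thesis
    proof (cases c)
      case (real q)
      show ?thesis
      proof (cases "r = 0")
        case False
        then have "0 < r" "0 < q" "r \<le> q"
          using \<open>b = ennreal r\<close> \<open>0 \<le> r\<close> real assms by (auto simp: ennreal_le_iff)
        then show ?thesis using \<open>b = ennreal r\<close> real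
          by (simp add: inverse_ennreal le_imp_inverse_le)
      qed (simp add: \<open>b = ennreal r\<close>)
    qed simp
  next
    case top
    then show ?thesis using assms by (simp add: top_unique)
  qed
  then show ?thesis unfolding divide_ennreal_def by (rule mult_left_mono) simp
qed

lemma divide_tendsto_0_ennreal:
  fixes u :: "nat \<Rightarrow> ennreal"
  assumes "u \<longlonglongrightarrow> top" "a < top"
  shows "(\<lambda>n. a / u n) \<longlonglongrightarrow> 0"
proof (rule order_tendstoI)
  fix e :: ennreal assume "0 < e"
  then obtain r where r: "0 < ennreal r" "ennreal r < e"
    by (metis dense ennreal_cases less_top order_less_imp_not_eq2 top.not_eq_extremum less_le_trans top_greatest)
  have r0: "0 < r" using r(1) by simp
  from \<open>a < top\<close> obtain q where q: "a = ennreal q" "0 \<le> q" by (cases a) auto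
  have "eventually (\<lambda>n. ennreal ((q + 1) / r) < u n) sequentially"
    by (rule order_tendstoD(1)[OF assms(1)]) simp
  then show "eventually (\<lambda>n. a / u n < e) sequentially"
  proof eventually_elim
    case (elim n)
    have "a / u n \<le> ennreal q / ennreal ((q + 1) / r)"
      unfolding q by (rule divide_left_mono_ennreal) (use elim in simp)
    also have "\<dots> = ennreal (q / (q + 1) * r)" using q r0 by (subst divide_ennreal) (auto simp: field_simps)
    also have "\<dots> \<le> ennreal r"
    proof (rule ennreal_leI)
      have "q / (q + 1) \<le> 1" using q by simp
      then show "q / (q + 1) * r \<le> r" using mult_right_mono[of "q / (q + 1)" 1 r] r0 by simp
    qed
    finally show ?case using r(2) by (rule le_less_trans)
  qed
qed simp

lemma divide_ennreal_cancel: "0 < s \<Longrightarrow> a / ennreal s = b / ennreal s \<longleftrightarrow> a = b"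
proof
  assume s: "0 < s" and "a / ennreal s = b / ennreal s"
  then have "a / ennreal s * ennreal s = b / ennreal s * ennreal s" by simp
  then show "a = b" using s by (simp add: ennreal_divide_times ennreal_divide_self)
qed simp

context spectral_field
begin

text \<open>Transport each cell's fraction of the mass to the origin. The sum of the weights \<open>U\<close> is the total mass,
  which is positive for every path but zero, so precisely the paths of finite mass are
  decomposed into translates and \<open>tiling_limit\<close> applies.\<close>

lemma finite_mass_limit:
  obtains l where "l < \<infinity>"
    "((\<lambda>T. emeasure \<nu> (exceed_event \<delta> x (cube T) \<inter> finite_mass) / ennreal (T ^ CARD('d))) \<longlongrightarrow> l) at_top"
proof -
  let ?u = "cell_mass L (\<lambda>_::'d. 0)"
  let ?U = "\<lambda>f. \<integral>\<^sup>+k. ?u (\<lambda>t. f (t + lattice_point L k)) \<partial>count_space UNIV"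
  let ?F = "finite_mass :: (real ^ 'd \<Rightarrow> real) set"
  have mu: "?u \<in> borel_measurable cadlag_algebra" by (rule measurable_cell_mass)
  have U: "?U f = total_mass 0 f" if "f \<in> cadlag" for f
    using that by (simp add: cell_mass_back total_mass_cells[OF L_pos])
  have mU: "?U \<in> borel_measurable cadlag_algebra"
    by (rule borel_measurable_nn_integral_count_space[OF measurable_back[OF mu]])
  have mF: "?F \<in> sets cadlag_algebra" by (rule sets_finite_mass)
  define m where "m = density \<nu> (\<lambda>f. ?u f / ?U f)"
  define \<nu>' where "\<nu>' = density \<nu> (indicator ?F)"
  have mw: "(\<lambda>f. ?u f / ?U f) \<in> borel_measurable \<nu>"
    using borel_measurable_divide_ennreal[OF mu mU] by (simp add: measurable_cong_sets[OF sets_exponent_measure refl])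
  have \<nu>': "emeasure \<nu>' A = emeasure \<nu> (?F \<inter> A)" if "A \<in> sets cadlag_algebra" for A
    unfolding \<nu>'_def using mF that
    by (subst emeasure_density) (auto simp: indicator_inter_arith[symmetric] nn_integral_indicator[symmetric] simp del: nn_integral_indicator)
  have sm: "sets m = sets cadlag_algebra" by (simp add: m_def)
  have transport: "emeasure \<nu>' A
      = (\<integral>\<^sup>+k. emeasure m {f\<in>cadlag. (\<lambda>t. f (t - lattice_point L k)) \<in> A} \<partial>count_space UNIV)"
    if A: "A \<in> sets cadlag_algebra" and 0: "(\<lambda>_. 0) \<notin> A" for A
  proof -
    have mA: "indicator A \<in> borel_measurable cadlag_algebra" using A by simp
    have "emeasure \<nu>' A = (\<integral>\<^sup>+f. indicator (?F \<inter> A) f \<partial>\<nu>)"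
      using \<nu>'[OF A] mF A by (simp add: sets.Int)
    also have "\<dots> = (\<integral>\<^sup>+f. indicator A f * indicator {f. 0 < ?U f \<and> ?U f < \<infinity>} f \<partial>\<nu>)"
    proof (rule nn_integral_cong)
      fix f assume "f \<in> space \<nu>"
      then have f: "f \<in> cadlag" by simp
      have "0 < total_mass 0 f" if "f \<in> A"
        using total_mass_0_imp_zero[OF f] 0 that by (auto simp: zero_less_iff_neq_zero)
      then show "indicator (?F \<inter> A) f = (indicator A f * indicator {f. 0 < ?U f \<and> ?U f < \<infinity>} f :: ennreal)"
        using U[OF f] f by (auto simp: indicator_def finite_mass_def)
    qed
    also have "\<dots> = (\<integral>\<^sup>+k. (\<integral>\<^sup>+f. indicator A (\<lambda>t. f (t - lattice_point L k)) * (?u f / ?U f) \<partial>\<nu>) \<partial>count_space UNIV)"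
      by (rule mass_transport[OF mu mA]) (simp add: 0)
    also have "\<dots> = (\<integral>\<^sup>+k. emeasure m {f\<in>cadlag. (\<lambda>t. f (t - lattice_point L k)) \<in> A} \<partial>count_space UNIV)"
    proof (rule nn_integral_cong)
      fix k :: "'d \<Rightarrow> int"
      have B: "{f\<in>cadlag. (\<lambda>t. f (t - lattice_point L k)) \<in> A} \<in> sets \<nu>"
        using measurable_sets[OF measurable_cadlag_shift A, of "lattice_point L k"]
        by (simp add: vimage_def Int_def conj_commute)
      show "(\<integral>\<^sup>+f. indicator A (\<lambda>t. f (t - lattice_point L k)) * (?u f / ?U f) \<partial>\<nu>)
          = emeasure m {f\<in>cadlag. (\<lambda>t. f (t - lattice_point L k)) \<in> A}"
        unfolding m_def emeasure_density[OF mw B]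
        by (intro nn_integral_cong) (simp add: indicator_def)
    qed
    finally show ?thesis .
  qed
  have fin: "emeasure \<nu>' {f\<in>cadlag. exceed_mass \<delta> (cell L (\<lambda>_::'d. 0)) f \<noteq> 0} < \<infinity>"
  proof -
    have "{f\<in>cadlag. exceed_mass \<delta> (cell L (\<lambda>_::'d. 0)) f \<noteq> 0} = (exceed_event \<delta> 0 (cell L (\<lambda>_::'d. 0)))"
      by (simp add: zero_less_iff_neq_zero)
    then have "{f\<in>cadlag. exceed_mass \<delta> (cell L (\<lambda>_::'d. 0)) f \<noteq> 0} \<in> sets cadlag_algebra"
      using sets_exceed_event[OF \<delta> sets_cell, of 0] by simp
    then have "emeasure \<nu>' {f\<in>cadlag. exceed_mass \<delta> (cell L (\<lambda>_::'d. 0)) f \<noteq> 0}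
        = emeasure \<nu> (?F \<inter> {f\<in>cadlag. exceed_mass \<delta> (cell L (\<lambda>_::'d. 0)) f \<noteq> 0})" by (rule \<nu>')
    also have "\<dots> \<le> emeasure \<nu> {f\<in>cadlag. 1 < cell_sup L (\<lambda>_::'d. 0) f}"
      using exceed_mass_imp_cell_sup sets_cell_sup by (intro emeasure_mono) auto
    finally have "emeasure \<nu>' {f\<in>cadlag. exceed_mass \<delta> (cell L (\<lambda>_::'d. 0)) f \<noteq> 0}
        \<le> emeasure \<nu> {f\<in>cadlag. 1 < cell_sup L (\<lambda>_::'d. 0) f}" .
    then show ?thesis using exponent_cell_sup_finite by (rule le_less_trans)
  qed
  note lim = tiling_limit[OF \<delta> sm transport fin, of x]
  have "emeasure \<nu>' (exceed_event \<delta> x (cube T)) = emeasure \<nu> (exceed_event \<delta> x (cube T) \<inter> finite_mass)" for T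
    unfolding \<nu>'[OF sets_exceed_event[OF \<delta> sets_cube]] by (simp only: Int_commute)
  with lim show ?thesis
    by (intro that[of "emeasure m (exceed_event \<delta> x UNIV) * ennreal ((1 / L) ^ CARD('d))"])
       (simp_all add: ennreal_mult_less_top)
qed

section \<open>Cells with the largest supremum\<close>

definition path_sup :: "(real ^ 'd \<Rightarrow> real) \<Rightarrow> ennreal" where
  "path_sup f = (SUP k. cell_sup L k f)"

definition peak_weight :: "(real ^ 'd \<Rightarrow> real) \<Rightarrow> ennreal" where
  "peak_weight f = indicator {f. cell_sup L (\<lambda>_. 0) f = path_sup f} f"

definition peak_count :: "(real ^ 'd \<Rightarrow> real) \<Rightarrow> ennreal" where
  "peak_count f = (\<integral>\<^sup>+k. peak_weight (\<lambda>t. f (t + lattice_point L k)) \<partial>count_space UNIV)"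

lemma cell_sup_back: "cell_sup L j (\<lambda>t. f (t + lattice_point L k)) = cell_sup L (\<lambda>i. j i + k i) f"
  using cell_sup_shift[of L "\<lambda>i. j i + k i" "\<lambda>t. f (t + lattice_point L k)" k] by simp

lemma path_sup_back: "path_sup (\<lambda>t. f (t + lattice_point L k)) = path_sup f"
proof -
  have "range (\<lambda>j. cell_sup L (\<lambda>i. j i + k i) f) = range (\<lambda>j. cell_sup L j f)"
  proof (intro antisym subsetI)
    fix y assume "y \<in> range (\<lambda>j. cell_sup L j f)"
    then obtain j where "y = cell_sup L j f" by blast
    then have "y = cell_sup L (\<lambda>i. (j i - k i) + k i) f" by simp
    then show "y \<in> range (\<lambda>j. cell_sup L (\<lambda>i. j i + k i) f)" by (rule range_eqI[where x = "\<lambda>i. j i - k i"])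
  qed auto
  then show ?thesis by (simp only: path_sup_def cell_sup_back)
qed

lemma peak_count_eq: "peak_count f = emeasure (count_space UNIV) {k. cell_sup L k f = path_sup f}"
proof -
  have "peak_count f = (\<integral>\<^sup>+k. indicator {k. cell_sup L k f = path_sup f} k \<partial>count_space UNIV)"
    unfolding peak_count_def peak_weight_def
    by (intro nn_integral_cong) (simp add: indicator_def cell_sup_back path_sup_back)
  then show ?thesis by simp
qed

lemma measurable_path_sup: "path_sup \<in> borel_measurable cadlag_algebra"
  unfolding path_sup_def[abs_def] by (intro borel_measurable_SUP measurable_cell_sup) simp

lemma measurable_peak_weight: "peak_weight \<in> borel_measurable cadlag_algebra"
proof -
  have [measurable]: "path_sup \<in> borel_measurable cadlag_algebra" by (rule measurable_path_sup)
  have [measurable]: "cell_sup L (\<lambda>_::'d. 0) \<in> borel_measurable cadlag_algebra" by (rule measurable_cell_sup)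
  have S: "{f\<in>space cadlag_algebra. cell_sup L (\<lambda>_::'d. 0) f = path_sup f} \<in> sets cadlag_algebra" by measurable
  show ?thesis
    by (subst measurable_cong[of _ _ "indicator {f\<in>space cadlag_algebra. cell_sup L (\<lambda>_::'d. 0) f = path_sup f}"])
       (use S in \<open>auto simp: peak_weight_def indicator_def\<close>)
qed

lemma measurable_peak_count: "peak_count \<in> borel_measurable cadlag_algebra"
  unfolding peak_count_def[abs_def]
  by (rule borel_measurable_nn_integral_count_space[OF measurable_back[OF measurable_peak_weight]])

lemma peak_weight_rescale:
  assumes f: "f \<in> cadlag" and s: "0 < s"
  shows "peak_weight (\<lambda>t. f t / s) = peak_weight f" and "peak_count (\<lambda>t. f t / s) = peak_count f"
proof -
  have c: "cell_sup L k (\<lambda>t. f t / s) = cell_sup L k f / ennreal s" for k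
    by (rule cell_sup_rescale[OF f s])
  have p: "path_sup (\<lambda>t. f t / s) = path_sup f / ennreal s"
    unfolding path_sup_def c unfolding divide_ennreal_def by (rule SUP_mult_right_ennreal[symmetric])
  show "peak_weight (\<lambda>t. f t / s) = peak_weight f"
    unfolding peak_weight_def by (simp add: indicator_def c p divide_ennreal_cancel[OF s])
  show "peak_count (\<lambda>t. f t / s) = peak_count f"
    unfolding peak_count_eq by (simp add: c p divide_ennreal_cancel[OF s])
qed

lemma total_mass_rescale:
  assumes f: "f \<in> cadlag" and s: "0 < s"
  shows "total_mass 0 (\<lambda>t. f t / s) = total_mass 0 f / ennreal s"
proof -
  have [measurable]: "f \<in> borel_measurable borel" by (rule borel_measurable_cadlag[OF f])
  have "total_mass 0 (\<lambda>t. f t / s) = (\<integral>\<^sup>+t. ennreal (f t) / ennreal s \<partial>lborel)"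
    unfolding total_mass_0 using s cadlag_nonneg[OF f] by (simp add: divide_ennreal)
  then show ?thesis by (simp add: nn_integral_divide total_mass_0)
qed

lemma total_mass_rescale_top:
  "f \<in> cadlag \<Longrightarrow> 0 < s \<Longrightarrow> total_mass 0 (\<lambda>t. f t / s) = top \<longleftrightarrow> total_mass 0 f = top"
  by (simp add: total_mass_rescale ennreal_divide_eq_top_iff)

lemma cells_summable_imp_mass_finite:
  fixes f :: "real ^ 'd \<Rightarrow> real"
  assumes f: "f \<in> cadlag" and fin: "(\<integral>\<^sup>+k. cell_sup L k f \<partial>count_space UNIV) < \<infinity>"
  shows "total_mass 0 f < \<infinity>"
proof -
  have "total_mass 0 f \<le> (\<integral>\<^sup>+k. cell_sup L k f * ennreal (L ^ CARD('d)) \<partial>count_space UNIV)"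
    unfolding total_mass_cells[OF L_pos f]
    using cell_mass_le_sup[of L _ f] L_pos by (intro nn_integral_mono) (simp add: emeasure_lborel_cell)
  also have "\<dots> = (\<integral>\<^sup>+k. cell_sup L k f \<partial>count_space UNIV) * ennreal (L ^ CARD('d))"
    by (rule nn_integral_multc) simp
  also have "\<dots> < \<infinity>" using fin by (simp add: ennreal_mult_less_top)
  finally show ?thesis .
qed

text \<open>Let \<open>w = peak_weight / peak_count\<close>, the weight of a path whose largest cell supremum is attained in
  finitely many cells, shared equally among these. By mass transport the sum over all cells of the
  \<open>w\<close>-weighted measure of an exceedance in the cell is at most the measure of an exceedance in the cell at
  the origin, which is finite. As \<open>w\<close> is insensitive to the scale of the path, integrating over the scale
  turns the exceedances into the cell suprema themselves, which are therefore summable where \<open>w\<close> is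
  positive.\<close>

lemma peak_at_origin_imp_mass_finite:
  "AE \<omega> in M. peak_weight (Z \<omega>) / peak_count (Z \<omega>) = 0 \<or> total_mass 0 (Z \<omega>) < \<infinity>"
proof -
  let ?w = "\<lambda>f. peak_weight f / peak_count f"
  let ?Y = "{f\<in>cadlag. 1 < cell_sup L (\<lambda>_::'d. 0) f}"
  have mw: "?w \<in> borel_measurable cadlag_algebra"
    by (rule borel_measurable_divide_ennreal[OF measurable_peak_weight measurable_peak_count])
  have mwZ [measurable]: "(\<lambda>\<omega>. ?w (Z \<omega>)) \<in> borel_measurable M" by (rule measurable_compose[OF mZ mw])
  have mYZ [measurable]: "(\<lambda>\<omega>. cell_sup L k (Z \<omega>)) \<in> borel_measurable M" for k by (rule measurable_cell_sup_field)
  have mI: "indicator {f\<in>cadlag. 1 < cell_sup L k f} \<in> borel_measurable cadlag_algebra" for k :: "'d \<Rightarrow> int"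
    by (rule borel_measurable_indicator[OF sets_cell_sup])
  have "(\<integral>\<^sup>+k. (\<integral>\<^sup>+f. indicator ?Y (\<lambda>t. f (t - lattice_point L k)) * ?w f \<partial>\<nu>) \<partial>count_space UNIV)
      = (\<integral>\<^sup>+f. indicator ?Y f * indicator {f. 0 < peak_count f \<and> peak_count f < \<infinity>} f \<partial>\<nu>)"
    unfolding peak_count_def
    by (rule mass_transport[symmetric, OF measurable_peak_weight mI]) (simp add: indicator_def cell_sup_def less_SUP_iff)
  also have "\<dots> \<le> (\<integral>\<^sup>+f. indicator ?Y f \<partial>\<nu>)"
    by (intro nn_integral_mono) (simp add: indicator_def)
  also have "\<dots> = emeasure \<nu> ?Y" by (rule nn_integral_indicator) (simp only: sets_exponent_measure sets_cell_sup)
  also have "\<dots> < \<infinity>" by (rule exponent_cell_sup_finite)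
  finally have "(\<integral>\<^sup>+k. (\<integral>\<^sup>+f. indicator ?Y (\<lambda>t. f (t - lattice_point L k)) * ?w f \<partial>\<nu>) \<partial>count_space UNIV) < \<infinity>" .
  also have "(\<integral>\<^sup>+k. (\<integral>\<^sup>+f. indicator ?Y (\<lambda>t. f (t - lattice_point L k)) * ?w f \<partial>\<nu>) \<partial>count_space UNIV)
      = (\<integral>\<^sup>+k. (\<integral>\<^sup>+f. indicator {f\<in>cadlag. 1 < cell_sup L (\<lambda>i. - k i) f} f * ?w f \<partial>\<nu>) \<partial>count_space UNIV)"
    by (intro nn_integral_cong) (simp add: indicator_def cell_sup_shift cadlag_shift)
  also have "\<dots> = (\<integral>\<^sup>+k. (\<integral>\<^sup>+f. indicator {f\<in>cadlag. 1 < cell_sup L k f} f * ?w f \<partial>\<nu>) \<partial>count_space UNIV)"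
    by (rule nn_integral_count_space_uminus)
  also have "\<dots> = (\<integral>\<^sup>+k. (\<integral>\<^sup>+\<omega>. ?w (Z \<omega>) * cell_sup L k (Z \<omega>) \<partial>M) \<partial>count_space UNIV)"
  proof (rule nn_integral_cong)
    fix k :: "'d \<Rightarrow> int"
    interpret P: pair_sigma_finite M "lborel :: real measure" ..
    have "(\<integral>\<^sup>+f. indicator {f\<in>cadlag. 1 < cell_sup L k f} f * ?w f \<partial>\<nu>)
        = (\<integral>\<^sup>+s\<in>{0<..}. (\<integral>\<^sup>+\<omega>. indicator {f\<in>cadlag. 1 < cell_sup L k f} (\<lambda>t. Z \<omega> t / s) * ?w (\<lambda>t. Z \<omega> t / s) \<partial>M) \<partial>lborel)"
      by (rule nn_integral_exponent_measure[OF sigma_finite_measure_axioms mZ borel_measurable_times_ennreal[OF mI mw]])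
    also have "\<dots> = (\<integral>\<^sup>+s. (\<integral>\<^sup>+\<omega>. ?w (Z \<omega>) * (indicator {0<..} s * indicator {s. ennreal s < cell_sup L k (Z \<omega>)} s) \<partial>M) \<partial>lborel)"
    proof (rule nn_integral_cong)
      fix s :: real
      have "(\<integral>\<^sup>+\<omega>. indicator {f\<in>cadlag. 1 < cell_sup L k f} (\<lambda>t. Z \<omega> t / s) * ?w (\<lambda>t. Z \<omega> t / s) \<partial>M)
          = (\<integral>\<^sup>+\<omega>. ?w (Z \<omega>) * (indicator {0<..} s * indicator {s. ennreal s < cell_sup L k (Z \<omega>)} s) \<partial>M)" if s: "0 < s"
      proof (rule nn_integral_cong)
        fix \<omega> assume "\<omega> \<in> space M"
        then have f: "Z \<omega> \<in> cadlag" by (rule Z_cadlag)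
        show "indicator {f\<in>cadlag. 1 < cell_sup L k f} (\<lambda>t. Z \<omega> t / s) * ?w (\<lambda>t. Z \<omega> t / s)
            = ?w (Z \<omega>) * (indicator {0<..} s * indicator {s. ennreal s < cell_sup L k (Z \<omega>)} s)"
          using s by (simp add: peak_weight_rescale[OF f s] indicator_def cadlag_divide[OF f less_imp_le[OF s]] one_less_cell_sup_rescale[OF f s])
      qed
      then show "(\<integral>\<^sup>+\<omega>. indicator {f\<in>cadlag. 1 < cell_sup L k f} (\<lambda>t. Z \<omega> t / s) * ?w (\<lambda>t. Z \<omega> t / s) \<partial>M) * indicator {0<..} s
          = (\<integral>\<^sup>+\<omega>. ?w (Z \<omega>) * (indicator {0<..} s * indicator {s. ennreal s < cell_sup L k (Z \<omega>)} s) \<partial>M)"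
        by (cases "0 < s") simp_all
    qed
    also have "\<dots> = (\<integral>\<^sup>+\<omega>. (\<integral>\<^sup>+s. ?w (Z \<omega>) * (indicator {0<..} s * indicator {s. ennreal s < cell_sup L k (Z \<omega>)} s) \<partial>lborel) \<partial>M)"
      by (rule P.Fubini') measurable
    also have "\<dots> = (\<integral>\<^sup>+\<omega>. ?w (Z \<omega>) * cell_sup L k (Z \<omega>) \<partial>M)"
    proof (rule nn_integral_cong)
      fix \<omega>
      have "(\<integral>\<^sup>+s. ?w (Z \<omega>) * (indicator {0<..} s * indicator {s. ennreal s < cell_sup L k (Z \<omega>)} s) \<partial>lborel)
          = ?w (Z \<omega>) * (\<integral>\<^sup>+s. indicator {0<..} s * indicator {s. ennreal s < cell_sup L k (Z \<omega>)} s \<partial>lborel)"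
        by (rule nn_integral_cmult) measurable
      then show "(\<integral>\<^sup>+s. ?w (Z \<omega>) * (indicator {0<..} s * indicator {s. ennreal s < cell_sup L k (Z \<omega>)} s) \<partial>lborel)
          = ?w (Z \<omega>) * cell_sup L k (Z \<omega>)" by (simp only: nn_integral_indicator_less)
    qed
    finally show "(\<integral>\<^sup>+f. indicator {f\<in>cadlag. 1 < cell_sup L k f} f * ?w f \<partial>\<nu>) = (\<integral>\<^sup>+\<omega>. ?w (Z \<omega>) * cell_sup L k (Z \<omega>) \<partial>M)" .
  qed
  also have "\<dots> = (\<integral>\<^sup>+\<omega>. (\<integral>\<^sup>+k. ?w (Z \<omega>) * cell_sup L k (Z \<omega>) \<partial>count_space UNIV) \<partial>M)"
    by (subst nn_integral_count_space_nn_integral) simp_all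
  finally have fin: "(\<integral>\<^sup>+\<omega>. (\<integral>\<^sup>+k. ?w (Z \<omega>) * cell_sup L k (Z \<omega>) \<partial>count_space UNIV) \<partial>M) \<noteq> \<infinity>" by simp
  have "AE \<omega> in M. (\<integral>\<^sup>+k. ?w (Z \<omega>) * cell_sup L k (Z \<omega>) \<partial>count_space UNIV) \<noteq> \<infinity>"
    by (rule nn_integral_PInf_AE[OF borel_measurable_nn_integral_count_space fin]) measurable
  then show ?thesis using AE_space
  proof eventually_elim
    case (elim \<omega>)
    have "(\<integral>\<^sup>+k. cell_sup L k (Z \<omega>) \<partial>count_space UNIV) < \<infinity>" if "?w (Z \<omega>) \<noteq> 0"
      using elim(1) that by (auto simp: nn_integral_cmult ennreal_mult_eq_top_iff less_top)
    then show ?case using cells_summable_imp_mass_finite[OF Z_cadlag[OF elim(2)]] by blast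
  qed
qed

text \<open>The previous lemma settles the paths with a peak in the cell at the origin; mass transport carries
  the peaks of the other paths there, and the total mass does not change under translation.\<close>

lemma finitely_many_peaks_imp_mass_finite:
  "AE f in \<nu>. 0 < peak_count f \<and> peak_count f < \<infinity> \<longrightarrow> total_mass 0 f < \<infinity>"
proof -
  let ?w = "\<lambda>f. peak_weight f / peak_count f"
  let ?I = "infinite_mass :: (real ^ 'd \<Rightarrow> real) set"
  have mw: "?w \<in> borel_measurable cadlag_algebra"
    by (rule borel_measurable_divide_ennreal[OF measurable_peak_weight measurable_peak_count])
  have sI: "?I \<in> sets cadlag_algebra" by (rule sets_infinite_mass)
  have mI: "indicator ?I \<in> borel_measurable cadlag_algebra" using sI by simp
  have null: "(\<integral>\<^sup>+f. indicator ?I f * ?w f \<partial>\<nu>) = 0"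
  proof -
    have "(\<integral>\<^sup>+\<omega>. indicator ?I (\<lambda>t. Z \<omega> t / s) * ?w (\<lambda>t. Z \<omega> t / s) \<partial>M) = 0" if s: "0 < s" for s
    proof -
      have "AE \<omega> in M. indicator ?I (\<lambda>t. Z \<omega> t / s) * ?w (\<lambda>t. Z \<omega> t / s) = 0"
        using peak_at_origin_imp_mass_finite AE_space
      proof eventually_elim
        case (elim \<omega>)
        have f: "Z \<omega> \<in> cadlag" using elim(2) by (rule Z_cadlag)
        show ?case using elim(1)
          by (auto simp: peak_weight_rescale[OF f s] indicator_def infinite_mass_def total_mass_rescale_top[OF f s])
      qed
      then have "(\<integral>\<^sup>+\<omega>. indicator ?I (\<lambda>t. Z \<omega> t / s) * ?w (\<lambda>t. Z \<omega> t / s) \<partial>M) = (\<integral>\<^sup>+\<omega>. 0 \<partial>M)"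
        by (rule nn_integral_cong_AE)
      then show ?thesis by simp
    qed
    then have "(\<integral>\<^sup>+\<omega>. indicator ?I (\<lambda>t. Z \<omega> t / s) * ?w (\<lambda>t. Z \<omega> t / s) \<partial>M) * indicator {0<..} s = 0" for s
      by (cases "0 < s") simp_all
    note zero = this
    then show ?thesis
      by (subst nn_integral_exponent_measure[OF sigma_finite_measure_axioms mZ borel_measurable_times_ennreal[OF mI mw]])
         (simp only: zero nn_integral_const mult_zero_left)
  qed
  have "(\<integral>\<^sup>+f. indicator ?I f * indicator {f. 0 < peak_count f \<and> peak_count f < \<infinity>} f \<partial>\<nu>)
      = (\<integral>\<^sup>+k. (\<integral>\<^sup>+f. indicator ?I (\<lambda>t. f (t - lattice_point L k)) * ?w f \<partial>\<nu>) \<partial>count_space UNIV)"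
    unfolding peak_count_def
    by (rule mass_transport[OF measurable_peak_weight mI]) (simp add: infinite_mass_def total_mass_0)
  also have "\<dots> = (\<integral>\<^sup>+k. (\<integral>\<^sup>+f. indicator ?I f * ?w f \<partial>\<nu>) \<partial>count_space (UNIV :: ('d \<Rightarrow> int) set))"
    by (intro nn_integral_cong) (simp add: indicator_def infinite_mass_def cadlag_shift total_mass_shift)
  also have "\<dots> = 0" by (simp add: null)
  finally have 0: "(\<integral>\<^sup>+f. indicator ?I f * indicator {f. 0 < peak_count f \<and> peak_count f < \<infinity>} f \<partial>\<nu>) = 0" .
  have "(\<lambda>f. indicator ?I f * indicator {f. 0 < peak_count f \<and> peak_count f < \<infinity>} f :: ennreal) \<in> borel_measurable \<nu>"
  proof -
    have [measurable]: "peak_count \<in> borel_measurable cadlag_algebra" by (rule measurable_peak_count)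
    have S: "{f\<in>space cadlag_algebra. 0 < peak_count f \<and> peak_count f < \<infinity>} \<in> sets cadlag_algebra" by measurable
    have "(\<lambda>f. indicator ?I f * indicator {f\<in>space cadlag_algebra. 0 < peak_count f \<and> peak_count f < \<infinity>} f :: ennreal) \<in> borel_measurable \<nu>"
      using sI S by (intro borel_measurable_times_ennreal borel_measurable_indicator) simp_all
    then show ?thesis
      by (rule measurable_cong[THEN iffD1, rotated]) (simp add: indicator_def)
  qed
  from nn_integral_0_iff_AE[OF this] 0
  have "AE f in \<nu>. (indicator ?I f * indicator {f. 0 < peak_count f \<and> peak_count f < \<infinity>} f :: ennreal) = 0" by simp
  then show ?thesis using AE_space
    by eventually_elim (auto simp: indicator_def infinite_mass_def less_top split: if_splits)
qed

end

section \<open>Paths of infinite mass\<close>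

context spectral_field
begin

text \<open>If only finitely many suprema exceeded one, the largest of them would be a peak, attained finitely often.\<close>

lemma infinite_mass_exceeds_infinitely_often:
  "AE f in \<nu>. total_mass 0 f = top \<and> 1 < cell_sup L (\<lambda>_. 0) f \<longrightarrow> infinite {k. 1 < cell_sup L k f}"
  using finitely_many_peaks_imp_mass_finite
proof eventually_elim
  case (elim f)
  show ?case
  proof (intro impI notI)
    assume a: "total_mass 0 f = top \<and> 1 < cell_sup L (\<lambda>_. 0) f" and fin: "finite {k. 1 < cell_sup L k f}"
    let ?K = "{k. 1 < cell_sup L k f}"
    have ne: "(\<lambda>_. 0) \<in> ?K" using a by simp
    let ?m = "Max ((\<lambda>k. cell_sup L k f) ` ?K)"
    have m_ge: "cell_sup L k f \<le> ?m" if "k \<in> ?K" for k using fin that by simp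
    have "1 < ?m" using m_ge[OF ne] a by (auto intro: less_le_trans)
    then have "cell_sup L k f \<le> ?m" for k
      using m_ge[of k] by (cases "k \<in> ?K") (auto simp: not_less intro: order_trans less_imp_le)
    moreover have "?m \<in> (\<lambda>k. cell_sup L k f) ` ?K" using fin ne by (intro Max_in) auto
    then obtain k0 where k0: "k0 \<in> ?K" "?m = cell_sup L k0 f" by blast
    ultimately have ps: "path_sup f = ?m"
      unfolding path_sup_def by (intro antisym SUP_least) (auto intro: SUP_upper2[of k0])
    have "{k. cell_sup L k f = path_sup f} \<subseteq> ?K" using \<open>1 < ?m\<close> ps by auto
    then have "finite {k. cell_sup L k f = path_sup f}" using fin by (rule finite_subset)
    moreover have "k0 \<in> {k. cell_sup L k f = path_sup f}" using k0 ps by simp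
    ultimately have "0 < peak_count f" "peak_count f < \<infinity>"
      unfolding peak_count_eq by (auto simp: emeasure_count_space_finite card_gt_0_iff zero_less_iff_neq_zero less_top[symmetric])
    with elim a show False by simp
  qed
qed

definition exceed_count :: "('d \<Rightarrow> int) set \<Rightarrow> (real ^ 'd \<Rightarrow> real) \<Rightarrow> ennreal" where
  "exceed_count B f = (\<integral>\<^sup>+j. indicator B j * indicator {f. 1 < cell_sup L j f} f \<partial>count_space UNIV)"

lemma exceed_count_eq: "exceed_count B f = emeasure (count_space UNIV) {j\<in>B. 1 < cell_sup L j f}"
proof -
  have "exceed_count B f = (\<integral>\<^sup>+j. indicator {j\<in>B. 1 < cell_sup L j f} j \<partial>count_space UNIV)"
    unfolding exceed_count_def by (intro nn_integral_cong) (auto simp: indicator_def)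
  then show ?thesis by simp
qed

lemma exceed_count_mono: "A \<subseteq> B \<Longrightarrow> exceed_count A f \<le> exceed_count B f"
  unfolding exceed_count_eq by (rule emeasure_mono) auto

lemma exceed_count_ge_1:
  assumes "k \<in> B" "1 < cell_sup L k f"
  shows "1 \<le> exceed_count B f"
proof -
  have "emeasure (count_space UNIV) {k} \<le> exceed_count B f"
    unfolding exceed_count_eq using assms by (intro emeasure_mono) auto
  then show ?thesis by simp
qed

lemma measurable_exceed_indicator: "indicator {f. 1 < cell_sup L k f} \<in> borel_measurable (cadlag_algebra :: (real ^ 'd \<Rightarrow> real) measure)"
  by (subst measurable_cong[of _ _ "indicator {f\<in>cadlag. 1 < cell_sup L k f}"])
     (simp add: indicator_def, rule borel_measurable_indicator[OF sets_cell_sup])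

lemma measurable_exceed_count: "exceed_count B \<in> borel_measurable cadlag_algebra"
  unfolding exceed_count_def[abs_def]
  by (intro borel_measurable_nn_integral_count_space borel_measurable_times_ennreal measurable_exceed_indicator) simp

lemma exceed_count_shift:
  "exceed_count B (\<lambda>t. f (t - lattice_point L k)) = exceed_count {j. (\<lambda>i. j i + k i) \<in> B} f"
proof -
  have bij: "bij_betw (\<lambda>j i. j i + k i) (UNIV :: ('d \<Rightarrow> int) set) UNIV"
    by (rule bij_betw_byWitness[where f' = "\<lambda>j i. j i - k i"]) auto
  have "exceed_count B (\<lambda>t. f (t - lattice_point L k))
      = (\<integral>\<^sup>+j. indicator B (\<lambda>i. j i + k i) * indicator {f. 1 < cell_sup L (\<lambda>i. j i + k i) f} (\<lambda>t. f (t - lattice_point L k)) \<partial>count_space UNIV)"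
    unfolding exceed_count_def by (rule nn_integral_bij_count_space[symmetric, OF bij])
  also have "\<dots> = exceed_count {j. (\<lambda>i. j i + k i) \<in> B} f"
    unfolding exceed_count_def by (intro nn_integral_cong) (simp add: indicator_def cell_sup_shift)
  finally show ?thesis .
qed

definition shared_exceedance :: "('d \<Rightarrow> int) set \<Rightarrow> ('d \<Rightarrow> int) \<Rightarrow> (real ^ 'd \<Rightarrow> real) \<Rightarrow> ennreal" where
  "shared_exceedance B k f = indicator infinite_mass f * (indicator {f. 1 < cell_sup L k f} f / exceed_count B f)"

lemma measurable_shared_exceedance: "shared_exceedance B k \<in> borel_measurable cadlag_algebra"
  unfolding shared_exceedance_def[abs_def]
  by (intro borel_measurable_times_ennreal borel_measurable_divide_ennreal borel_measurable_indicator
      measurable_exceed_indicator measurable_exceed_count sets_infinite_mass)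

text \<open>The exceedances in the box have equal shares in the event that there is one. Shift invariance moves
  a share to the origin, at the price of moving the box.\<close>

lemma exceed_box_le:
  fixes B :: "('d \<Rightarrow> int) set"
  assumes B: "finite B"
  shows "emeasure \<nu> {f\<in>infinite_mass. \<exists>k\<in>B. 1 < cell_sup L k f}
    \<le> (\<integral>\<^sup>+k. indicator B k * (\<integral>\<^sup>+f. shared_exceedance {j. (\<lambda>i. j i + k i) \<in> B} (\<lambda>_. 0) f \<partial>\<nu>) \<partial>count_space UNIV)"
proof -
  have S: "{f\<in>infinite_mass. \<exists>k\<in>B. 1 < cell_sup L k f} \<in> sets \<nu>"
  proof -
    have "{f\<in>infinite_mass. \<exists>k\<in>B. 1 < cell_sup L k f} = infinite_mass \<inter> (\<Union>k\<in>B. {f\<in>cadlag. 1 < cell_sup L k f})"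
      by (auto simp: infinite_mass_def)
    also have "\<dots> \<in> sets cadlag_algebra"
      by (intro sets.Int sets_infinite_mass sets.finite_UN[OF B] sets_cell_sup)
    finally show ?thesis by simp
  qed
  have "emeasure \<nu> {f\<in>infinite_mass. \<exists>k\<in>B. 1 < cell_sup L k f}
      = (\<integral>\<^sup>+f. indicator {f\<in>infinite_mass. \<exists>k\<in>B. 1 < cell_sup L k f} f \<partial>\<nu>)"
    by (rule nn_integral_indicator[symmetric, OF S])
  also have "\<dots> \<le> (\<integral>\<^sup>+f. (\<integral>\<^sup>+k. indicator B k * shared_exceedance B k f \<partial>count_space UNIV) \<partial>\<nu>)"
  proof (rule nn_integral_mono)
    fix f
    show "indicator {f\<in>infinite_mass. \<exists>k\<in>B. 1 < cell_sup L k f} f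
        \<le> (\<integral>\<^sup>+k. indicator B k * shared_exceedance B k f \<partial>count_space UNIV)"
    proof (cases "f \<in> infinite_mass \<and> (\<exists>k\<in>B. 1 < cell_sup L k f)")
      case True
      then obtain k where "k \<in> B" "1 < cell_sup L k f" by blast
      then have "1 \<le> exceed_count B f" by (rule exceed_count_ge_1)
      then have n0: "exceed_count B f \<noteq> 0" by auto
      have "{j\<in>B. 1 < cell_sup L j f} \<subseteq> B" by auto
      then have nt: "exceed_count B f \<noteq> top"
        unfolding exceed_count_eq using B by (simp add: emeasure_count_space_finite finite_subset)
      have "(\<integral>\<^sup>+k. indicator B k * shared_exceedance B k f \<partial>count_space UNIV)
          = (\<integral>\<^sup>+k. indicator B k * indicator {f. 1 < cell_sup L k f} f / exceed_count B f \<partial>count_space UNIV)"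
        using True by (intro nn_integral_cong) (simp add: shared_exceedance_def ennreal_times_divide)
      also have "\<dots> = exceed_count B f / exceed_count B f"
        unfolding exceed_count_def[of B f] by (rule nn_integral_divide) simp
      also have "\<dots> = 1" using n0 nt by (simp add: ennreal_divide_self less_top)
      finally show ?thesis by (simp add: indicator_def)
    qed (auto simp: indicator_def)
  qed
  also have "\<dots> = (\<integral>\<^sup>+k. (\<integral>\<^sup>+f. indicator B k * shared_exceedance B k f \<partial>\<nu>) \<partial>count_space UNIV)"
    using measurable_shared_exceedance by (subst nn_integral_count_space_nn_integral) simp_all
  also have "\<dots> = (\<integral>\<^sup>+k. indicator B k * (\<integral>\<^sup>+f. shared_exceedance B k f \<partial>\<nu>) \<partial>count_space UNIV)"
    using measurable_shared_exceedance by (simp add: nn_integral_cmult)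
  also have "\<dots> = (\<integral>\<^sup>+k. indicator B k * (\<integral>\<^sup>+f. shared_exceedance {j. (\<lambda>i. j i + k i) \<in> B} (\<lambda>_. 0) f \<partial>\<nu>) \<partial>count_space UNIV)"
  proof (rule nn_integral_cong)
    fix k :: "'d \<Rightarrow> int"
    have "(\<integral>\<^sup>+f. shared_exceedance B k f \<partial>\<nu>) = (\<integral>\<^sup>+f. shared_exceedance B k (\<lambda>t. f (t - lattice_point L k)) \<partial>\<nu>)"
      by (rule exponent_shift[symmetric, OF measurable_shared_exceedance])
         (simp add: shared_exceedance_def infinite_mass_def total_mass_0 indicator_def)
    also have "\<dots> = (\<integral>\<^sup>+f. shared_exceedance {j. (\<lambda>i. j i + k i) \<in> B} (\<lambda>_. 0) f \<partial>\<nu>)"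
      by (intro nn_integral_cong)
         (simp add: shared_exceedance_def exceed_count_shift indicator_def infinite_mass_def cadlag_shift total_mass_shift cell_sup_shift)
    finally show "indicator B k * (\<integral>\<^sup>+f. shared_exceedance B k f \<partial>\<nu>)
        = indicator B k * (\<integral>\<^sup>+f. shared_exceedance {j. (\<lambda>i. j i + k i) \<in> B} (\<lambda>_. 0) f \<partial>\<nu>)" by (simp only:)
  qed
  finally show ?thesis .
qed

definition index_box :: "int \<Rightarrow> int \<Rightarrow> ('d \<Rightarrow> int) set" where
  "index_box a c = {k. \<forall>i. a \<le> k i \<and> k i < a + c}"

lemma emeasure_index_box: "emeasure (count_space UNIV) (index_box a c) = ennreal (max 0 (of_int c) ^ CARD('d))"
  unfolding index_box_def by (rule emeasure_count_box)

lemma finite_index_box: "finite (index_box a c)"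
  using emeasure_index_box[of a c] by (auto simp: emeasure_count_space split: if_splits)

text \<open>The share of an exceedance at the origin tends to zero as the box grows, because a path of infinite
  mass that has one has infinitely many. All shares are at most one, on a set of finite measure.\<close>

lemma shared_exceedance_tendsto_0:
  "(\<lambda>R. \<integral>\<^sup>+f. shared_exceedance (index_box (- int R) (2 * int R + 1)) (\<lambda>_. 0) f \<partial>\<nu>) \<longlonglongrightarrow> 0"
proof -
  let ?B = "\<lambda>R. index_box (- int R) (2 * int R + 1)"
  let ?Y = "{f\<in>cadlag. 1 < cell_sup L (\<lambda>_::'d. 0) f}"
  have "(\<lambda>R. \<integral>\<^sup>+f. shared_exceedance (?B R) (\<lambda>_. 0) f \<partial>\<nu>) \<longlonglongrightarrow> (\<integral>\<^sup>+f. 0 \<partial>\<nu>)"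
  proof (rule nn_integral_dominated_convergence[where w = "indicator ?Y"])
    show "shared_exceedance (?B R) (\<lambda>_. 0) \<in> borel_measurable \<nu>" for R
      using measurable_shared_exceedance by (simp add: measurable_cong_sets[OF sets_exponent_measure refl])
    show "indicator ?Y \<in> borel_measurable \<nu>"
      by (rule borel_measurable_indicator) (simp only: sets_exponent_measure sets_cell_sup)
    show "(\<lambda>f. 0) \<in> borel_measurable \<nu>" by simp
    have "(\<integral>\<^sup>+f. indicator ?Y f \<partial>\<nu>) = emeasure \<nu> ?Y"
      by (rule nn_integral_indicator) (simp only: sets_exponent_measure sets_cell_sup)
    then show "(\<integral>\<^sup>+f. indicator ?Y f \<partial>\<nu>) < \<infinity>" using exponent_cell_sup_finite by (simp only:)
    show "AE f in \<nu>. shared_exceedance (?B R) (\<lambda>_. 0) f \<le> indicator ?Y f" for R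
    proof (rule AE_I2)
      fix f assume "f \<in> space \<nu>"
      then have f: "f \<in> cadlag" by simp
      show "shared_exceedance (?B R) (\<lambda>_. 0) f \<le> indicator ?Y f"
      proof (cases "1 < cell_sup L (\<lambda>_. 0) f")
        case True
        have "1 \<le> exceed_count (?B R) f" by (rule exceed_count_ge_1[OF _ True]) (simp add: index_box_def)
        then have "1 / exceed_count (?B R) f \<le> 1 / 1" by (rule divide_left_mono_ennreal)
        then show ?thesis using True f by (simp add: shared_exceedance_def indicator_def)
      qed (simp add: shared_exceedance_def)
    qed
    show "AE f in \<nu>. (\<lambda>R. shared_exceedance (?B R) (\<lambda>_. 0) f) \<longlonglongrightarrow> 0"
      using infinite_mass_exceeds_infinitely_often
    proof eventually_elim
      case (elim f)
      show ?case
      proof (cases "f \<in> infinite_mass \<and> 1 < cell_sup L (\<lambda>_. 0) f")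
        case True
        then have inf: "infinite {k. 1 < cell_sup L k f}" using elim by (simp add: infinite_mass_def)
        let ?A = "\<lambda>R. {j\<in>?B R. 1 < cell_sup L j f}"
        have "(\<lambda>R. emeasure (count_space UNIV) (?A R)) \<longlonglongrightarrow> emeasure (count_space UNIV) (\<Union>R. ?A R)"
          by (rule Lim_emeasure_incseq) (auto simp: incseq_def index_box_def, (smt (verit, best) of_nat_mono)+)
        also have "(\<Union>R. ?A R) = {k. 1 < cell_sup L k f}"
        proof -
          have "\<exists>R. k \<in> ?B R" for k :: "'d \<Rightarrow> int"
          proof -
            have "\<bar>k i\<bar> \<le> int (nat (Max (range (\<lambda>i. \<bar>k i\<bar>))))" for i
            proof -
              have "\<bar>k i\<bar> \<le> Max (range (\<lambda>i. \<bar>k i\<bar>))" by (intro Max_ge) auto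
              then show ?thesis by linarith
            qed
            then obtain m :: nat where m: "\<bar>k i\<bar> \<le> int m" for i by blast
            have "- int m \<le> k i \<and> k i < - int m + (2 * int m + 1)" for i using m[of i] by linarith
            then have "k \<in> ?B m" unfolding index_box_def by blast
            then show ?thesis ..
          qed
          then show ?thesis by auto
        qed
        finally have "(\<lambda>R. exceed_count (?B R) f) \<longlonglongrightarrow> top"
          using inf by (simp add: exceed_count_eq)
        from divide_tendsto_0_ennreal[OF this, of 1] show ?thesis
          using True by (simp add: shared_exceedance_def indicator_def)
      qed (auto simp: shared_exceedance_def indicator_def)
    qed
  qed
  then show ?thesis by simp
qed

text \<open>A cell that keeps the distance \<open>R\<close> from the boundary of the box contributes at most the share in a
  centred box of radius \<open>R\<close>, which is small; a cell near the boundary contributes a bounded amount, and the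
  proportion of such cells vanishes.\<close>

lemma infinite_mass_limit:
  "((\<lambda>T. emeasure \<nu> {f\<in>infinite_mass. ennreal x < exceed_mass \<delta> (cube T) f} / ennreal (T ^ CARD('d))) \<longlongrightarrow> 0) at_top"
proof (rule order_tendstoI)
  fix e :: ennreal assume e: "0 < e"
  let ?B = "\<lambda>R. index_box (- int R) (2 * int R + 1)"
  let ?a = "\<lambda>R. \<integral>\<^sup>+f. shared_exceedance (?B R) (\<lambda>_. 0) f \<partial>\<nu>"
  let ?C = "emeasure \<nu> {f\<in>cadlag. 1 < cell_sup L (\<lambda>_::'d. 0) f}"
  let ?q = "(1 / L) ^ CARD('d)"
  have "(\<lambda>R. ?a R * ennreal ?q) \<longlonglongrightarrow> 0 * ennreal ?q"
    by (intro tendsto_mult_ennreal shared_exceedance_tendsto_0 tendsto_const) simp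
  then have "eventually (\<lambda>R. ?a R * ennreal ?q < e) sequentially"
    using e by (intro order_tendstoD(2)) simp_all
  moreover have "eventually (\<lambda>R. ?a R < 1) sequentially"
    using shared_exceedance_tendsto_0 by (rule order_tendstoD(2)) simp
  ultimately have "eventually (\<lambda>R. ?a R * ennreal ?q < e \<and> ?a R < 1) sequentially" by (rule eventually_conj)
  then obtain R where R: "?a R * ennreal ?q < e" "?a R < 1"
    by (auto simp: eventually_sequentially)
  obtain a where a: "?a R = ennreal a" "0 \<le> a" using R(2) by (cases "?a R") (auto simp: top_unique)
  obtain c where c: "?C = ennreal c" "0 \<le> c" using exponent_cell_sup_finite by (cases ?C) auto
  \<comment> \<open>The numbers of cells that meet the cube, and of those whose translates by up to \<open>R\<close> in each coordinate
    all meet it.\<close>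
  let ?hi = "\<lambda>T. max 0 (of_int (\<lfloor>T / L\<rfloor> + 1)) ^ CARD('d) :: real"
  let ?lo = "\<lambda>T. max 0 (of_int (\<lfloor>T / L\<rfloor> + (1 - 2 * int R))) ^ CARD('d) :: real"
  have bound: "emeasure \<nu> {f\<in>infinite_mass. ennreal x < exceed_mass \<delta> (cube T) f}
      \<le> ennreal (a * ?hi T + c * (?hi T - ?lo T))" for T
  proof -
    let ?n = "\<lfloor>T / L\<rfloor>"
    let ?K = "index_box 0 (?n + 1) :: ('d \<Rightarrow> int) set"
    let ?I = "index_box (int R) (?n + (1 - 2 * int R)) :: ('d \<Rightarrow> int) set"
    have IK: "?I \<subseteq> ?K" unfolding index_box_def
    proof clarify
      fix k :: "'d \<Rightarrow> int" and i assume "\<forall>i. int R \<le> k i \<and> k i < int R + (?n + (1 - 2 * int R))"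
      then have "int R \<le> k i" "k i < int R + (?n + (1 - 2 * int R))" by auto
      then show "0 \<le> k i \<and> k i < 0 + (?n + 1)" by linarith
    qed
    have lohi: "?lo T \<le> ?hi T" by (intro power_mono) auto
    have sK: "{f\<in>infinite_mass. \<exists>k\<in>?K. 1 < cell_sup L k f} \<in> sets \<nu>"
    proof -
      have "{f\<in>infinite_mass. \<exists>k\<in>?K. 1 < cell_sup L k f} = infinite_mass \<inter> (\<Union>k\<in>?K. {f\<in>cadlag. 1 < cell_sup L k f})"
        by (auto simp: infinite_mass_def)
      also have "\<dots> \<in> sets cadlag_algebra"
        by (intro sets.Int sets_infinite_mass sets.finite_UN[OF finite_index_box] sets_cell_sup)
      finally show ?thesis by simp
    qed
    have "emeasure \<nu> {f\<in>infinite_mass. ennreal x < exceed_mass \<delta> (cube T) f}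
        \<le> emeasure \<nu> {f\<in>infinite_mass. \<exists>k\<in>?K. 1 < cell_sup L k f}"
    proof (rule emeasure_mono[OF _ sK])
      show "{f\<in>infinite_mass. ennreal x < exceed_mass \<delta> (cube T) f} \<subseteq> {f\<in>infinite_mass. \<exists>k\<in>?K. 1 < cell_sup L k f}"
      proof clarify
        fix f :: "real ^ 'd \<Rightarrow> real" assume f: "f \<in> infinite_mass" "ennreal x < exceed_mass \<delta> (cube T) f"
        have "window L T (\<lambda>_::'d. 0) = cube T" by (auto simp: in_window_iff cube_def)
        then have "ennreal x < exceed_mass \<delta> (window (mesh \<delta>) T (\<lambda>_. 0)) f" using f by simp
        then obtain j where j: "j \<in> exceed_cells \<delta> f" "\<And>i. - j i \<le> 0 \<and> 0 < - j i + (\<lfloor>T / mesh \<delta>\<rfloor> + 1)"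
          using window_sees_cell[OF \<delta>, of f x T "\<lambda>_. 0"] f(1) unfolding infinite_mass_def by blast
        have "0 \<le> j i \<and> j i < 0 + (?n + 1)" for i using j(2)[of i] by linarith
        then have "j \<in> ?K" by (auto simp: index_box_def)
        moreover have "1 < cell_sup L j f"
          using j(1) by (intro exceed_mass_imp_cell_sup) (simp add: exceed_cells_def)
        ultimately show "\<exists>k\<in>?K. 1 < cell_sup L k f" by blast
      qed
    qed
    also have "\<dots> \<le> (\<integral>\<^sup>+k. indicator ?K k * (\<integral>\<^sup>+f. shared_exceedance {j. (\<lambda>i. j i + k i) \<in> ?K} (\<lambda>_. 0) f \<partial>\<nu>) \<partial>count_space UNIV)"
      by (rule exceed_box_le[OF finite_index_box])
    also have "\<dots> \<le> (\<integral>\<^sup>+k. ennreal a * indicator ?K k + ennreal c * indicator (?K - ?I) k \<partial>count_space UNIV)"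
    proof (rule nn_integral_mono)
      fix k :: "'d \<Rightarrow> int"
      let ?s = "\<integral>\<^sup>+f. shared_exceedance {j. (\<lambda>i. j i + k i) \<in> ?K} (\<lambda>_. 0) f \<partial>\<nu>"
      have "?s \<le> ennreal a" if k: "k \<in> ?I"
      proof -
        have "?B R \<subseteq> {j. (\<lambda>i. j i + k i) \<in> ?K}"
        proof
          fix j :: "'d \<Rightarrow> int" assume "j \<in> ?B R"
          then have j: "- int R \<le> j i" "j i < - int R + (2 * int R + 1)" for i by (auto simp: index_box_def)
          have k': "int R \<le> k i" "k i < int R + (?n + (1 - 2 * int R))" for i using k by (auto simp: index_box_def)
          have "0 \<le> j i + k i \<and> j i + k i < 0 + (?n + 1)" for i using j[of i] k'[of i] by linarith
          then show "j \<in> {j. (\<lambda>i. j i + k i) \<in> ?K}" by (auto simp: index_box_def)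
        qed
        then have "?s \<le> ?a R"
          unfolding shared_exceedance_def
          by (intro nn_integral_mono mult_left_mono divide_left_mono_ennreal exceed_count_mono) simp_all
        then show ?thesis by (simp add: a)
      qed
      moreover have "?s \<le> ennreal c" if k: "k \<in> ?K"
      proof -
        have "?s \<le> (\<integral>\<^sup>+f. indicator {f\<in>cadlag. 1 < cell_sup L (\<lambda>_::'d. 0) f} f \<partial>\<nu>)"
        proof (rule nn_integral_mono)
          fix f assume "f \<in> space \<nu>"
          then have f: "f \<in> cadlag" by simp
          show "shared_exceedance {j. (\<lambda>i. j i + k i) \<in> ?K} (\<lambda>_. 0) f \<le> indicator {f\<in>cadlag. 1 < cell_sup L (\<lambda>_::'d. 0) f} f"
          proof (cases "1 < cell_sup L (\<lambda>_. 0) f")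
            case True
            have "1 \<le> exceed_count {j. (\<lambda>i. j i + k i) \<in> ?K} f" by (rule exceed_count_ge_1[OF _ True]) (simp add: k)
            then have "1 / exceed_count {j. (\<lambda>i. j i + k i) \<in> ?K} f \<le> 1 / 1" by (rule divide_left_mono_ennreal)
            then show ?thesis using True f by (simp add: shared_exceedance_def indicator_def)
          qed (simp add: shared_exceedance_def)
        qed
        also have "\<dots> = ?C" by (rule nn_integral_indicator) (simp only: sets_exponent_measure sets_cell_sup)
        finally show ?thesis by (simp only: c)
      qed
      ultimately show "indicator ?K k * ?s \<le> ennreal a * indicator ?K k + ennreal c * indicator (?K - ?I) k"
        using IK by (cases "k \<in> ?I"; cases "k \<in> ?K") (auto intro: add_increasing)
    qed
    also have "\<dots> = ennreal a * emeasure (count_space UNIV) ?K + ennreal c * emeasure (count_space UNIV) (?K - ?I)"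
      by (subst nn_integral_add) (simp_all add: nn_integral_cmult)
    also have "emeasure (count_space UNIV) (?K - ?I) = emeasure (count_space UNIV) ?K - emeasure (count_space UNIV) ?I"
      using IK by (intro emeasure_Diff) (simp_all add: emeasure_index_box)
    also have "ennreal a * emeasure (count_space UNIV) ?K + ennreal c * (emeasure (count_space UNIV) ?K - emeasure (count_space UNIV) ?I)
        = ennreal (a * ?hi T + c * (?hi T - ?lo T))"
      unfolding emeasure_index_box using a c lohi
      by (simp add: ennreal_minus ennreal_mult'[symmetric] ennreal_plus[symmetric] del: of_int_add ennreal_plus)
    finally show ?thesis .
  qed
  have "((\<lambda>T. ennreal (a * (max 0 (of_int (\<lfloor>T / L\<rfloor> + 1)) / T) ^ CARD('d)
        + c * ((max 0 (of_int (\<lfloor>T / L\<rfloor> + 1)) / T) ^ CARD('d) - (max 0 (of_int (\<lfloor>T / L\<rfloor> + (1 - 2 * int R))) / T) ^ CARD('d))))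
      \<longlongrightarrow> ennreal (a * ?q + c * (?q - ?q))) at_top"
    by (intro tendsto_ennrealI tendsto_add tendsto_mult tendsto_diff tendsto_const floor_div_asymp[OF L_pos])
  moreover have "ennreal (a * ?q + c * (?q - ?q)) < e"
    using R(1) a L_pos by (simp add: ennreal_mult'[symmetric] del: power_divide)
  ultimately have "\<forall>\<^sub>F T in at_top. ennreal (a * (max 0 (of_int (\<lfloor>T / L\<rfloor> + 1)) / T) ^ CARD('d)
        + c * ((max 0 (of_int (\<lfloor>T / L\<rfloor> + 1)) / T) ^ CARD('d) - (max 0 (of_int (\<lfloor>T / L\<rfloor> + (1 - 2 * int R))) / T) ^ CARD('d))) < e"
    by (rule order_tendstoD(2))
  then show "\<forall>\<^sub>F T in at_top. emeasure \<nu> {f\<in>infinite_mass. ennreal x < exceed_mass \<delta> (cube T) f} / ennreal (T ^ CARD('d)) < e"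
    using eventually_gt_at_top[of 0]
  proof eventually_elim
    case (elim T)
    have lohi: "?lo T \<le> ?hi T" by (intro power_mono) auto
    have "emeasure \<nu> {f\<in>infinite_mass. ennreal x < exceed_mass \<delta> (cube T) f} / ennreal (T ^ CARD('d))
        \<le> ennreal (a * ?hi T + c * (?hi T - ?lo T)) / ennreal (T ^ CARD('d))"
      by (rule divide_right_mono_ennreal[OF bound])
    also have "\<dots> = ennreal ((a * ?hi T + c * (?hi T - ?lo T)) / T ^ CARD('d))"
      using elim(2) a c lohi by (intro divide_ennreal add_nonneg_nonneg mult_nonneg_nonneg) simp_all
    also have "(a * ?hi T + c * (?hi T - ?lo T)) / T ^ CARD('d)
        = a * (max 0 (of_int (\<lfloor>T / L\<rfloor> + 1)) / T) ^ CARD('d)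
        + c * ((max 0 (of_int (\<lfloor>T / L\<rfloor> + 1)) / T) ^ CARD('d) - (max 0 (of_int (\<lfloor>T / L\<rfloor> + (1 - 2 * int R))) / T) ^ CARD('d))"
      by (simp add: power_divide add_divide_distrib diff_divide_distrib right_diff_distrib del: of_int_add)
    finally show ?case using elim(1) by (rule le_less_trans)
  qed
qed simp

end

section \<open>Randomly translated patterns\<close>

lemma sigma_finite_scales: "sigma_finite_measure scales"
  by (rule sigma_finite_measure_restrict_space) (auto intro: lborel.sigma_finite_measure_axioms)

text \<open>Exceeding the level \<open>s\<close> and exceeding the level one after division by \<open>s\<close> are the same.\<close>

lemma emeasure_exponent_excursion:
  fixes Y :: "'w \<Rightarrow> real ^ 'd::finite \<Rightarrow> real"
  assumes "prob_space M" and mY: "Y \<in> M \<rightarrow>\<^sub>M cadlag_algebra" and \<delta>: "0 \<le> \<delta>" and A: "A \<in> sets borel"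
  shows "(\<integral>\<^sup>+s\<in>{0..}. ennreal (\<P>(\<omega> in M. excursion \<delta> A (Y \<omega>) s > ennreal x)) \<partial>lborel)
    = emeasure (exponent_measure M Y) (exceed_event \<delta> x A)"
proof -
  interpret prob_space M by fact
  have Yc: "Y \<omega> \<in> cadlag" if "\<omega> \<in> space M" for \<omega> using measurable_space[OF mY that] by simp
  have S: "exceed_event \<delta> x A \<in> sets cadlag_algebra" by (rule sets_exceed_event[OF \<delta> A])
  have "(\<integral>\<^sup>+s\<in>{0..}. ennreal (\<P>(\<omega> in M. excursion \<delta> A (Y \<omega>) s > ennreal x)) \<partial>lborel)
      = (\<integral>\<^sup>+s\<in>{0<..}. emeasure M {\<omega>\<in>space M. (\<lambda>t. Y \<omega> t / s) \<in> (exceed_event \<delta> x A)} \<partial>lborel)"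
  proof (rule nn_integral_cong_AE)
    have *: "{\<omega>\<in>space M. excursion \<delta> A (Y \<omega>) s > ennreal x}
        = {\<omega>\<in>space M. (\<lambda>t. Y \<omega> t / s) \<in> (exceed_event \<delta> x A)}" if s: "0 < s" for s
    proof (intro Collect_cong conj_cong refl)
      fix \<omega> assume "\<omega> \<in> space M"
      then have f: "Y \<omega> \<in> cadlag" by (rule Yc)
      have "(\<lambda>t. Y \<omega> t / s) \<in> cadlag"
        using f s by (intro cadlag_divide) auto
      moreover have "exceed_mass \<delta> A (\<lambda>t. Y \<omega> t / s) = excursion \<delta> A (Y \<omega>) s"
        using s by (simp add: excursion_eq[OF f A] exceed_mass_def pos_less_divide_eq)
      ultimately show "(excursion \<delta> A (Y \<omega>) s > ennreal x)
          = ((\<lambda>t. Y \<omega> t / s) \<in> (exceed_event \<delta> x A))" by simp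
    qed
    show "AE s in lborel. ennreal (\<P>(\<omega> in M. excursion \<delta> A (Y \<omega>) s > ennreal x)) * indicator {0..} s
        = emeasure M {\<omega>\<in>space M. (\<lambda>t. Y \<omega> t / s) \<in> (exceed_event \<delta> x A)} * indicator {0<..} s"
      using AE_lborel_singleton[of "0::real"]
    proof eventually_elim
      case (elim s)
      show ?case
      proof (cases "0 < s")
        case True
        then show ?thesis using *[OF True] by (simp add: emeasure_eq_measure)
      qed (use elim in \<open>simp add: indicator_def\<close>)
    qed
  qed
  also have "\<dots> = emeasure (exponent_measure M Y) (exceed_event \<delta> x A)"
    by (rule emeasure_exponent_measure[symmetric, OF sigma_finite_measure_axioms mY S])
  finally show ?thesis .
qed

text \<open>The reference measure of the density of the random translation. For \<open>\<delta> > 0\<close> it gives mass one to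
  each point of the grid, where \<open>grid_measure\<close> gives \<open>\<delta>\<^sup>d\<close>; this produces the factor \<open>\<delta>\<^sup>d\<close> between the two patterns \<open>Qb\<close> and \<open>Q\<close>.\<close>

definition grid_ref :: "real \<Rightarrow> (real ^ 'd::finite) measure" where
  "grid_ref \<delta> = (if \<delta> = 0 then lborel else count_space (grid \<delta>))"

lemma space_grid_ref: "space (grid_ref \<delta>) = grid \<delta>"
  by (simp add: grid_ref_def grid_def)

lemma measurable_grid_ref_ident: "(\<lambda>t. t) \<in> grid_ref \<delta> \<rightarrow>\<^sub>M (borel :: (real ^ 'd::finite) measure)"
proof (cases "\<delta> = 0")
  case True
  show ?thesis unfolding grid_ref_def if_P[OF True] by (rule measurable_ident_sets) simp
next
  case False
  show ?thesis unfolding grid_ref_def if_not_P[OF False] by simp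
qed

lemma sigma_finite_grid_ref: "0 \<le> \<delta> \<Longrightarrow> sigma_finite_measure (grid_ref \<delta> :: (real ^ 'd::finite) measure)"
proof (cases "\<delta> = 0")
  case False
  assume "0 \<le> \<delta>"
  with False have "0 < \<delta>" by simp
  have "countable (grid \<delta> :: (real ^ 'd) set)"
    using bij_betw_imp_surj_on[OF bij_betw_lattice_point[OF \<open>0 < \<delta>\<close>]] by (metis countableI_type countable_image)
  then show ?thesis using False by (simp add: grid_ref_def sigma_finite_measure_count_space_countable)
qed (simp add: grid_ref_def lborel.sigma_finite_measure_axioms)

lemma nn_integral_grid_ref:
  fixes h :: "real ^ 'd::finite \<Rightarrow> ennreal"
  assumes \<delta>: "0 \<le> \<delta>" and h: "h \<in> borel_measurable borel"
  shows "(\<integral>\<^sup>+t. h t \<partial>grid_ref \<delta>) = ennreal ((1 / mesh \<delta>) ^ CARD('d)) * (\<integral>\<^sup>+t. h t \<partial>grid_measure \<delta>)"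
proof (cases "\<delta> = 0")
  case True
  then show ?thesis by (simp add: grid_ref_def grid_measure_0 mesh_def)
next
  case False
  then have d: "0 < \<delta>" using \<delta> by simp
  have "(\<integral>\<^sup>+t. h t \<partial>grid_ref \<delta>) = (\<integral>\<^sup>+k. h (lattice_point \<delta> k) \<partial>count_space UNIV)"
    using nn_integral_bij_count_space[OF bij_betw_lattice_point[OF d], of h] False by (simp add: grid_ref_def)
  also have "\<dots> = ennreal ((1 / \<delta>) ^ CARD('d)) * (ennreal (\<delta> ^ CARD('d)) * (\<integral>\<^sup>+k. h (lattice_point \<delta> k) \<partial>count_space UNIV))"
    using d by (simp add: mult.assoc[symmetric] ennreal_mult'[symmetric] power_divide)
  finally show ?thesis using False by (simp add: nn_integral_grid_measure_pos[OF d h] mesh_def)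
qed

lemma nn_integral_grid_measure_cells:
  fixes h :: "real ^ 'd::finite \<Rightarrow> ennreal"
  assumes \<delta>: "0 \<le> \<delta>" and [measurable]: "h \<in> borel_measurable borel"
  shows "(\<integral>\<^sup>+t. h t \<partial>grid_measure \<delta>)
    = (\<integral>\<^sup>+k. (\<integral>\<^sup>+u. h (u + lattice_point (mesh \<delta>) k) * indicator (cell (mesh \<delta>) (\<lambda>_. 0)) u \<partial>grid_measure \<delta>) \<partial>count_space UNIV)"
proof -
  let ?L = "mesh \<delta>"
  have L: "0 < ?L" by (rule mesh_pos[OF \<delta>])
  have m: "(\<lambda>u. h u * indicator (cell ?L k) u) \<in> borel_measurable borel" for k by measurable
  have "(\<integral>\<^sup>+t. h t \<partial>grid_measure \<delta>) = (\<integral>\<^sup>+t. (\<integral>\<^sup>+k. h t * indicator (cell ?L k) t \<partial>count_space UNIV) \<partial>grid_measure \<delta>)"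
  proof (rule nn_integral_cong)
    fix t :: "real ^ 'd"
    have "(\<integral>\<^sup>+k. h t * indicator (cell ?L k) t \<partial>count_space UNIV)
        = (\<integral>\<^sup>+k. h t * indicator {\<lambda>i. \<lfloor>t $ i / ?L\<rfloor>} k \<partial>count_space UNIV)"
      by (intro nn_integral_cong) (simp add: indicator_def in_cell_iff[OF L])
    also have "\<dots> = h t" by (simp add: nn_integral_cmult)
    finally show "h t = (\<integral>\<^sup>+k. h t * indicator (cell ?L k) t \<partial>count_space UNIV)" ..
  qed
  also have "\<dots> = (\<integral>\<^sup>+k. (\<integral>\<^sup>+t. h t * indicator (cell ?L k) t \<partial>grid_measure \<delta>) \<partial>count_space UNIV)"
    using m by (subst nn_integral_count_space_nn_integral) (simp_all add: measurable_cong_sets[OF sets_grid_measure refl])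
  also have "\<dots> = (\<integral>\<^sup>+k. (\<integral>\<^sup>+u. h (u + lattice_point ?L k) * indicator (cell ?L (\<lambda>_. 0)) u \<partial>grid_measure \<delta>) \<partial>count_space UNIV)"
  proof (rule nn_integral_cong)
    fix k :: "'d \<Rightarrow> int"
    have "(\<integral>\<^sup>+t. h t * indicator (cell ?L k) t \<partial>grid_measure \<delta>)
        = (\<integral>\<^sup>+u. h (u + lattice_point ?L k) * indicator (cell ?L k) (u + lattice_point ?L k) \<partial>grid_measure \<delta>)"
      by (rule nn_integral_grid_measure_shift[symmetric, OF \<delta> lattice_point_in_grid m])
    then show "(\<integral>\<^sup>+t. h t * indicator (cell ?L k) t \<partial>grid_measure \<delta>)
        = (\<integral>\<^sup>+u. h (u + lattice_point ?L k) * indicator (cell ?L (\<lambda>_. 0)) u \<partial>grid_measure \<delta>)"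
      by (simp add: indicator_def cell_translate)
  qed
  finally show ?thesis .
qed

lemma measurable_translated_rescaled:
  fixes Q :: "'x \<Rightarrow> real ^ 'd::finite \<Rightarrow> real"
  assumes "q \<in> N \<rightarrow>\<^sub>M cadlag_algebra" "\<tau> \<in> N \<rightarrow>\<^sub>M (borel :: (real ^ 'd) measure)" "c \<in> borel_measurable N"
    and pos: "\<And>x. x \<in> space N \<Longrightarrow> 0 \<le> c x"
  shows "(\<lambda>x t. q x (t - \<tau> x) / c x) \<in> N \<rightarrow>\<^sub>M cadlag_algebra"
proof (rule measurable_cadlag_algebraI)
  fix x assume x: "x \<in> space N"
  have "q x \<in> cadlag" using measurable_space[OF assms(1) x] by simp
  then show "(\<lambda>t. q x (t - \<tau> x) / c x) \<in> cadlag"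
    using pos[OF x] by (intro cadlag_divide[OF cadlag_shift])
next
  fix t
  have "(\<lambda>x. t - \<tau> x) \<in> N \<rightarrow>\<^sub>M borel" using assms(2) by (intro borel_measurable_diff) simp_all
  then have "(\<lambda>x. q x (t - \<tau> x)) \<in> borel_measurable N" by (rule measurable_cadlag_field_pair[OF assms(1)])
  then show "(\<lambda>x. q x (t - \<tau> x) / c x) \<in> borel_measurable N" using assms(3) by (rule borel_measurable_divide)
qed

lemma nn_integral_scales_mult:
  fixes g :: "real \<Rightarrow> ennreal"
  assumes c: "0 < c" and [measurable]: "(\<lambda>s. g s * indicator {0<..} s) \<in> borel_measurable borel"
  shows "ennreal c * (\<integral>\<^sup>+s. g (c * s) \<partial>scales) = (\<integral>\<^sup>+s. g s \<partial>scales)"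
proof -
  have "(\<integral>\<^sup>+s. g s \<partial>scales) = (\<integral>\<^sup>+s. g s * indicator {0<..} s \<partial>lborel)"
    by (simp add: nn_integral_restrict_space)
  also have "\<dots> = ennreal c * (\<integral>\<^sup>+s. g (c * s) * indicator {0<..} (c * s) \<partial>lborel)"
    using c by (subst nn_integral_real_affine[where c = c and t = 0]) simp_all
  also have "(\<integral>\<^sup>+s. g (c * s) * indicator {0<..} (c * s) \<partial>lborel) = (\<integral>\<^sup>+s. g (c * s) \<partial>scales)"
    using c by (simp add: nn_integral_restrict_space indicator_def zero_less_mult_iff)
  finally show ?thesis ..
qed

lemma measurable_scales_indicator:
  assumes "g \<in> borel_measurable scales"
  shows "(\<lambda>s. g s * indicator {0<..} s :: ennreal) \<in> borel_measurable borel"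
  using assms by (subst (asm) borel_measurable_restrict_space_iff_ennreal) simp_all

text \<open>Given the translation \<open>\<tau>\<close>, the substitution of \<open>p \<tau> * s\<close> for the scale cancels the factor
  \<open>1 / p \<tau>\<close> of the pattern against the density of the translation. What remains is the uniform
  mixture of all translates of the exponent measure of the pattern.\<close>

lemma exponent_measure_translated:
  fixes Q :: "'w \<Rightarrow> real ^ 'd::finite \<Rightarrow> real" and T :: "'w \<Rightarrow> real ^ 'd"
  assumes "prob_space M" and mQ: "Q \<in> M \<rightarrow>\<^sub>M cadlag_algebra" and \<delta>: "0 \<le> \<delta>"
    and mT: "T \<in> M \<rightarrow>\<^sub>M grid_ref \<delta>" and mp: "p \<in> borel_measurable (grid_ref \<delta>)"
    and pos: "\<And>s. s \<in> grid \<delta> \<Longrightarrow> 0 < p s"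
    and joint: "distr M (grid_ref \<delta> \<Otimes>\<^sub>M cadlag_algebra) (\<lambda>\<omega>. (T \<omega>, Q \<omega>))
      = density (grid_ref \<delta>) (\<lambda>s. ennreal (p s)) \<Otimes>\<^sub>M distr M cadlag_algebra Q"
    and \<Phi>: "\<Phi> \<in> borel_measurable cadlag_algebra"
  shows "(\<integral>\<^sup>+f. \<Phi> f \<partial>exponent_measure M (\<lambda>\<omega> t. Q \<omega> (t - T \<omega>) / p (T \<omega>)))
    = (\<integral>\<^sup>+\<tau>. (\<integral>\<^sup>+z. \<Phi> (\<lambda>t. Q (snd z) (t - \<tau>) / fst z) \<partial>(scales \<Otimes>\<^sub>M M)) \<partial>grid_ref \<delta>)"
proof -
  interpret M: prob_space M by fact
  let ?C = "distr M cadlag_algebra Q"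
  interpret C: prob_space ?C by (rule M.prob_space_distr[OF mQ])
  interpret R: sigma_finite_measure scales by (rule sigma_finite_scales)
  interpret G: sigma_finite_measure "grid_ref \<delta> :: (real ^ 'd) measure" by (rule sigma_finite_grid_ref[OF \<delta>])
  interpret RG: pair_sigma_finite scales "grid_ref \<delta> :: (real ^ 'd) measure" ..
  let ?D = "density (grid_ref \<delta>) (\<lambda>s. ennreal (p s))"
  let ?Y = "\<lambda>x. \<lambda>t. snd x (t - fst x) / p (fst x)"
  have mTQ: "(\<lambda>\<omega>. (T \<omega>, Q \<omega>)) \<in> M \<rightarrow>\<^sub>M grid_ref \<delta> \<Otimes>\<^sub>M cadlag_algebra" using mT mQ by (rule measurable_Pair)
  have mY: "?Y \<in> grid_ref \<delta> \<Otimes>\<^sub>M cadlag_algebra \<rightarrow>\<^sub>M cadlag_algebra"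
  proof (rule measurable_translated_rescaled)
    show "(\<lambda>x. fst x) \<in> grid_ref \<delta> \<Otimes>\<^sub>M cadlag_algebra \<rightarrow>\<^sub>M (borel :: (real ^ 'd) measure)"
      by (rule measurable_compose[OF measurable_fst measurable_grid_ref_ident])
    show "(\<lambda>x. p (fst x)) \<in> borel_measurable (grid_ref \<delta> \<Otimes>\<^sub>M cadlag_algebra)"
      by (rule measurable_compose[OF measurable_fst mp])
    show "0 \<le> p (fst x)" if "x \<in> space (grid_ref \<delta> \<Otimes>\<^sub>M cadlag_algebra)" for x :: "(real ^ 'd) \<times> (real ^ 'd \<Rightarrow> real)"
      using that pos[of "fst x"] by (auto simp: space_pair_measure space_grid_ref less_imp_le)
  qed simp
  have mYM: "(\<lambda>\<omega> t. Q \<omega> (t - T \<omega>) / p (T \<omega>)) \<in> M \<rightarrow>\<^sub>M cadlag_algebra"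
    using measurable_compose[OF mTQ mY] by simp
  let ?F = "\<lambda>s x. \<Phi> (\<lambda>t. ?Y x t / s)"
  have m3: "(\<lambda>z. ?F (fst (fst z)) (snd (fst z), snd z)) \<in> borel_measurable ((scales \<Otimes>\<^sub>M grid_ref \<delta>) \<Otimes>\<^sub>M ?C)"
  proof -
    have "(\<lambda>z. ((snd (fst z)), snd z)) \<in> (scales \<Otimes>\<^sub>M grid_ref \<delta>) \<Otimes>\<^sub>M cadlag_algebra \<rightarrow>\<^sub>M grid_ref \<delta> \<Otimes>\<^sub>M cadlag_algebra"
      by measurable
    then have "(\<lambda>z. (fst (fst z), ((snd (fst z)), snd z))) \<in> (scales \<Otimes>\<^sub>M grid_ref \<delta>) \<Otimes>\<^sub>M cadlag_algebra
        \<rightarrow>\<^sub>M scales \<Otimes>\<^sub>M (grid_ref \<delta> \<Otimes>\<^sub>M cadlag_algebra)"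
      by (intro measurable_Pair measurable_compose[OF measurable_fst measurable_fst]) simp_all
    from measurable_compose[OF measurable_compose[OF this measurable_rescaled_field[OF mY]] \<Phi>]
    have "(\<lambda>z. ?F (fst (fst z)) (snd (fst z), snd z)) \<in> borel_measurable ((scales \<Otimes>\<^sub>M grid_ref \<delta>) \<Otimes>\<^sub>M cadlag_algebra)"
      by simp
    then show ?thesis
      by (subst measurable_cong_sets[OF sets_pair_measure_cong[OF refl sets_distr] refl])
  qed
  let ?H = "\<lambda>(s, \<tau>). \<integral>\<^sup>+q. ?F s (\<tau>, q) \<partial>?C"
  have mH: "?H \<in> borel_measurable (scales \<Otimes>\<^sub>M grid_ref \<delta>)"
    using C.borel_measurable_nn_integral_fst[OF m3] by (simp add: case_prod_beta)
  have mF: "?F s \<in> borel_measurable (grid_ref \<delta> \<Otimes>\<^sub>M ?C)" if "0 < s" for s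
  proof -
    have "s \<in> space scales" using that by (simp add: space_restrict_space)
    from measurable_compose[OF measurable_compose[OF measurable_Pair1'[OF this] measurable_rescaled_field[OF mY]] \<Phi>]
    have "?F s \<in> borel_measurable (grid_ref \<delta> \<Otimes>\<^sub>M cadlag_algebra)" by simp
    then show ?thesis by (subst measurable_cong_sets[OF sets_pair_measure_cong[OF refl sets_distr] refl])
  qed
  have inner: "(\<integral>\<^sup>+\<omega>. \<Phi> (\<lambda>t. Q \<omega> (t - T \<omega>) / p (T \<omega>) / s) \<partial>M) = (\<integral>\<^sup>+\<tau>. ennreal (p \<tau>) * ?H (s, \<tau>) \<partial>grid_ref \<delta>)"
    if s: "0 < s" for s
  proof -
    have mF': "?F s \<in> borel_measurable (grid_ref \<delta> \<Otimes>\<^sub>M cadlag_algebra)"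
      using mF[OF s] by (subst (asm) measurable_cong_sets[OF sets_pair_measure_cong[OF refl sets_distr] refl])
    have "(\<integral>\<^sup>+\<omega>. \<Phi> (\<lambda>t. Q \<omega> (t - T \<omega>) / p (T \<omega>) / s) \<partial>M) = (\<integral>\<^sup>+x. ?F s x \<partial>distr M (grid_ref \<delta> \<Otimes>\<^sub>M cadlag_algebra) (\<lambda>\<omega>. (T \<omega>, Q \<omega>)))"
      by (subst nn_integral_distr[OF mTQ]) (simp_all only: measurable_distr_eq1 mF' fst_conv snd_conv)
    also have "\<dots> = (\<integral>\<^sup>+x. ?F s x \<partial>(?D \<Otimes>\<^sub>M ?C))" by (simp only: joint)
    also have "\<dots> = (\<integral>\<^sup>+\<tau>. (\<integral>\<^sup>+q. ?F s (\<tau>, q) \<partial>?C) \<partial>?D)"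
      by (rule C.nn_integral_fst[symmetric])
         (subst measurable_cong_sets[OF sets_pair_measure_cong[OF sets_density refl] refl], rule mF[OF s])
    also have "\<dots> = (\<integral>\<^sup>+\<tau>. ennreal (p \<tau>) * (\<integral>\<^sup>+q. ?F s (\<tau>, q) \<partial>?C) \<partial>grid_ref \<delta>)"
      by (rule nn_integral_density) (use mp C.borel_measurable_nn_integral_fst[OF mF[OF s]] in simp_all)
    finally show ?thesis by simp
  qed
  have "(\<integral>\<^sup>+f. \<Phi> f \<partial>exponent_measure M (\<lambda>\<omega> t. Q \<omega> (t - T \<omega>) / p (T \<omega>)))
      = (\<integral>\<^sup>+s. (\<integral>\<^sup>+\<omega>. \<Phi> (\<lambda>t. Q \<omega> (t - T \<omega>) / p (T \<omega>) / s) \<partial>M) \<partial>scales)"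
    by (simp add: nn_integral_exponent_measure[OF M.sigma_finite_measure_axioms mYM \<Phi>] nn_integral_restrict_space)
  also have "\<dots> = (\<integral>\<^sup>+s. (\<integral>\<^sup>+\<tau>. ennreal (p \<tau>) * ?H (s, \<tau>) \<partial>grid_ref \<delta>) \<partial>scales)"
  proof (rule nn_integral_cong)
    fix s assume "s \<in> space scales"
    then have "0 < s" by (simp add: space_restrict_space)
    then show "(\<integral>\<^sup>+\<omega>. \<Phi> (\<lambda>t. Q \<omega> (t - T \<omega>) / p (T \<omega>) / s) \<partial>M) = (\<integral>\<^sup>+\<tau>. ennreal (p \<tau>) * ?H (s, \<tau>) \<partial>grid_ref \<delta>)"
      by (rule inner)
  qed
  also have "\<dots> = (\<integral>\<^sup>+\<tau>. (\<integral>\<^sup>+s. ennreal (p \<tau>) * ?H (s, \<tau>) \<partial>scales) \<partial>grid_ref \<delta>)"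
  proof (rule RG.Fubini'[symmetric])
    have "(\<lambda>z. ennreal (p (snd z))) \<in> borel_measurable (scales \<Otimes>\<^sub>M grid_ref \<delta>)"
      by (rule measurable_compose[OF measurable_compose[OF measurable_snd mp] measurable_ennreal])
    then show "(\<lambda>(s, \<tau>). ennreal (p \<tau>) * ?H (s, \<tau>)) \<in> borel_measurable (scales \<Otimes>\<^sub>M grid_ref \<delta>)"
      using borel_measurable_times_ennreal[OF _ mH] by (simp add: case_prod_beta)
  qed
  also have "\<dots> = (\<integral>\<^sup>+\<tau>. (\<integral>\<^sup>+z. \<Phi> (\<lambda>t. Q (snd z) (t - \<tau>) / fst z) \<partial>(scales \<Otimes>\<^sub>M M)) \<partial>grid_ref \<delta>)"
  proof (rule nn_integral_cong)
    fix \<tau> :: "real ^ 'd" assume "\<tau> \<in> space (grid_ref \<delta>)"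
    then have p: "0 < p \<tau>" and \<tau>: "\<tau> \<in> space (grid_ref \<delta>)" by (simp_all add: pos space_grid_ref)
    let ?K = "\<lambda>z. \<Phi> (\<lambda>t. Q (snd z) (t - \<tau>) / fst z)"
    have mK: "?K \<in> borel_measurable (scales \<Otimes>\<^sub>M M)"
      using measurable_compose[OF measurable_rescaled_field[OF measurable_compose[OF mQ measurable_cadlag_shift[of \<tau>]]] \<Phi>]
      by (simp add: case_prod_beta)
    let ?g = "\<lambda>s. \<integral>\<^sup>+\<omega>. ?K (s, \<omega>) \<partial>M"
    have H: "?H (s, \<tau>) = ?g (p \<tau> * s)" if "0 < s" for s
    proof -
      have "(\<lambda>q. ?F s (\<tau>, q)) \<in> borel_measurable cadlag_algebra"
        using measurable_compose[OF measurable_Pair1'[OF \<tau>] mF[OF that]] by simp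
      then have "?H (s, \<tau>) = (\<integral>\<^sup>+\<omega>. ?F s (\<tau>, Q \<omega>) \<partial>M)" by (simp add: nn_integral_distr[OF mQ])
      then show ?thesis by simp
    qed
    have "(\<integral>\<^sup>+s. ennreal (p \<tau>) * ?H (s, \<tau>) \<partial>scales) = (\<integral>\<^sup>+s. ennreal (p \<tau>) * ?g (p \<tau> * s) \<partial>scales)"
    proof (rule nn_integral_cong)
      fix s assume "s \<in> space scales"
      then have "0 < s" by (simp add: space_restrict_space)
      then show "ennreal (p \<tau>) * ?H (s, \<tau>) = ennreal (p \<tau>) * ?g (p \<tau> * s)" by (simp only: H)
    qed
    also have "\<dots> = ennreal (p \<tau>) * (\<integral>\<^sup>+s. ?g (p \<tau> * s) \<partial>scales)"
    proof (rule nn_integral_cmult)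
      have "(\<lambda>s. ?H (s, \<tau>)) \<in> borel_measurable scales"
        using measurable_compose[OF measurable_Pair2'[OF \<tau>] mH] by simp
      then show "(\<lambda>s. ?g (p \<tau> * s)) \<in> borel_measurable scales"
        by (rule measurable_cong[THEN iffD1, rotated]) (subst H, simp_all add: space_restrict_space)
    qed
    also have "\<dots> = (\<integral>\<^sup>+s. ?g s \<partial>scales)"
      by (rule nn_integral_scales_mult[OF p measurable_scales_indicator[OF M.borel_measurable_nn_integral_fst[OF mK]]])
    also have "\<dots> = (\<integral>\<^sup>+z. ?K z \<partial>(scales \<Otimes>\<^sub>M M))" by (rule M.nn_integral_fst[OF mK])
    finally show "(\<integral>\<^sup>+s. ennreal (p \<tau>) * ?H (s, \<tau>) \<partial>scales) = (\<integral>\<^sup>+z. ?K z \<partial>(scales \<Otimes>\<^sub>M M))" .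
  qed
  finally show ?thesis .
qed

text \<open>Write a translation as a lattice point plus a point \<open>u\<close> of the cell at the origin. Then \<open>\<nu>\<close> is the sum of
  the lattice translates of \<open>m\<close>, the exponent measure of \<open>Q\<close> translated by a uniform \<open>u\<close>. The total size of
  an excursion does not depend on \<open>u\<close>, so \<open>m\<close> and the exponent measure of \<open>Q\<close> agree on it.\<close>

theorem translated_pattern_limit:
  fixes Q Z :: "'w \<Rightarrow> real ^ 'd::finite \<Rightarrow> real" and T :: "'w \<Rightarrow> real ^ 'd"
  assumes "prob_space M" and mQ: "Q \<in> M \<rightarrow>\<^sub>M cadlag_algebra" and \<delta>: "0 \<le> \<delta>"
    and mT: "T \<in> M \<rightarrow>\<^sub>M grid_ref \<delta>" and mp: "p \<in> borel_measurable (grid_ref \<delta>)"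
    and pos: "\<And>s. s \<in> grid \<delta> \<Longrightarrow> 0 < p s"
    and joint: "distr M (grid_ref \<delta> \<Otimes>\<^sub>M cadlag_algebra) (\<lambda>\<omega>. (T \<omega>, Q \<omega>))
      = density (grid_ref \<delta>) (\<lambda>s. ennreal (p s)) \<Otimes>\<^sub>M distr M cadlag_algebra Q"
    and eq: "\<And>\<Phi>. \<Phi> \<in> borel_measurable cadlag_algebra \<Longrightarrow> \<Phi> (\<lambda>_. 0) = 0 \<Longrightarrow>
      (\<integral>\<^sup>+f. \<Phi> f \<partial>exponent_measure M Z) = (\<integral>\<^sup>+f. \<Phi> f \<partial>exponent_measure M (\<lambda>\<omega> t. Q \<omega> (t - T \<omega>) / p (T \<omega>)))"
    and fin: "emeasure (exponent_measure M Z) {f\<in>cadlag. exceed_mass \<delta> (cell (mesh \<delta>) (\<lambda>_. 0)) f \<noteq> 0} < \<infinity>"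
  shows "((\<lambda>T. emeasure (exponent_measure M Z) (exceed_event \<delta> x (cube T)) / ennreal (T ^ CARD('d)))
      \<longlongrightarrow> emeasure (exponent_measure M Q) (exceed_event \<delta> x UNIV) * ennreal ((1 / mesh \<delta>) ^ CARD('d))) at_top"
    and "emeasure (exponent_measure M Q) (exceed_event \<delta> x UNIV) < \<infinity>"
proof -
  interpret M: prob_space M by fact
  interpret R: sigma_finite_measure scales by (rule sigma_finite_scales)
  interpret RM0: pair_sigma_finite scales M ..
  let ?RM = "scales \<Otimes>\<^sub>M M"
  let ?L = "mesh \<delta>"
  have L: "0 < ?L" by (rule mesh_pos[OF \<delta>])
  define c where "c = ennreal ((1 / ?L) ^ CARD('d))"
  let ?w = "\<lambda>u. indicator (cell ?L (\<lambda>_::'d. 0)) u * c"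
  let ?D = "density (grid_measure \<delta>) ?w"
  let ?G = "\<lambda>x t. Q (snd (snd x)) (t - fst x) / fst (snd x)"
  have mG0: "?G \<in> borel \<Otimes>\<^sub>M ?RM \<rightarrow>\<^sub>M cadlag_algebra"
  proof (rule measurable_translated_rescaled)
    show "(\<lambda>x. Q (snd (snd x))) \<in> borel \<Otimes>\<^sub>M ?RM \<rightarrow>\<^sub>M cadlag_algebra"
      by (rule measurable_compose[OF measurable_compose[OF measurable_snd measurable_snd] mQ])
    show "(\<lambda>x. fst x) \<in> borel \<Otimes>\<^sub>M ?RM \<rightarrow>\<^sub>M (borel :: (real ^ 'd) measure)" by (rule measurable_fst)
    show "(\<lambda>x. fst (snd x)) \<in> borel_measurable (borel \<Otimes>\<^sub>M ?RM)"
      by (rule measurable_compose[OF measurable_snd measurable_fst_scales])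
    show "0 \<le> fst (snd x)" if "x \<in> space (borel \<Otimes>\<^sub>M ?RM)" for x :: "(real ^ 'd) \<times> real \<times> 'w"
      using that by (auto simp: space_pair_measure space_restrict_space)
  qed
  have sD: "sets ?D = sets borel" by simp
  have mG: "?G \<in> ?D \<Otimes>\<^sub>M ?RM \<rightarrow>\<^sub>M cadlag_algebra"
    using mG0 by (subst measurable_cong_sets[OF sets_pair_measure_cong[OF sD refl] refl])
  define h where "h \<Phi> u = (\<integral>\<^sup>+z. \<Phi> (\<lambda>t. Q (snd z) (t - u) / fst z) \<partial>?RM)"
    for \<Phi> :: "(real ^ 'd \<Rightarrow> real) \<Rightarrow> ennreal" and u
  have mh: "h \<Phi> \<in> borel_measurable borel" if "\<Phi> \<in> borel_measurable cadlag_algebra" for \<Phi>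
    using RM0.P.borel_measurable_nn_integral_fst[OF measurable_compose[OF mG0 that]] unfolding h_def by simp
  define m where "m = distr (?D \<Otimes>\<^sub>M ?RM) cadlag_algebra ?G"
  have sm: "sets m = sets cadlag_algebra" by (simp add: m_def)
  have mw: "?w \<in> borel_measurable (grid_measure \<delta>)"
    by (intro borel_measurable_times_ennreal borel_measurable_indicator) simp_all
  have int_m: "(\<integral>\<^sup>+f. \<Phi> f \<partial>m) = (\<integral>\<^sup>+u. ?w u * h \<Phi> u \<partial>grid_measure \<delta>)"
    if \<Phi>: "\<Phi> \<in> borel_measurable cadlag_algebra" for \<Phi>
  proof -
    have "(\<integral>\<^sup>+f. \<Phi> f \<partial>m) = (\<integral>\<^sup>+x. \<Phi> (?G x) \<partial>(?D \<Otimes>\<^sub>M ?RM))"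
      unfolding m_def by (rule nn_integral_distr[OF mG]) (simp add: \<Phi>)
    also have "\<dots> = (\<integral>\<^sup>+u. (\<integral>\<^sup>+z. \<Phi> (?G (u, z)) \<partial>?RM) \<partial>?D)"
      by (rule RM0.P.nn_integral_fst[symmetric, OF measurable_compose[OF mG \<Phi>]])
    also have "\<dots> = (\<integral>\<^sup>+u. h \<Phi> u \<partial>?D)" by (simp add: h_def)
    also have "\<dots> = (\<integral>\<^sup>+u. ?w u * h \<Phi> u \<partial>grid_measure \<delta>)"
      by (rule nn_integral_density[OF mw]) (use mh[OF \<Phi>] in \<open>simp add: measurable_cong_sets[OF sets_grid_measure refl]\<close>)
    finally show ?thesis .
  qed
  have sE: "exceed_event \<delta> x UNIV \<in> sets (cadlag_algebra :: (real ^ 'd \<Rightarrow> real) measure)"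
    by (rule sets_exceed_event[OF \<delta>]) simp
  have transport: "emeasure (exponent_measure M Z) A
      = (\<integral>\<^sup>+k. emeasure m {f\<in>cadlag. (\<lambda>t. f (t - lattice_point ?L k)) \<in> A} \<partial>count_space UNIV)"
    if A: "A \<in> sets cadlag_algebra" and 0: "(\<lambda>_. 0) \<notin> A" for A
  proof -
    let ?I = "indicator A :: (real ^ 'd \<Rightarrow> real) \<Rightarrow> ennreal"
    have mI: "?I \<in> borel_measurable cadlag_algebra" using A by simp
    have "emeasure (exponent_measure M Z) A = (\<integral>\<^sup>+f. ?I f \<partial>exponent_measure M Z)" using A by simp
    also have "\<dots> = (\<integral>\<^sup>+f. ?I f \<partial>exponent_measure M (\<lambda>\<omega> t. Q \<omega> (t - T \<omega>) / p (T \<omega>)))"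
      by (rule eq[OF mI]) (simp add: 0)
    also have "\<dots> = (\<integral>\<^sup>+\<tau>. h ?I \<tau> \<partial>grid_ref \<delta>)"
      unfolding h_def by (rule exponent_measure_translated[OF assms(1-7) mI])
    also have "\<dots> = c * (\<integral>\<^sup>+\<tau>. h ?I \<tau> \<partial>grid_measure \<delta>)"
      unfolding c_def by (rule nn_integral_grid_ref[OF \<delta> mh[OF mI]])
    also have "\<dots> = c * (\<integral>\<^sup>+k. (\<integral>\<^sup>+u. h ?I (u + lattice_point ?L k) * indicator (cell ?L (\<lambda>_. 0)) u \<partial>grid_measure \<delta>) \<partial>count_space UNIV)"
      by (simp only: nn_integral_grid_measure_cells[OF \<delta> mh[OF mI]])
    also have "\<dots> = (\<integral>\<^sup>+k. c * (\<integral>\<^sup>+u. h ?I (u + lattice_point ?L k) * indicator (cell ?L (\<lambda>_. 0)) u \<partial>grid_measure \<delta>) \<partial>count_space UNIV)"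
      by (rule nn_integral_cmult[symmetric]) simp
    also have "\<dots> = (\<integral>\<^sup>+k. emeasure m {f\<in>cadlag. (\<lambda>t. f (t - lattice_point ?L k)) \<in> A} \<partial>count_space UNIV)"
    proof (rule nn_integral_cong)
      fix k :: "'d \<Rightarrow> int"
      let ?l = "lattice_point ?L k"
      let ?S = "{f\<in>cadlag. (\<lambda>t. f (t - ?l)) \<in> A}"
      have S: "?S \<in> sets cadlag_algebra"
        using measurable_sets[OF measurable_cadlag_shift A, of ?l] by (simp add: vimage_def Int_def conj_commute)
      have hS: "h (indicator ?S) u = h ?I (u + ?l)" for u
        unfolding h_def
      proof (rule nn_integral_cong)
        fix z assume z: "z \<in> space ?RM"
        have "?G (u, z) \<in> cadlag"
          using measurable_space[OF mG0, of "(u, z)"] z by (simp add: space_pair_measure)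
        then have "(\<lambda>t. Q (snd z) (t - u) / fst z) \<in> cadlag" by simp
        moreover have "t - ?l - u = t - (u + ?l)" for t by simp
        ultimately show "indicator ?S (\<lambda>t. Q (snd z) (t - u) / fst z) = ?I (\<lambda>t. Q (snd z) (t - (u + ?l)) / fst z)"
          by (simp only: indicator_def mem_Collect_eq simp_thms)
      qed
      have "(\<lambda>u. h ?I (u + ?l)) \<in> borel_measurable borel"
      proof -
        have "(\<lambda>u. u + ?l) \<in> borel \<rightarrow>\<^sub>M borel" by measurable
        from measurable_compose[OF this mh[OF mI]] show ?thesis .
      qed
      then have mm: "(\<lambda>u. h ?I (u + ?l) * indicator (cell ?L (\<lambda>_. 0)) u) \<in> borel_measurable (grid_measure \<delta>)"
        by (simp add: measurable_cong_sets[OF sets_grid_measure refl])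
      have "emeasure m ?S = (\<integral>\<^sup>+f. indicator ?S f \<partial>m)" using S by (simp add: sm)
      also have "\<dots> = (\<integral>\<^sup>+u. ?w u * h (indicator ?S) u \<partial>grid_measure \<delta>)" using S by (intro int_m) simp
      also have "\<dots> = (\<integral>\<^sup>+u. c * (h ?I (u + ?l) * indicator (cell ?L (\<lambda>_. 0)) u) \<partial>grid_measure \<delta>)"
        unfolding hS by (intro nn_integral_cong) (simp add: ac_simps)
      also have "\<dots> = c * (\<integral>\<^sup>+u. h ?I (u + ?l) * indicator (cell ?L (\<lambda>_. 0)) u \<partial>grid_measure \<delta>)"
        by (rule nn_integral_cmult[OF mm])
      finally show "c * (\<integral>\<^sup>+u. h ?I (u + ?l) * indicator (cell ?L (\<lambda>_. 0)) u \<partial>grid_measure \<delta>) = emeasure m ?S" ..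
    qed
    finally show ?thesis .
  qed
  have mass_eq: "emeasure m (exceed_event \<delta> x UNIV)
      = emeasure (exponent_measure M Q) (exceed_event \<delta> x UNIV)"
  proof -
    let ?E = "exceed_event \<delta> x UNIV :: (real ^ 'd \<Rightarrow> real) set"
    let ?I = "indicator ?E :: (real ^ 'd \<Rightarrow> real) \<Rightarrow> ennreal"
    have mI: "?I \<in> borel_measurable cadlag_algebra" using sE by simp
    have h0: "h ?I 0 = emeasure (exponent_measure M Q) ?E"
    proof -
      have "emeasure (exponent_measure M Q) ?E = (\<integral>\<^sup>+f. ?I f \<partial>exponent_measure M Q)"
        using sE by (intro nn_integral_indicator[symmetric]) simp
      also have "\<dots> = (\<integral>\<^sup>+z. ?I ((\<lambda>(s, \<omega>) t. Q \<omega> t / s) z) \<partial>?RM)"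
        unfolding exponent_measure_def by (rule nn_integral_distr[OF measurable_rescaled_field[OF mQ]]) (simp add: mI)
      finally show ?thesis by (simp add: h_def case_prod_beta)
    qed
    have hu: "h ?I u = h ?I 0" if u: "u \<in> grid \<delta>" for u
      unfolding h_def
    proof (rule nn_integral_cong)
      fix z assume z: "z \<in> space ?RM"
      have f: "(\<lambda>t. Q (snd z) t / fst z) \<in> cadlag"
        using measurable_space[OF measurable_rescaled_field[OF mQ] z] by (simp add: case_prod_beta)
      have "exceed_mass \<delta> UNIV (\<lambda>t. Q (snd z) (t - u) / fst z) = exceed_mass \<delta> UNIV (\<lambda>t. Q (snd z) t / fst z)"
        using exceed_mass_shift[OF \<delta> u f, of UNIV] by simp
      then show "?I (\<lambda>t. Q (snd z) (t - u) / fst z) = ?I (\<lambda>t. Q (snd z) (t - 0) / fst z)"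
        using f cadlag_shift[OF f, of u] by (simp add: indicator_def)
    qed
    have mw': "?w \<in> borel_measurable borel" using mw by (simp add: measurable_cong_sets[OF sets_grid_measure refl])
    have "emeasure m ?E = (\<integral>\<^sup>+f. ?I f \<partial>m)" using sE by (simp add: sm)
    also have "\<dots> = (\<integral>\<^sup>+u. ?w u * h ?I u \<partial>grid_measure \<delta>)" by (rule int_m[OF mI])
    also have "\<dots> = (\<integral>\<^sup>+u. ?w u * h ?I u \<partial>lam \<delta>)"
      by (rule nn_integral_grid_measure[OF borel_measurable_times_ennreal[OF mw' mh[OF mI]]])
    also have "\<dots> = (\<integral>\<^sup>+u. ?w u * h ?I 0 \<partial>lam \<delta>)"
      using hu by (intro nn_integral_cong) (simp add: space_lam)
    also have "\<dots> = (\<integral>\<^sup>+u. ?w u * h ?I 0 \<partial>grid_measure \<delta>)"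
      by (rule nn_integral_grid_measure[symmetric, OF borel_measurable_times_ennreal[OF mw' borel_measurable_const]])
    also have "\<dots> = (\<integral>\<^sup>+u. indicator (cell ?L (\<lambda>_::'d. 0)) u * (c * h ?I 0) \<partial>grid_measure \<delta>)"
      by (simp add: mult.assoc)
    also have "\<dots> = emeasure (grid_measure \<delta>) (cell ?L (\<lambda>_::'d. 0)) * (c * h ?I 0)"
      by (subst nn_integral_multc) simp_all
    also have "\<dots> = ennreal (?L ^ CARD('d)) * c * h ?I 0"
      by (simp add: emeasure_grid_measure_cell[OF \<delta>] mult.assoc)
    also have "ennreal (?L ^ CARD('d)) * c = 1"
      unfolding c_def using L by (simp add: ennreal_mult'[symmetric] power_divide)
    finally show ?thesis by (simp add: h0)
  qed
  show "((\<lambda>T. emeasure (exponent_measure M Z) (exceed_event \<delta> x (cube T)) / ennreal (T ^ CARD('d)))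
      \<longlongrightarrow> emeasure (exponent_measure M Q) (exceed_event \<delta> x UNIV) * ennreal ((1 / mesh \<delta>) ^ CARD('d))) at_top"
    using tiling_limit(1)[OF \<delta> sm _ fin, of x] transport unfolding mass_eq by blast
  show "emeasure (exponent_measure M Q) (exceed_event \<delta> x UNIV) < \<infinity>"
    using tiling_limit(2)[OF \<delta> sm _ fin, of x] transport unfolding mass_eq by blast
qed

section \<open>Versions of fields and values on the grid\<close>

text \<open>Completeness makes measurability itself insensitive to null sets, so that both sides are zero by
  convention if one of the two sets is not measurable.\<close>

lemma (in complete_measure) measure_cong_AE_complete:
  assumes "AE x in M. P x \<longleftrightarrow> P' x"
  shows "measure M {x\<in>space M. P x} = measure M {x\<in>space M. P' x}"
proof (cases "{x\<in>space M. P x} \<in> sets M")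
  case True
  have "{x\<in>space M. P' x} \<in> sets M"
    by (rule in_sets_AE[OF _ True]) (use assms in auto)
  then show ?thesis using True assms by (intro measure_eq_AE) auto
next
  case False
  have "{x\<in>space M. P' x} \<notin> sets M"
  proof
    assume "{x\<in>space M. P' x} \<in> sets M"
    moreover have "AE x in M. (x \<in> {x\<in>space M. P' x}) \<longleftrightarrow> x \<in> {x\<in>space M. P x}"
      using assms by eventually_elim auto
    ultimately have "{x\<in>space M. P x} \<in> sets M"
      using in_sets_AE[of "{x\<in>space M. P' x}" "{x\<in>space M. P x}"] by simp
    with False show False ..
  qed
  then show ?thesis using False by (simp add: measure_notin_sets)
qed

lemma (in complete_measure) measurable_cong_AE_complete:
  assumes ae: "AE x in M. f x = g x" and g: "g \<in> M \<rightarrow>\<^sub>M N" and f: "\<And>x. x \<in> space M \<Longrightarrow> f x \<in> space N"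
  shows "f \<in> M \<rightarrow>\<^sub>M N"
proof (rule measurableI[OF f])
  fix A assume A: "A \<in> sets N"
  show "f -` A \<inter> space M \<in> sets M"
    by (rule in_sets_AE[OF _ measurable_sets[OF g A]]) (use ae in auto)
qed

definition cadlag_part :: "(real ^ 'd::finite \<Rightarrow> real) \<Rightarrow> real ^ 'd \<Rightarrow> real" where
  "cadlag_part f = (if f \<in> cadlag then f else (\<lambda>_. 0))"

lemma (in complete_measure) measurable_cadlag_part:
  assumes "cadlag_field M Y"
  shows "(\<lambda>\<omega>. cadlag_part (Y \<omega>)) \<in> M \<rightarrow>\<^sub>M cadlag_algebra" and "AE \<omega> in M. cadlag_part (Y \<omega>) = Y \<omega>"
proof -
  have ae: "AE \<omega> in M. Y \<omega> \<in> cadlag" and m: "(\<lambda>\<omega>. Y \<omega> t) \<in> borel_measurable M" for t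
    using assms by (auto simp: cadlag_field_def random_field_def)
  from ae show ae': "AE \<omega> in M. cadlag_part (Y \<omega>) = Y \<omega>"
    by eventually_elim (simp add: cadlag_part_def)
  show "(\<lambda>\<omega>. cadlag_part (Y \<omega>)) \<in> M \<rightarrow>\<^sub>M cadlag_algebra"
  proof (rule measurable_cadlag_algebraI)
    show "cadlag_part (Y \<omega>) \<in> cadlag" for \<omega> by (simp add: cadlag_part_def)
    show "(\<lambda>\<omega>. cadlag_part (Y \<omega>) t) \<in> borel_measurable M" for t
    proof (rule measurable_cong_AE_complete[OF _ m[of t]])
      show "AE \<omega> in M. cadlag_part (Y \<omega>) t = Y \<omega> t" using ae' by eventually_elim simp
    qed simp
  qed
qed

lemma AE_max_stable_space_component:
  assumes "prob_space M" "AE \<omega> in M. P \<omega>"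
  shows "AE w in max_stable_space M. \<forall>i. P (snd (w i))"
proof -
  interpret M: prob_space M by fact
  interpret E: prob_space unit_exp by (rule prob_space_unit_exp)
  interpret P: pair_prob_space unit_exp M ..
  from AE_E[OF assms(2)] obtain N where N: "{\<omega>\<in>space M. \<not> P \<omega>} \<subseteq> N" "emeasure M N = 0" "N \<in> sets M" by blast
  have "AE p in unit_exp \<Otimes>\<^sub>M M. snd p \<notin> N"
  proof (rule P.AE_pair_measure)
    have [measurable]: "N \<in> sets M" by fact
    show "{p\<in>space (unit_exp \<Otimes>\<^sub>M M). snd p \<notin> N} \<in> sets (unit_exp \<Otimes>\<^sub>M M)" by measurable
    have "N \<in> null_sets M" using N by (intro null_setsI) auto
    then show "AE x in unit_exp. AE y in M. snd (x, y) \<notin> N" by (simp add: AE_not_in)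
  qed
  then have *: "AE p in unit_exp \<Otimes>\<^sub>M M. P (snd p)"
    using AE_space by eventually_elim (use N(1) in \<open>auto simp: space_pair_measure\<close>)
  show ?thesis
    unfolding max_stable_space_eq AE_all_countable
    by (intro allI AE_PiM_component * P.prob_space_axioms) simp
qed

lemma field_law_cong_AE:
  assumes "prob_space M" and Y: "random_field M I Y" and Z: "random_field M I Z"
    and ae: "AE \<omega> in M. \<forall>t\<in>I. Y \<omega> t = Z \<omega> t"
  shows "field_law (max_stable_space M) I (max_stable_field Y) = field_law (max_stable_space M) I (max_stable_field Z)"
  unfolding field_law_def
proof (rule distr_cong_AE)
  show "AE w in max_stable_space M. restrict (max_stable_field Y w) I = restrict (max_stable_field Z w) I"
    using AE_max_stable_space_component[OF assms(1) ae]
    by eventually_elim (auto simp: max_stable_field_def restrict_def fun_eq_iff)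
  show "(\<lambda>w. restrict (max_stable_field Y w) I) \<in> max_stable_space M \<rightarrow>\<^sub>M Pi\<^sub>M I (\<lambda>_. borel)"
    using Y by (intro measurable_restrict measurable_max_stable_field) (simp add: random_field_def)
  show "(\<lambda>w. restrict (max_stable_field Z w) I) \<in> max_stable_space M \<rightarrow>\<^sub>M Pi\<^sub>M I (\<lambda>_. borel)"
    using Z by (intro measurable_restrict measurable_max_stable_field) (simp add: random_field_def)
qed simp_all

text \<open>For \<open>\<delta> > 0\<close> this rounds down to the grid, so that composition with it extends a field on the grid to one
  that is constant on the cells.\<close>

definition grid_round :: "real \<Rightarrow> real ^ 'd::finite \<Rightarrow> real ^ 'd" where
  "grid_round \<delta> t = (if \<delta> = 0 then t else lattice_point \<delta> (\<lambda>i. \<lfloor>t $ i / \<delta>\<rfloor>))"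

lemma grid_round_in_grid: "grid_round \<delta> t \<in> grid \<delta>"
  by (auto simp: grid_round_def grid_def)

lemma grid_round_diff:
  assumes "0 \<le> \<delta>" "h \<in> grid \<delta>"
  shows "grid_round \<delta> (t - h) = grid_round \<delta> t - h"
proof (cases "\<delta> = 0")
  case False
  then have d: "0 < \<delta>" using assms by simp
  from assms obtain j where h: "h = lattice_point \<delta> j"
    using bij_betw_lattice_point[OF d] by (auto simp: bij_betw_def)
  have "\<lfloor>(t - h) $ i / \<delta>\<rfloor> = \<lfloor>t $ i / \<delta>\<rfloor> - j i" for i
  proof -
    have "(t - h) $ i / \<delta> = t $ i / \<delta> - of_int (j i)" using d by (simp add: h diff_divide_distrib)
    then show ?thesis by simp
  qed
  then show ?thesis using False by (simp add: grid_round_def vec_eq_iff h right_diff_distrib)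
qed (simp add: grid_round_def)

lemma grid_round_grid: "0 \<le> \<delta> \<Longrightarrow> t \<in> grid \<delta> \<Longrightarrow> grid_round \<delta> t = t"
  using grid_round_diff[of \<delta> t t] by (auto simp: grid_round_def vec_eq_iff lattice_point_def zero_vec_def split: if_splits)

lemma grid_diff: "0 \<le> \<delta> \<Longrightarrow> s \<in> grid \<delta> \<Longrightarrow> t \<in> grid \<delta> \<Longrightarrow> s - t \<in> grid \<delta>"
  using grid_round_in_grid[of \<delta> "s - t"] by (simp add: grid_round_diff grid_round_grid)

text \<open>A function of the lower corner of the lattice cell is constant near a point inside each
  quadrant, so its quadrant limits exist whatever its values.\<close>

lemma cadlag_grid_round:
  fixes g :: "real ^ 'd::finite \<Rightarrow> real"
  assumes d: "0 < \<delta>" and nn: "\<And>t. t \<in> grid \<delta> \<Longrightarrow> 0 \<le> g t"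
  shows "(\<lambda>t. g (grid_round \<delta> t)) \<in> cadlag"
proof -
  have ev: "\<exists>v. (\<forall>\<^sub>F s in at t within quadrant I t. grid_round \<delta> s = v) \<and> (I = UNIV \<longrightarrow> v = grid_round \<delta> t)"
    for t :: "real ^ 'd" and I
  proof -
    \<comment> \<open>Approached from the left, a grid point still belongs to the preceding cell.\<close>
    define v where "v = lattice_point \<delta> (\<lambda>i. if i \<in> I then \<lfloor>t $ i / \<delta>\<rfloor> else \<lceil>t $ i / \<delta>\<rceil> - 1)"
    have nth: "((\<lambda>s. s $ i / \<delta>) \<longlongrightarrow> t $ i / \<delta>) (at t within quadrant I t)" for i
      using d by (intro tendsto_divide tendsto_vec_nth tendsto_ident_at tendsto_const) simp
    have "\<forall>\<^sub>F s in at t within quadrant I t. \<lfloor>s $ i / \<delta>\<rfloor> = (if i \<in> I then \<lfloor>t $ i / \<delta>\<rfloor> else \<lceil>t $ i / \<delta>\<rceil> - 1)" for i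
    proof (cases "i \<in> I")
      case True
      have "t $ i / \<delta> < of_int (\<lfloor>t $ i / \<delta>\<rfloor> + 1)" by linarith
      from order_tendstoD(2)[OF nth this]
      have "\<forall>\<^sub>F s in at t within quadrant I t. s $ i / \<delta> < of_int (\<lfloor>t $ i / \<delta>\<rfloor> + 1)" .
      moreover have "\<forall>\<^sub>F s in at t within quadrant I t. t $ i / \<delta> \<le> s $ i / \<delta>"
        unfolding eventually_at_filter using True d
        by (intro always_eventually) (auto simp: quadrant_def divide_right_mono)
      ultimately show ?thesis
      proof eventually_elim
        case (elim s)
        then show ?case using True by simp linarith
      qed
    next
      case False
      have "of_int (\<lceil>t $ i / \<delta>\<rceil> - 1) < t $ i / \<delta>" by linarith
      from order_tendstoD(1)[OF nth this]
      have "\<forall>\<^sub>F s in at t within quadrant I t. of_int (\<lceil>t $ i / \<delta>\<rceil> - 1) < s $ i / \<delta>" .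
      moreover have "\<forall>\<^sub>F s in at t within quadrant I t. s $ i / \<delta> < t $ i / \<delta>"
        unfolding eventually_at_filter using False d
        by (intro always_eventually) (auto simp: quadrant_def divide_strict_right_mono)
      ultimately show ?thesis
      proof eventually_elim
        case (elim s)
        then show ?case using False by simp linarith
      qed
    qed
    then have "\<forall>\<^sub>F s in at t within quadrant I t. \<forall>i. \<lfloor>s $ i / \<delta>\<rfloor> = (if i \<in> I then \<lfloor>t $ i / \<delta>\<rfloor> else \<lceil>t $ i / \<delta>\<rceil> - 1)"
      by (rule eventually_all_finite)
    then have "\<forall>\<^sub>F s in at t within quadrant I t. grid_round \<delta> s = v"
      by eventually_elim (use d in \<open>simp add: grid_round_def v_def\<close>)
    moreover have "I = UNIV \<longrightarrow> v = grid_round \<delta> t" using d by (simp add: v_def grid_round_def)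
    ultimately show ?thesis by blast
  qed
  have lim: "\<exists>v. ((\<lambda>t. g (grid_round \<delta> t)) \<longlongrightarrow> g v) (at t within quadrant I t) \<and> (I = UNIV \<longrightarrow> v = grid_round \<delta> t)"
    for t :: "real ^ 'd" and I
  proof -
    from ev[of t I] obtain v where v: "\<forall>\<^sub>F s in at t within quadrant I t. grid_round \<delta> s = v" "I = UNIV \<longrightarrow> v = grid_round \<delta> t" by blast
    from v(1) have "\<forall>\<^sub>F s in at t within quadrant I t. g (grid_round \<delta> s) = g v" by eventually_elim simp
    then have "((\<lambda>t. g (grid_round \<delta> t)) \<longlongrightarrow> g v) (at t within quadrant I t)" by (rule tendsto_eventually)
    with v(2) show ?thesis by blast
  qed
  have "quadrant UNIV t = {s. \<forall>i. t $ i \<le> s $ i}" for t :: "real ^ 'd" by (simp add: quadrant_def)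
  then show ?thesis
    unfolding cadlag_def using lim nn[OF grid_round_in_grid] by (auto, metis, metis)
qed

lemma excursion_cong_grid:
  assumes "\<And>t. t \<in> grid \<delta> \<Longrightarrow> f t = g t"
  shows "excursion \<delta> A f s = excursion \<delta> A g s"
  unfolding excursion_def using assms by (intro nn_integral_cong) (auto simp: space_lam indicator_def)

lemma (in complete_measure) excursion_integral_cong:
  assumes "AE \<omega> in M. \<forall>t\<in>grid \<delta>. Y \<omega> t = Y' \<omega> t"
  shows "(\<integral>\<^sup>+s\<in>{0..}. ennreal (\<P>(\<omega> in M. excursion \<delta> A (Y \<omega>) s > ennreal x)) \<partial>lborel)
    = (\<integral>\<^sup>+s\<in>{0..}. ennreal (\<P>(\<omega> in M. excursion \<delta> A (Y' \<omega>) s > ennreal x)) \<partial>lborel)"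
proof -
  have "\<P>(\<omega> in M. excursion \<delta> A (Y \<omega>) s > ennreal x) = \<P>(\<omega> in M. excursion \<delta> A (Y' \<omega>) s > ennreal x)" for s
  proof (rule measure_cong_AE_complete)
    show "AE \<omega> in M. (excursion \<delta> A (Y \<omega>) s > ennreal x) = (excursion \<delta> A (Y' \<omega>) s > ennreal x)"
      using assms by eventually_elim (simp add: excursion_cong_grid[of \<delta> "Y _" "Y' _"])
  qed
  then show ?thesis by simp
qed

section \<open>The Berman function of a randomly translated pattern\<close>

lemma nn_integral_exponent_measure_rescale:
  assumes "prob_space M" and mY: "Y \<in> M \<rightarrow>\<^sub>M cadlag_algebra" and b: "0 < b"
    and \<Phi>: "\<Phi> \<in> borel_measurable cadlag_algebra"
  shows "(\<integral>\<^sup>+f. \<Phi> f \<partial>exponent_measure M (\<lambda>\<omega> t. Y \<omega> t / b)) = ennreal (1 / b) * (\<integral>\<^sup>+f. \<Phi> f \<partial>exponent_measure M Y)"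
proof -
  interpret prob_space M by fact
  have mYb: "(\<lambda>\<omega> t. Y \<omega> t / b) \<in> M \<rightarrow>\<^sub>M cadlag_algebra"
    using measurable_translated_rescaled[OF mY, of "\<lambda>_. 0" "\<lambda>_. b"] b by simp
  let ?g = "\<lambda>s. \<integral>\<^sup>+\<omega>. \<Phi> (\<lambda>t. Y \<omega> t / s) \<partial>M"
  have mg: "?g \<in> borel_measurable scales"
    using borel_measurable_nn_integral_fst[OF measurable_compose[OF measurable_rescaled_field[OF mY] \<Phi>]] by simp
  have "(\<integral>\<^sup>+f. \<Phi> f \<partial>exponent_measure M (\<lambda>\<omega> t. Y \<omega> t / b)) = (\<integral>\<^sup>+s. ?g (b * s) \<partial>scales)"
    by (simp add: nn_integral_exponent_measure[OF sigma_finite_measure_axioms mYb \<Phi>] nn_integral_restrict_space)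
  also have "\<dots> = ennreal (1 / b) * (ennreal b * (\<integral>\<^sup>+s. ?g (b * s) \<partial>scales))"
    using b by (simp add: mult.assoc[symmetric] ennreal_mult'[symmetric])
  also have "ennreal b * (\<integral>\<^sup>+s. ?g (b * s) \<partial>scales) = (\<integral>\<^sup>+s. ?g s \<partial>scales)"
    by (rule nn_integral_scales_mult[OF b measurable_scales_indicator[OF mg]])
  also have "\<dots> = (\<integral>\<^sup>+f. \<Phi> f \<partial>exponent_measure M Y)"
    by (simp add: nn_integral_exponent_measure[OF sigma_finite_measure_axioms mY \<Phi>] nn_integral_restrict_space)
  finally show ?thesis .
qed

lemma emeasure_exponent_measure_rescale:
  assumes "prob_space M" and mY: "Y \<in> M \<rightarrow>\<^sub>M cadlag_algebra" and b: "0 < b" and A: "A \<in> sets cadlag_algebra"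
  shows "emeasure (exponent_measure M (\<lambda>\<omega> t. Y \<omega> t / b)) A = ennreal (1 / b) * emeasure (exponent_measure M Y) A"
  using nn_integral_exponent_measure_rescale[OF assms(1-3) borel_measurable_indicator[OF A]] A by simp

lemma mesh_power: "(if \<delta> = 0 then 1 else \<delta> ^ n) = mesh \<delta> ^ n"
  by (simp add: mesh_def)

lemma berman_mean_eq:
  fixes Y :: "'w \<Rightarrow> real ^ 'd::finite \<Rightarrow> real"
  assumes "prob_space M" "complete_measure M" and \<delta>: "0 \<le> \<delta>" and Y: "cadlag_field M Y"
  shows "berman_mean M Y \<delta> x T
    = emeasure (exponent_measure M (\<lambda>\<omega>. cadlag_part (Y \<omega>))) (exceed_event \<delta> x (cube T)) / ennreal (T ^ CARD('d))"
proof -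
  interpret C: complete_measure M by fact
  have "(\<integral>\<^sup>+s\<in>{0..}. ennreal (\<P>(\<omega> in M. excursion \<delta> (cube T) (Y \<omega>) s > ennreal x)) \<partial>lborel)
      = (\<integral>\<^sup>+s\<in>{0..}. ennreal (\<P>(\<omega> in M. excursion \<delta> (cube T) (cadlag_part (Y \<omega>)) s > ennreal x)) \<partial>lborel)"
    using C.measurable_cadlag_part(2)[OF Y] by (intro C.excursion_integral_cong, eventually_elim) simp
  then show ?thesis unfolding berman_mean_def
    by (simp only: emeasure_exponent_excursion[OF assms(1) C.measurable_cadlag_part(1)[OF Y] \<delta> sets_cube])
qed

text \<open>On the grid, the translated pattern is a spectral field of the same max-stable field as \<open>Z\<close>. To
  compare exponent measures on the path space, both fields are extended from the grid by rounding, which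
  commutes with translations by grid points and does not change the excursions. The limit is then that of
  \<open>translated_pattern_limit\<close>, and its factor \<open>(1 / mesh \<delta>)\<^sup>d\<close> is what rescaling \<open>Qb\<close> to \<open>Q\<close> gives.\<close>

theorem dissipative_limit:
  fixes Z Q :: "'w \<Rightarrow> real ^ 'd::finite \<Rightarrow> real"
  assumes "prob_space M" and "complete_measure M" and Z: "spectral_field M (\<lambda>\<omega>. cadlag_part (Z \<omega>)) \<delta>"
    and Zc: "cadlag_field M Z" and Q: "is_Q M Z \<delta> Q"
  shows "(berman_mean M Z \<delta> x \<longlongrightarrow>
      (\<integral>\<^sup>+s\<in>{0..}. ennreal (\<P>(\<omega> in M. excursion \<delta> UNIV (Q \<omega>) s > ennreal x)) \<partial>lborel)) at_top"
    and "(\<integral>\<^sup>+s\<in>{0..}. ennreal (\<P>(\<omega> in M. excursion \<delta> UNIV (Q \<omega>) s > ennreal x)) \<partial>lborel) < \<infinity>"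
proof -
  interpret M: prob_space M by fact
  interpret C: complete_measure M by fact
  let ?Z = "\<lambda>\<omega>. cadlag_part (Z \<omega>)"
  interpret Z: spectral_field M ?Z \<delta> by fact
  note \<delta> = Z.\<delta>
  note mZ = C.measurable_cadlag_part(1)[OF Zc] and ae_Z = C.measurable_cadlag_part(2)[OF Zc]
  from Q obtain T p Qb where
      dist: "distributed M (grid_ref \<delta>) T (\<lambda>s. ennreal (p s))"
    and pos: "\<And>s. s \<in> grid \<delta> \<Longrightarrow> 0 < p s"
    and cont: "\<delta> = 0 \<Longrightarrow> continuous_on UNIV p"
    and rf: "random_field M (grid \<delta>) Qb"
    and nn: "AE \<omega> in M. \<forall>t\<in>grid \<delta>. 0 \<le> Qb \<omega> t"
    and cl: "\<delta> = 0 \<Longrightarrow> AE \<omega> in M. Qb \<omega> \<in> cadlag"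
    and ind: "M.indep_set
         {(\<lambda>\<omega>. restrict (Qb \<omega>) (grid \<delta>)) -` A \<inter> space M | A. A \<in> sets (PiM (grid \<delta>) (\<lambda>_. borel))}
         {T -` B \<inter> space M | B. B \<in> sets (grid_ref \<delta>)}"
    and spec: "spectral_field_on M Z (grid \<delta>) (\<lambda>\<omega> t. Qb \<omega> (t - T \<omega>) / p (T \<omega>))"
    and Q_eq: "Q = (\<lambda>\<omega> t. Qb \<omega> t / mesh \<delta> ^ CARD('d))"
    unfolding is_Q_def Let_def grid_ref_def[symmetric] mesh_power by blast
  have mT: "T \<in> M \<rightarrow>\<^sub>M grid_ref \<delta>" and T_law: "distr M (grid_ref \<delta>) T = density (grid_ref \<delta>) (\<lambda>s. ennreal (p s))"
    using dist by (auto simp: distributed_def)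
  have T_grid: "T \<omega> \<in> grid \<delta>" if "\<omega> \<in> space M" for \<omega> using measurable_space[OF mT that] by (simp add: space_grid_ref)
  have mp: "p \<in> borel_measurable (grid_ref \<delta>)"
  proof (cases "\<delta> = 0")
    case True
    have "p \<in> borel_measurable borel" using cont[OF True] by (rule borel_measurable_continuous_onI)
    then show ?thesis using True by (simp add: grid_ref_def)
  qed (simp add: grid_ref_def)
  let ?r = "grid_round \<delta> :: real ^ 'd \<Rightarrow> real ^ 'd"
  have Qr: "cadlag_field M (\<lambda>\<omega> t. Qb \<omega> (?r t))"
    unfolding cadlag_field_def
  proof
    show "random_field M UNIV (\<lambda>\<omega> t. Qb \<omega> (?r t))" using rf grid_round_in_grid by (auto simp: random_field_def)
    show "AE \<omega> in M. (\<lambda>t. Qb \<omega> (?r t)) \<in> cadlag"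
    proof (cases "\<delta> = 0")
      case True
      then show ?thesis using cl by (simp add: grid_round_def)
    next
      case False
      then have "0 < \<delta>" using \<delta> by simp
      from nn show ?thesis by eventually_elim (auto intro: cadlag_grid_round[OF \<open>0 < \<delta>\<close>])
    qed
  qed
  define Qc where "Qc \<omega> = cadlag_part (\<lambda>t. Qb \<omega> (?r t))" for \<omega>
  have mQ: "Qc \<in> M \<rightarrow>\<^sub>M cadlag_algebra" and ae_Q: "AE \<omega> in M. Qc \<omega> = (\<lambda>t. Qb \<omega> (?r t))"
    unfolding Qc_def[abs_def] by (rule C.measurable_cadlag_part[OF Qr])+
  have r_idem: "?r (?r t) = ?r t" for t by (rule grid_round_grid[OF \<delta> grid_round_in_grid])
  have Qc_r: "Qc \<omega> (?r t) = Qc \<omega> t" for \<omega> t by (simp add: Qc_def cadlag_part_def r_idem)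
  have ae_Qg: "AE \<omega> in M. \<forall>t\<in>grid \<delta>. Qb \<omega> t = Qc \<omega> t"
    using ae_Q by eventually_elim (simp add: grid_round_grid[OF \<delta>])
  \<comment> \<open>The event \<open>Qc \<in> A\<close> depends on the values of \<open>Qb\<close> on the grid only, of which \<open>T\<close> is independent.\<close>
  have joint: "distr M (grid_ref \<delta> \<Otimes>\<^sub>M cadlag_algebra) (\<lambda>\<omega>. (T \<omega>, Qc \<omega>))
      = density (grid_ref \<delta>) (\<lambda>s. ennreal (p s)) \<Otimes>\<^sub>M distr M cadlag_algebra Qc"
    unfolding T_law[symmetric]
  proof (rule pair_measure_eqI[symmetric])
    show "sigma_finite_measure (distr M (grid_ref \<delta>) T)" "sigma_finite_measure (distr M cadlag_algebra Qc)"
      by (rule prob_space_imp_sigma_finite[OF M.prob_space_distr[OF mT]],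
          rule prob_space_imp_sigma_finite[OF M.prob_space_distr[OF mQ]])
    show "sets (distr M (grid_ref \<delta>) T \<Otimes>\<^sub>M distr M cadlag_algebra Qc)
        = sets (distr M (grid_ref \<delta> \<Otimes>\<^sub>M cadlag_algebra) (\<lambda>\<omega>. (T \<omega>, Qc \<omega>)))"
      by (simp cong: sets_pair_measure_cong)
    fix B A assume "B \<in> sets (distr M (grid_ref \<delta>) T)" "A \<in> sets (distr M cadlag_algebra Qc)"
    then have B: "B \<in> sets (grid_ref \<delta>)" and A: "A \<in> sets cadlag_algebra" by simp_all
    from A obtain A' where A': "A' \<in> sets (PiM UNIV (\<lambda>_. borel))" "A = A' \<inter> cadlag"
      unfolding cadlag_algebra_def sets_restrict_space by (auto simp: Int_commute)
    let ?\<phi> = "\<lambda>g t. g (?r t) :: real"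
    have m\<phi>: "?\<phi> \<in> PiM (grid \<delta>) (\<lambda>_. borel) \<rightarrow>\<^sub>M PiM UNIV (\<lambda>_. borel)"
      using grid_round_in_grid by (intro measurable_PiM_single') (auto intro: measurable_component_singleton)
    let ?A = "?\<phi> -` A' \<inter> space (PiM (grid \<delta>) (\<lambda>_. borel))"
    have sA: "?A \<in> sets (PiM (grid \<delta>) (\<lambda>_. borel))" by (rule measurable_sets[OF m\<phi> A'(1)])
    have ev: "AE \<omega> in M. Qc \<omega> \<in> A \<longleftrightarrow> restrict (Qb \<omega>) (grid \<delta>) \<in> ?A"
      using ae_Q AE_space
    proof eventually_elim
      case (elim \<omega>)
      have "Qc \<omega> \<in> cadlag" by (simp add: Qc_def cadlag_part_def)
      then show ?case using elim by (simp add: A'(2) grid_round_in_grid space_PiM)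
    qed
    have prod: "M.prob ({\<omega>\<in>space M. restrict (Qb \<omega>) (grid \<delta>) \<in> ?A} \<inter> {\<omega>\<in>space M. T \<omega> \<in> B})
        = M.prob {\<omega>\<in>space M. restrict (Qb \<omega>) (grid \<delta>) \<in> ?A} * M.prob {\<omega>\<in>space M. T \<omega> \<in> B}"
      by (rule M.indep_setD[OF ind]) (use sA B in \<open>auto simp: vimage_def Int_def conj_commute\<close>)
    have 1: "M.prob {\<omega>\<in>space M. Qc \<omega> \<in> A} = M.prob {\<omega>\<in>space M. restrict (Qb \<omega>) (grid \<delta>) \<in> ?A}"
      using ev by (intro C.measure_cong_AE_complete)
    have 2: "M.prob {\<omega>\<in>space M. T \<omega> \<in> B \<and> Qc \<omega> \<in> A}
        = M.prob ({\<omega>\<in>space M. restrict (Qb \<omega>) (grid \<delta>) \<in> ?A} \<inter> {\<omega>\<in>space M. T \<omega> \<in> B})"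
    proof -
      have "M.prob {\<omega>\<in>space M. T \<omega> \<in> B \<and> Qc \<omega> \<in> A}
          = M.prob {\<omega>\<in>space M. T \<omega> \<in> B \<and> restrict (Qb \<omega>) (grid \<delta>) \<in> ?A}"
        using ev by (intro C.measure_cong_AE_complete, eventually_elim) blast
      then show ?thesis by (simp only: Int_def mem_Collect_eq conj_ac) (metis (no_types, lifting))
    qed
    have "emeasure (distr M (grid_ref \<delta>) T) B * emeasure (distr M cadlag_algebra Qc) A
        = ennreal (M.prob {\<omega>\<in>space M. T \<omega> \<in> B}) * ennreal (M.prob {\<omega>\<in>space M. Qc \<omega> \<in> A})"
      using A B by (simp add: emeasure_distr[OF mT] emeasure_distr[OF mQ] M.emeasure_eq_measure vimage_def Int_def conj_commute)
    also have "\<dots> = ennreal (M.prob {\<omega>\<in>space M. T \<omega> \<in> B \<and> Qc \<omega> \<in> A})"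
      unfolding 2 prod 1 by (simp add: ennreal_mult'[symmetric] mult.commute)
    also have "\<dots> = emeasure (distr M (grid_ref \<delta> \<Otimes>\<^sub>M cadlag_algebra) (\<lambda>\<omega>. (T \<omega>, Qc \<omega>))) (B \<times> A)"
      using A B by (simp add: emeasure_distr[OF measurable_Pair[OF mT mQ]] M.emeasure_eq_measure vimage_def Int_def conj_ac)
    finally show "emeasure (distr M (grid_ref \<delta>) T) B * emeasure (distr M cadlag_algebra Qc) A
        = emeasure (distr M (grid_ref \<delta> \<Otimes>\<^sub>M cadlag_algebra) (\<lambda>\<omega>. (T \<omega>, Qc \<omega>))) (B \<times> A)" .
  qed
  let ?Y = "\<lambda>\<omega> t. Qc \<omega> (t - T \<omega>) / p (T \<omega>)"
  have mY: "?Y \<in> M \<rightarrow>\<^sub>M cadlag_algebra"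
  proof (rule measurable_translated_rescaled[OF mQ])
    show "T \<in> M \<rightarrow>\<^sub>M borel" using measurable_compose[OF mT measurable_grid_ref_ident] by simp
    show "(\<lambda>\<omega>. p (T \<omega>)) \<in> borel_measurable M" by (rule measurable_compose[OF mT mp])
    show "0 \<le> p (T \<omega>)" if "\<omega> \<in> space M" for \<omega> using pos[OF T_grid[OF that]] by simp
  qed
  have ae_Y: "AE \<omega> in M. \<forall>t\<in>grid \<delta>. Qb \<omega> (t - T \<omega>) / p (T \<omega>) = ?Y \<omega> t"
    using ae_Qg AE_space by eventually_elim (simp add: grid_diff[OF \<delta> _ T_grid])
  have rfY: "random_field M (grid \<delta>) (\<lambda>\<omega> t. Qb \<omega> (t - T \<omega>) / p (T \<omega>))"
    unfolding random_field_def
  proof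
    fix t :: "real ^ 'd" assume t: "t \<in> grid \<delta>"
    show "(\<lambda>\<omega>. Qb \<omega> (t - T \<omega>) / p (T \<omega>)) \<in> borel_measurable M"
    proof (rule C.measurable_cong_AE_complete[OF _ measurable_cadlag_apply[OF mY]])
      show "AE \<omega> in M. Qb \<omega> (t - T \<omega>) / p (T \<omega>) = ?Y \<omega> t" using ae_Y by eventually_elim (use t in blast)
    qed simp
  qed
  have rfZ: "random_field M (grid \<delta>) Z" using Zc by (simp add: cadlag_field_def random_field_def)
  let ?Zr = "\<lambda>\<omega> t. ?Z \<omega> (?r t)"
  have Y_r: "?Y \<omega> (?r t) = ?Y \<omega> t" if "\<omega> \<in> space M" for \<omega> t
    using Qc_r[of \<omega> "t - T \<omega>"] by (simp add: grid_round_diff[OF \<delta> T_grid[OF that]])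
  have mZr: "?Zr \<in> M \<rightarrow>\<^sub>M cadlag_algebra"
  proof (rule measurable_cadlag_algebraI)
    show "(\<lambda>\<omega>. ?Z \<omega> (?r t)) \<in> borel_measurable M" for t by (rule measurable_cadlag_apply[OF mZ])
    show "(\<lambda>t. ?Z \<omega> (?r t)) \<in> cadlag" if "\<omega> \<in> space M" for \<omega>
    proof (cases "\<delta> = 0")
      case True
      then show ?thesis using measurable_space[OF mZ that] by (simp add: grid_round_def)
    next
      case False
      then have "0 < \<delta>" using \<delta> by simp
      moreover have "?Z \<omega> \<in> cadlag" using measurable_space[OF mZ that] by simp
      ultimately show ?thesis by (intro cadlag_grid_round cadlag_nonneg)
    qed
  qed
  have exponents: "(\<integral>\<^sup>+\<omega>. (SUP (t, x)\<in>P. ennreal (?Y \<omega> t / x)) \<partial>M) = (\<integral>\<^sup>+\<omega>. (SUP (t, x)\<in>P. ennreal (?Zr \<omega> t / x)) \<partial>M)"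
    if P: "finite P" "P \<subseteq> UNIV \<times> {0<..}" for P
  proof -
    let ?P = "(\<lambda>(t, x). (?r t, x)) ` P"
    have "(\<integral>\<^sup>+\<omega>. (SUP (t, x)\<in>P. ennreal (?Y \<omega> t / x)) \<partial>M) = (\<integral>\<^sup>+\<omega>. (SUP (t, x)\<in>?P. ennreal (?Y \<omega> t / x)) \<partial>M)"
      by (intro nn_integral_cong) (simp only: image_image case_prod_unfold fst_conv snd_conv Y_r)
    also have "\<dots> = (\<integral>\<^sup>+\<omega>. (SUP (t, x)\<in>?P. ennreal (Qb \<omega> (t - T \<omega>) / p (T \<omega>) / x)) \<partial>M)"
    proof (rule nn_integral_cong_AE)
      show "AE \<omega> in M. (SUP (t, x)\<in>?P. ennreal (?Y \<omega> t / x)) = (SUP (t, x)\<in>?P. ennreal (Qb \<omega> (t - T \<omega>) / p (T \<omega>) / x))"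
        using ae_Y by eventually_elim (intro SUP_cong, auto simp: grid_round_in_grid)
    qed
    also have "\<dots> = (\<integral>\<^sup>+\<omega>. (SUP (t, x)\<in>?P. ennreal (Z \<omega> t / x)) \<partial>M)"
      by (rule spectral_field_on_exponent[OF assms(1) rfY rfZ spec]) (use P in \<open>auto simp: grid_round_in_grid\<close>)
    also have "\<dots> = (\<integral>\<^sup>+\<omega>. (SUP (t, x)\<in>?P. ennreal (?Z \<omega> t / x)) \<partial>M)"
      using ae_Z by (intro nn_integral_cong_AE, eventually_elim) simp
    also have "\<dots> = (\<integral>\<^sup>+\<omega>. (SUP (t, x)\<in>P. ennreal (?Zr \<omega> t / x)) \<partial>M)"
      by (intro nn_integral_cong) (simp add: image_image case_prod_beta)
    finally show ?thesis .
  qed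
  have eq: "(\<integral>\<^sup>+f. \<Phi> f \<partial>exponent_measure M ?Zr) = (\<integral>\<^sup>+f. \<Phi> f \<partial>exponent_measure M ?Y)"
    if "\<Phi> \<in> borel_measurable cadlag_algebra" "\<Phi> (\<lambda>_. 0) = 0" for \<Phi>
    by (rule exponent_measure_eqI[symmetric, OF assms(1) mY mZr exponents _ that]) (simp_all add: Z.mean)
  have Zr_Z: "emeasure (exponent_measure M ?Zr) (exceed_event \<delta> y A)
      = emeasure (exponent_measure M ?Z) (exceed_event \<delta> y A)" if "A \<in> sets borel" for y A
    unfolding emeasure_exponent_excursion[OF assms(1) mZr \<delta> that, symmetric]
      emeasure_exponent_excursion[OF assms(1) mZ \<delta> that, symmetric]
    by (rule C.excursion_integral_cong) (simp add: grid_round_grid[OF \<delta>])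
  have fin: "emeasure (exponent_measure M ?Zr) {f\<in>cadlag. exceed_mass \<delta> (cell (mesh \<delta>) (\<lambda>_::'d. 0)) f \<noteq> 0} < \<infinity>"
  proof -
    have "emeasure (exponent_measure M ?Zr) {f\<in>cadlag. exceed_mass \<delta> (cell (mesh \<delta>) (\<lambda>_::'d. 0)) f \<noteq> 0}
        = emeasure (exponent_measure M ?Z) (exceed_event \<delta> 0 (cell (mesh \<delta>) (\<lambda>_::'d. 0)))"
      unfolding Zr_Z[OF sets_cell, symmetric] by (simp add: zero_less_iff_neq_zero)
    also have "\<dots> \<le> emeasure (exponent_measure M ?Z) {f\<in>cadlag. 1 < cell_sup (mesh \<delta>) (\<lambda>_::'d. 0) f}"
      using Z.exceed_mass_imp_cell_sup Z.sets_cell_sup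
      by (intro emeasure_mono) (auto simp: zero_less_iff_neq_zero)
    also have "\<dots> < \<infinity>" by (rule Z.exponent_cell_sup_finite)
    finally show ?thesis .
  qed
  have mean: "berman_mean M Z \<delta> x T = emeasure (exponent_measure M ?Zr) (exceed_event \<delta> x (cube T)) / ennreal (T ^ CARD('d))" for T
    by (simp only: berman_mean_eq[OF assms(1,2) \<delta> Zc] Zr_Z[OF sets_cube])
  have L: "0 < mesh \<delta> ^ CARD('d)" using mesh_pos[OF \<delta>] by simp
  let ?E = "exceed_event \<delta> x UNIV :: (real ^ 'd \<Rightarrow> real) set"
  have target: "(\<integral>\<^sup>+s\<in>{0..}. ennreal (\<P>(\<omega> in M. excursion \<delta> UNIV (Q \<omega>) s > ennreal x)) \<partial>lborel)
      = emeasure (exponent_measure M Qc) ?E * ennreal ((1 / mesh \<delta>) ^ CARD('d))"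
  proof -
    have mQL: "(\<lambda>\<omega> t. Qc \<omega> t / mesh \<delta> ^ CARD('d)) \<in> M \<rightarrow>\<^sub>M cadlag_algebra"
      using measurable_translated_rescaled[OF mQ, of "\<lambda>_. 0" "\<lambda>_. mesh \<delta> ^ CARD('d)"] L by simp
    have "(\<integral>\<^sup>+s\<in>{0..}. ennreal (\<P>(\<omega> in M. excursion \<delta> UNIV (Q \<omega>) s > ennreal x)) \<partial>lborel)
        = (\<integral>\<^sup>+s\<in>{0..}. ennreal (\<P>(\<omega> in M. excursion \<delta> UNIV (\<lambda>t. Qc \<omega> t / mesh \<delta> ^ CARD('d)) s > ennreal x)) \<partial>lborel)"
      using ae_Qg by (intro C.excursion_integral_cong, eventually_elim) (simp add: Q_eq)
    also have "\<dots> = emeasure (exponent_measure M (\<lambda>\<omega> t. Qc \<omega> t / mesh \<delta> ^ CARD('d))) ?E"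
      by (rule emeasure_exponent_excursion[OF assms(1) mQL \<delta>]) simp
    also have "\<dots> = ennreal (1 / mesh \<delta> ^ CARD('d)) * emeasure (exponent_measure M Qc) ?E"
      by (rule emeasure_exponent_measure_rescale[OF assms(1) mQ L sets_exceed_event[OF \<delta>]]) simp
    finally show ?thesis by (simp add: power_divide mult.commute)
  qed
  note lim = translated_pattern_limit[OF assms(1) mQ \<delta> mT mp pos joint _ fin, of x]
  show "(berman_mean M Z \<delta> x \<longlongrightarrow>
      (\<integral>\<^sup>+s\<in>{0..}. ennreal (\<P>(\<omega> in M. excursion \<delta> UNIV (Q \<omega>) s > ennreal x)) \<partial>lborel)) at_top"
    unfolding target mean[abs_def] using lim(1) eq by blast
  have "emeasure (exponent_measure M Qc) ?E < \<infinity>" using lim(2) eq by blast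
  then show "(\<integral>\<^sup>+s\<in>{0..}. ennreal (\<P>(\<omega> in M. excursion \<delta> UNIV (Q \<omega>) s > ennreal x)) \<partial>lborel) < \<infinity>"
    unfolding target by (simp add: ennreal_mult_less_top)
qed

section \<open>Conditioning on finite mass\<close>

context spectral_field
begin

lemma finite_mass_rescale_iff:
  "f \<in> cadlag \<Longrightarrow> 0 < s \<Longrightarrow> (\<lambda>t. f t / s) \<in> finite_mass \<longleftrightarrow> f \<in> finite_mass"
  by (simp add: finite_mass_def cadlag_divide total_mass_rescale_top less_top[symmetric])

lemma exceed_limit:
  obtains l where "l < \<infinity>"
    "((\<lambda>T. emeasure \<nu> (exceed_event \<delta> x (cube T) \<inter> finite_mass) / ennreal (T ^ CARD('d))) \<longlongrightarrow> l) at_top"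
    "((\<lambda>T. emeasure \<nu> (exceed_event \<delta> x (cube T)) / ennreal (T ^ CARD('d))) \<longlongrightarrow> l) at_top"
proof -
  let ?E = "\<lambda>T. exceed_event \<delta> x (cube T)"
  obtain l where l: "l < \<infinity>"
    "((\<lambda>T. emeasure \<nu> (?E T \<inter> finite_mass) / ennreal (T ^ CARD('d))) \<longlongrightarrow> l) at_top"
    by (rule finite_mass_limit[of x])
  have inf: "{f\<in>infinite_mass. ennreal x < exceed_mass \<delta> (cube T) f} = ?E T \<inter> infinite_mass" for T
    by (auto simp: infinite_mass_def)
  have sE: "?E T \<in> sets \<nu>" for T using sets_exceed_event[OF \<delta> sets_cube] by simp
  have split: "emeasure \<nu> (?E T) = emeasure \<nu> (?E T \<inter> finite_mass) + emeasure \<nu> (?E T \<inter> infinite_mass)" for T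
  proof -
    have union: "(?E T \<inter> finite_mass) \<union> (?E T \<inter> infinite_mass) = ?E T"
      by (auto simp: finite_mass_def infinite_mass_def less_top)
    have "?E T \<inter> finite_mass \<in> sets \<nu>" "?E T \<inter> infinite_mass \<in> sets \<nu>"
      by (rule sets.Int[OF sE], simp add: sets_finite_mass, rule sets.Int[OF sE], simp add: sets_infinite_mass)
    moreover have "(?E T \<inter> finite_mass) \<inter> (?E T \<inter> infinite_mass) = {}"
      by (auto simp: finite_mass_def infinite_mass_def)
    ultimately have "emeasure \<nu> (?E T \<inter> finite_mass) + emeasure \<nu> (?E T \<inter> infinite_mass)
        = emeasure \<nu> ((?E T \<inter> finite_mass) \<union> (?E T \<inter> infinite_mass))" by (rule plus_emeasure)
    then show ?thesis by (simp only: union)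
  qed
  have "((\<lambda>T. emeasure \<nu> (?E T \<inter> finite_mass) / ennreal (T ^ CARD('d)) + emeasure \<nu> (?E T \<inter> infinite_mass) / ennreal (T ^ CARD('d)))
      \<longlongrightarrow> l + 0) at_top"
    using l(2) infinite_mass_limit[of x] unfolding inf by (rule tendsto_add)
  then have "((\<lambda>T. emeasure \<nu> (?E T) / ennreal (T ^ CARD('d))) \<longlongrightarrow> l) at_top"
    unfolding split by (simp add: add_divide_distrib_ennreal)
  with l show ?thesis by (rule that)
qed

text \<open>By stationarity the \<open>\<nu>\<close>-measure of the paths of finite mass that exceed level 1 at \<open>t\<close> does not depend
  on \<open>t\<close>, and it is the mean of \<open>Z t\<close> on the event of finite mass; were
  it zero, then almost every path of finite mass would vanish at all rational points.\<close>

lemma size_biased_finite_mass_pos: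
  assumes nz: "AE \<omega> in M. Z \<omega> \<noteq> (\<lambda>_. 0)" and P: "prob {\<omega>\<in>space M. Z \<omega> \<in> finite_mass} > 0"
  shows "0 < (\<integral>\<^sup>+\<omega>. ennreal (Z \<omega> 0) * indicator finite_mass (Z \<omega>) \<partial>M)"
proof (rule ccontr)
  let ?W = "\<lambda>t \<omega>. ennreal (Z \<omega> t) * indicator finite_mass (Z \<omega>)"
  assume "\<not> ?thesis"
  then have 0: "(\<integral>\<^sup>+\<omega>. ?W 0 \<omega> \<partial>M) = 0" by simp
  let ?A = "\<lambda>t. {f\<in>finite_mass. 1 < f t}"
  have sA: "?A t \<in> sets cadlag_algebra" for t :: "real ^ 'd"
  proof -
    have [measurable]: "(\<lambda>f. f t) \<in> borel_measurable (cadlag_algebra :: (real ^ 'd \<Rightarrow> real) measure)" by (rule measurable_cadlag_eval)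
    have "{f\<in>space (cadlag_algebra :: (real ^ 'd \<Rightarrow> real) measure). 1 < f t} \<in> sets cadlag_algebra" by measurable
    from sets.Int[OF sets_finite_mass this] show ?thesis
      by (simp add: Int_def finite_mass_def conj_ac)
  qed
  have mW: "?W t \<in> borel_measurable M" for t
  proof (rule borel_measurable_times_ennreal)
    show "(\<lambda>\<omega>. ennreal (Z \<omega> t)) \<in> borel_measurable M"
      by (rule measurable_compose[OF measurable_cadlag_apply[OF mZ] measurable_ennreal])
    show "(\<lambda>\<omega>. indicator finite_mass (Z \<omega>) :: ennreal) \<in> borel_measurable M"
      by (rule measurable_compose[OF mZ borel_measurable_indicator[OF sets_finite_mass]])
  qed
  have level: "emeasure \<nu> (?A t) = (\<integral>\<^sup>+\<omega>. ?W t \<omega> \<partial>M)" for t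
  proof -
    have "emeasure \<nu> (?A t) = (\<integral>\<^sup>+s\<in>{0<..}. emeasure M {\<omega>\<in>space M. (\<lambda>u. Z \<omega> u / s) \<in> ?A t} \<partial>lborel)"
      by (rule emeasure_exponent_measure[OF sigma_finite_measure_axioms mZ sA])
    also have "\<dots> = (\<integral>\<^sup>+s\<in>{0<..}. emeasure M {\<omega>\<in>space M. ennreal s < ?W t \<omega>} \<partial>lborel)"
    proof (rule nn_integral_cong)
      fix s :: real
      have "{\<omega>\<in>space M. (\<lambda>u. Z \<omega> u / s) \<in> ?A t} = {\<omega>\<in>space M. ennreal s < ?W t \<omega>}" if s: "0 < s"
      proof (intro Collect_cong conj_cong refl)
        fix \<omega> assume "\<omega> \<in> space M"
        then have f: "Z \<omega> \<in> cadlag" by (rule Z_cadlag)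
        show "((\<lambda>u. Z \<omega> u / s) \<in> ?A t) = (ennreal s < ?W t \<omega>)"
          using s by (auto simp: finite_mass_rescale_iff[OF f s] indicator_def ennreal_less_iff pos_less_divide_eq)
      qed
      then show "emeasure M {\<omega>\<in>space M. (\<lambda>u. Z \<omega> u / s) \<in> ?A t} * indicator {0<..} s
          = emeasure M {\<omega>\<in>space M. ennreal s < ?W t \<omega>} * indicator {0<..} s"
        by (cases "0 < s") simp_all
    qed
    also have "\<dots> = (\<integral>\<^sup>+\<omega>. ?W t \<omega> \<partial>M)" by (rule layer_cake[OF mW])
    finally show ?thesis .
  qed
  have "(\<integral>\<^sup>+\<omega>. ?W t \<omega> \<partial>M) = 0" for t
  proof -
    have "(\<integral>\<^sup>+\<omega>. ?W t \<omega> \<partial>M) = (\<integral>\<^sup>+f. indicator (?A t) f \<partial>\<nu>)"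
      unfolding level[symmetric] using sA by (intro nn_integral_indicator[symmetric]) simp
    also have "\<dots> = (\<integral>\<^sup>+f. indicator (?A t) (\<lambda>u. f (u - t)) \<partial>\<nu>)"
      by (rule exponent_shift[symmetric, OF borel_measurable_indicator[OF sA]]) (simp add: indicator_def)
    also have "\<dots> = (\<integral>\<^sup>+f. indicator (?A 0) f \<partial>\<nu>)"
      by (intro nn_integral_cong) (simp add: indicator_def finite_mass_def cadlag_shift total_mass_shift)
    also have "\<dots> = emeasure \<nu> (?A 0)" using sA by (intro nn_integral_indicator) simp
    finally show ?thesis by (simp only: level 0)
  qed
  then have "AE \<omega> in M. ?W t \<omega> = 0" for t by (subst (asm) nn_integral_0_iff_AE[OF mW]) simp
  then have "AE \<omega> in M. \<forall>t\<in>rat_points. ?W t \<omega> = 0"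
    by (subst AE_ball_countable[OF countable_rat_points]) blast
  then have "AE \<omega> in M. Z \<omega> \<notin> finite_mass" using nz AE_space
  proof eventually_elim
    case (elim \<omega>)
    note f = Z_cadlag[OF elim(3)]
    show ?case
    proof
      assume F: "Z \<omega> \<in> finite_mass"
      have "Z \<omega> t = 0" if "t \<in> rat_points" for t
        using elim(1) that F cadlag_nonneg[OF f, of t] by (auto simp: ennreal_eq_0_iff)
      then show False using cadlag_eq_zeroI[OF f] elim(2) by blast
    qed
  qed
  moreover have "{\<omega>\<in>space M. Z \<omega> \<in> finite_mass} \<in> sets M"
    using measurable_sets[OF mZ sets_finite_mass] by (simp add: vimage_def Int_def conj_commute)
  ultimately have "prob {\<omega>\<in>space M. Z \<omega> \<in> finite_mass} = 0"
    by (subst prob_eq_0) auto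
  with P show False by simp
qed

end

text \<open>Let \<open>\<theta> = E(Z 0; S\<^sub>0 < \<infinity>)\<close>. Finiteness of the mass does not depend on the scale of a path, so \<open>\<theta>\<close> is the
  probability that \<open>\<Theta>\<close> has finite mass. Conditioning divides by the probability \<open>q\<close> of finite mass and the
  normalisation of \<open>V\<close> multiplies paths, hence exponent measures, by \<open>q / \<theta>\<close>; so the exponent measure of \<open>V\<close>
  is that of \<open>Z\<close> on the paths of finite mass divided by \<open>\<theta>\<close>. Both therefore have the same limit up to \<open>\<theta>\<close>,
  as the paths of infinite mass contribute nothing to the one of \<open>Z\<close>.\<close>

theorem conditioned_limit:
  fixes Z V \<Theta> :: "'w \<Rightarrow> real ^ 'd::finite \<Rightarrow> real"
  assumes "prob_space M" and "complete_measure M" and Z: "spectral_field M (\<lambda>\<omega>. cadlag_part (Z \<omega>)) \<delta>"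
    and Zc: "cadlag_field M Z" and nz: "AE \<omega> in M. Z \<omega> \<noteq> (\<lambda>_. 0)"
    and P: "\<P>(\<omega> in M. total_mass 0 (Z \<omega>) < \<infinity>) > 0"
    and \<Theta>: "is_Theta M Z \<Theta>" and V: "is_V M Z V"
  obtains b where "(berman_mean M V \<delta> x \<longlongrightarrow> b) at_top"
    "(berman_mean M Z \<delta> x \<longlongrightarrow> ennreal (\<P>(\<omega> in M. total_mass 0 (\<Theta> \<omega>) < \<infinity>)) * b) at_top"
    "ennreal (\<P>(\<omega> in M. total_mass 0 (\<Theta> \<omega>) < \<infinity>)) * b < \<infinity>"
proof -
  interpret M: prob_space M by fact
  interpret C: complete_measure M by fact
  let ?Z = "\<lambda>\<omega>. cadlag_part (Z \<omega>)"
  interpret Z: spectral_field M ?Z \<delta> by fact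
  note \<delta> = Z.\<delta>
  note mZ = C.measurable_cadlag_part(1)[OF Zc] and ae_Z = C.measurable_cadlag_part(2)[OF Zc]
  let ?F = "finite_mass :: (real ^ 'd \<Rightarrow> real) set"
  have F_iff: "AE \<omega> in M. (total_mass 0 (Z \<omega>) < \<infinity>) = (?Z \<omega> \<in> ?F)"
    using ae_Z AE_space
  proof eventually_elim
    case (elim \<omega>)
    show ?case using elim(1) Z.Z_cadlag[OF elim(2)] by (simp add: finite_mass_def)
  qed
  define q where "q = \<P>(\<omega> in M. total_mass 0 (Z \<omega>) < \<infinity>)"
  have q: "q = \<P>(\<omega> in M. ?Z \<omega> \<in> ?F)" unfolding q_def by (rule C.measure_cong_AE_complete[OF F_iff])
  have q0: "0 < q" using P by (simp add: q_def)
  define g where "g \<omega> = ?Z \<omega> 0 * indicator ?F (?Z \<omega>)" for \<omega>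
  have mg: "g \<in> borel_measurable M"
    unfolding g_def[abs_def]
    by (intro borel_measurable_times measurable_cadlag_apply[OF mZ] measurable_compose[OF mZ borel_measurable_indicator[OF sets_finite_mass]])
  have g0: "0 \<le> g \<omega>" if "\<omega> \<in> space M" for \<omega>
    using cadlag_nonneg[OF Z.Z_cadlag[OF that]] by (simp add: g_def)
  have gnn: "(\<integral>\<^sup>+\<omega>. ennreal (g \<omega>) \<partial>M) = (\<integral>\<^sup>+\<omega>. ennreal (?Z \<omega> 0) * indicator ?F (?Z \<omega>) \<partial>M)"
    by (intro nn_integral_cong) (simp add: g_def indicator_def)
  have gfin: "(\<integral>\<^sup>+\<omega>. ennreal (g \<omega>) \<partial>M) < \<infinity>"
  proof -
    have "(\<integral>\<^sup>+\<omega>. ennreal (g \<omega>) \<partial>M) \<le> (\<integral>\<^sup>+\<omega>. ennreal (?Z \<omega> 0) \<partial>M)"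
      unfolding gnn by (intro nn_integral_mono) (simp add: indicator_def)
    also have "\<dots> < \<infinity>" by (simp add: Z.mean)
    finally show ?thesis .
  qed
  define \<theta> where "\<theta> = (\<integral>\<omega>. g \<omega> \<partial>M)"
  have "integrable M g"
    using mg gfin g0 by (intro integrableI_nonneg) (auto intro: AE_I2)
  then have \<theta>_nn: "ennreal \<theta> = (\<integral>\<^sup>+\<omega>. ennreal (g \<omega>) \<partial>M)"
    unfolding \<theta>_def using g0 by (intro nn_integral_eq_integral[symmetric]) (auto intro: AE_I2)
  have nz': "AE \<omega> in M. ?Z \<omega> \<noteq> (\<lambda>_. 0)" using nz ae_Z by eventually_elim simp
  have "0 < ennreal \<theta>"
    unfolding \<theta>_nn gnn by (rule Z.size_biased_finite_mass_pos[OF nz']) (use q0 q in simp)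
  then have \<theta>: "0 < \<theta>" by simp
  have mean_F: "(\<integral>\<omega>. Z \<omega> 0 * indicator {\<omega>. total_mass 0 (Z \<omega>) < \<infinity>} \<omega> \<partial>M) = \<theta>"
  proof -
    have ae: "AE \<omega> in M. Z \<omega> 0 * indicator {\<omega>. total_mass 0 (Z \<omega>) < \<infinity>} \<omega> = g \<omega>"
      using ae_Z F_iff by eventually_elim (simp add: g_def indicator_def)
    have "(\<lambda>\<omega>. Z \<omega> 0 * indicator {\<omega>. total_mass 0 (Z \<omega>) < \<infinity>} \<omega>) \<in> borel_measurable M"
      by (rule C.measurable_cong_AE_complete[OF ae mg]) simp
    then show ?thesis unfolding \<theta>_def using mg ae by (rule integral_cong_AE)
  qed
  have Theta: "\<P>(\<omega> in M. total_mass 0 (\<Theta> \<omega>) < \<infinity>) = \<theta>"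
  proof -
    have T1: "AE \<omega> in M. \<Theta> \<omega> \<in> cadlag" using \<Theta> by (simp add: is_Theta_def cadlag_field_def)
    have "\<P>(\<omega> in M. total_mass 0 (\<Theta> \<omega>) < \<infinity>) = \<P>(\<omega> in M. \<Theta> \<omega> \<in> ?F)"
      using T1 by (intro C.measure_cong_AE_complete, eventually_elim) (simp add: finite_mass_def)
    also have "\<dots> = (\<integral>\<omega>. Z \<omega> 0 * indicator ?F (\<lambda>t. Z \<omega> t / Z \<omega> 0) \<partial>M)"
      using \<Theta> sets_finite_mass unfolding is_Theta_def by blast
    also have "\<dots> = \<theta>"
    proof -
      have ae: "AE \<omega> in M. Z \<omega> 0 * indicator ?F (\<lambda>t. Z \<omega> t / Z \<omega> 0) = g \<omega>"
        using ae_Z AE_space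
      proof eventually_elim
        case (elim \<omega>)
        note f = Z.Z_cadlag[OF elim(2)]
        show ?case
        proof (cases "?Z \<omega> 0 = 0")
          case False
          then have "0 < ?Z \<omega> 0" using cadlag_nonneg[OF f, of 0] by simp
          then show ?thesis using elim(1) Z.finite_mass_rescale_iff[OF f, of "?Z \<omega> 0"] by (simp add: g_def indicator_def)
        qed (use elim(1) in \<open>simp add: g_def\<close>)
      qed
      have "(\<lambda>\<omega>. Z \<omega> 0 * indicator ?F (\<lambda>t. Z \<omega> t / Z \<omega> 0)) \<in> borel_measurable M"
        by (rule C.measurable_cong_AE_complete[OF ae mg]) simp
      then show ?thesis unfolding \<theta>_def using mg ae by (rule integral_cong_AE)
    qed
    finally show ?thesis .
  qed
  have Vf: "cadlag_field M V" using V by (simp add: is_V_def Let_def)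
  let ?V = "\<lambda>\<omega>. cadlag_part (V \<omega>)"
  note mV = C.measurable_cadlag_part(1)[OF Vf] and ae_V = C.measurable_cadlag_part(2)[OF Vf]
  define b where "b = \<theta> / q"
  have b: "0 < b" using q0 \<theta> by (simp add: b_def)
  have mZb: "(\<lambda>\<omega> t. ?Z \<omega> t / b) \<in> M \<rightarrow>\<^sub>M cadlag_algebra"
    using measurable_translated_rescaled[OF mZ, of "\<lambda>_. 0" "\<lambda>_. b"] b by simp
  have V_law: "\<P>(\<omega> in M. ?V \<omega> \<in> A) = \<P>(\<omega> in M. (\<lambda>t. ?Z \<omega> t / b) \<in> A \<inter> ?F) / q"
    if A: "A \<in> sets cadlag_algebra" for A
  proof -
    have "\<P>(\<omega> in M. ?V \<omega> \<in> A) = \<P>(\<omega> in M. V \<omega> \<in> A)"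
      using ae_V by (intro C.measure_cong_AE_complete, eventually_elim) simp
    also have "\<dots> = \<P>(\<omega> in M. (\<lambda>t. q / \<theta> * Z \<omega> t) \<in> A \<bar> total_mass 0 (Z \<omega>) < \<infinity>)"
      using V A unfolding is_V_def Let_def mean_F q_def[symmetric] by blast
    also have "\<dots> = \<P>(\<omega> in M. (\<lambda>t. q / \<theta> * Z \<omega> t) \<in> A \<and> total_mass 0 (Z \<omega>) < \<infinity>) / q"
      by (simp add: cond_prob_def q_def)
    also have "\<P>(\<omega> in M. (\<lambda>t. q / \<theta> * Z \<omega> t) \<in> A \<and> total_mass 0 (Z \<omega>) < \<infinity>) = \<P>(\<omega> in M. (\<lambda>t. ?Z \<omega> t / b) \<in> A \<inter> ?F)"
    proof (rule C.measure_cong_AE_complete)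
      show "AE \<omega> in M. ((\<lambda>t. q / \<theta> * Z \<omega> t) \<in> A \<and> total_mass 0 (Z \<omega>) < \<infinity>) = ((\<lambda>t. ?Z \<omega> t / b) \<in> A \<inter> ?F)"
        using ae_Z F_iff AE_space
      proof eventually_elim
        case (elim \<omega>)
        have "(\<lambda>t. q / \<theta> * Z \<omega> t) = (\<lambda>t. ?Z \<omega> t / b)" by (simp add: elim(1) b_def mult.commute)
        then show ?case using elim(2) Z.finite_mass_rescale_iff[OF Z.Z_cadlag[OF elim(3)] b] by simp
      qed
    qed
    finally show ?thesis .
  qed
  have exp_V: "emeasure (exponent_measure M ?V) A = ennreal (1 / \<theta>) * emeasure Z.\<nu> (A \<inter> ?F)"
    if A: "A \<in> sets cadlag_algebra" for A
  proof -
    have AF: "A \<inter> ?F \<in> sets cadlag_algebra" using A sets_finite_mass by (rule sets.Int)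
    have "emeasure (exponent_measure M ?V) A = (\<integral>\<^sup>+s\<in>{0<..}. emeasure M {\<omega>\<in>space M. (\<lambda>t. ?V \<omega> t / s) \<in> A} \<partial>lborel)"
      by (rule emeasure_exponent_measure[OF M.sigma_finite_measure_axioms mV A])
    also have "\<dots> = (\<integral>\<^sup>+s. ennreal (1 / q) * (emeasure M {\<omega>\<in>space M. (\<lambda>t. ?Z \<omega> t / b / s) \<in> A \<inter> ?F} * indicator {0<..} s) \<partial>lborel)"
    proof (rule nn_integral_cong)
      fix s :: real
      have "emeasure M {\<omega>\<in>space M. (\<lambda>t. ?V \<omega> t / s) \<in> A} = ennreal (1 / q) * emeasure M {\<omega>\<in>space M. (\<lambda>t. ?Z \<omega> t / b / s) \<in> A \<inter> ?F}"
        if s: "0 < s"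
      proof -
        have md: "(\<lambda>f t. f t / s) \<in> cadlag_algebra \<rightarrow>\<^sub>M (cadlag_algebra :: (real ^ 'd \<Rightarrow> real) measure)"
          using measurable_translated_rescaled[where q = "\<lambda>f. f" and N = "cadlag_algebra :: (real ^ 'd \<Rightarrow> real) measure"
              and \<tau> = "\<lambda>_. 0" and c = "\<lambda>_. s"] s by simp
        let ?A = "{f\<in>cadlag. (\<lambda>t. f t / s) \<in> A}"
        have sA: "?A \<in> sets cadlag_algebra"
          using measurable_sets[OF md A] by (simp add: vimage_def Int_def conj_commute)
        have "{\<omega>\<in>space M. (\<lambda>t. ?V \<omega> t / s) \<in> A} = {\<omega>\<in>space M. ?V \<omega> \<in> ?A}"
          using measurable_space[OF mV] by auto
        then have "emeasure M {\<omega>\<in>space M. (\<lambda>t. ?V \<omega> t / s) \<in> A} = ennreal (\<P>(\<omega> in M. (\<lambda>t. ?Z \<omega> t / b) \<in> ?A \<inter> ?F) / q)"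
          using V_law[OF sA] by (simp add: M.emeasure_eq_measure)
        also have "{\<omega>\<in>space M. (\<lambda>t. ?Z \<omega> t / b) \<in> ?A \<inter> ?F} = {\<omega>\<in>space M. (\<lambda>t. ?Z \<omega> t / b / s) \<in> A \<inter> ?F}"
        proof (intro Collect_cong conj_cong refl)
          fix \<omega> assume "\<omega> \<in> space M"
          then have f: "(\<lambda>t. ?Z \<omega> t / b) \<in> cadlag" using measurable_space[OF mZb] by simp
          show "((\<lambda>t. ?Z \<omega> t / b) \<in> ?A \<inter> ?F) = ((\<lambda>t. ?Z \<omega> t / b / s) \<in> A \<inter> ?F)"
            using Z.finite_mass_rescale_iff[OF f s] f by simp
        qed
        finally show ?thesis using q0 by (simp add: M.emeasure_eq_measure ennreal_mult'[symmetric])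
      qed
      then show "emeasure M {\<omega>\<in>space M. (\<lambda>t. ?V \<omega> t / s) \<in> A} * indicator {0<..} s
          = ennreal (1 / q) * (emeasure M {\<omega>\<in>space M. (\<lambda>t. ?Z \<omega> t / b / s) \<in> A \<inter> ?F} * indicator {0<..} s)"
        by (cases "0 < s") simp_all
    qed
    also have "\<dots> = ennreal (1 / q) * (\<integral>\<^sup>+s\<in>{0<..}. emeasure M {\<omega>\<in>space M. (\<lambda>t. ?Z \<omega> t / b / s) \<in> A \<inter> ?F} \<partial>lborel)"
    proof (rule nn_integral_cmult)
      let ?g = "\<lambda>s. \<integral>\<^sup>+\<omega>. indicator (A \<inter> ?F) (\<lambda>t. ?Z \<omega> t / b / s) \<partial>M"
      have "?g \<in> borel_measurable scales"
        using M.borel_measurable_nn_integral_fst[OF measurable_compose[OF measurable_rescaled_field[OF mZb] borel_measurable_indicator[OF AF]]]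
        by simp
      then have "(\<lambda>s. ?g s * indicator {0<..} s) \<in> borel_measurable borel" by (rule measurable_scales_indicator)
      moreover have "?g s * indicator {0<..} s = emeasure M {\<omega>\<in>space M. (\<lambda>t. ?Z \<omega> t / b / s) \<in> A \<inter> ?F} * indicator {0<..} s" for s
      proof (cases "0 < s")
        case True
        have "(\<lambda>\<omega> t. ?Z \<omega> t / b / s) \<in> M \<rightarrow>\<^sub>M cadlag_algebra"
          using measurable_translated_rescaled[OF mZb, of "\<lambda>_. 0" "\<lambda>_. s"] True by simp
        from measurable_sets[OF this AF]
        have "{\<omega>\<in>space M. (\<lambda>t. ?Z \<omega> t / b / s) \<in> A \<inter> ?F} \<in> sets M" by (simp add: vimage_def Int_def conj_ac)
        then have "emeasure M {\<omega>\<in>space M. (\<lambda>t. ?Z \<omega> t / b / s) \<in> A \<inter> ?F}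
            = (\<integral>\<^sup>+\<omega>. indicator {\<omega>\<in>space M. (\<lambda>t. ?Z \<omega> t / b / s) \<in> A \<inter> ?F} \<omega> \<partial>M)"
          by (rule nn_integral_indicator[symmetric])
        also have "\<dots> = ?g s" by (intro nn_integral_cong) (simp add: indicator_def)
        finally show ?thesis by (simp only:)
      qed simp
      ultimately show "(\<lambda>s. emeasure M {\<omega>\<in>space M. (\<lambda>t. ?Z \<omega> t / b / s) \<in> A \<inter> ?F} * indicator {0<..} s) \<in> borel_measurable lborel"
        by simp
    qed
    also have "(\<integral>\<^sup>+s\<in>{0<..}. emeasure M {\<omega>\<in>space M. (\<lambda>t. ?Z \<omega> t / b / s) \<in> A \<inter> ?F} \<partial>lborel)
        = emeasure (exponent_measure M (\<lambda>\<omega> t. ?Z \<omega> t / b)) (A \<inter> ?F)"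
      by (rule emeasure_exponent_measure[symmetric, OF M.sigma_finite_measure_axioms mZb AF])
    also have "\<dots> = ennreal (1 / b) * emeasure Z.\<nu> (A \<inter> ?F)"
      by (rule emeasure_exponent_measure_rescale[OF assms(1) mZ b AF])
    also have "ennreal (1 / q) * (ennreal (1 / b) * emeasure Z.\<nu> (A \<inter> ?F)) = ennreal (1 / \<theta>) * emeasure Z.\<nu> (A \<inter> ?F)"
      using q0 \<theta> by (simp add: mult.assoc[symmetric] ennreal_mult'[symmetric] b_def)
    finally show ?thesis .
  qed
  let ?E = "\<lambda>T. exceed_event \<delta> x (cube T) :: (real ^ 'd \<Rightarrow> real) set"
  note mean = berman_mean_eq[OF assms(1,2) \<delta>]
  obtain l where l: "l < \<infinity>"
    "((\<lambda>T. emeasure Z.\<nu> (?E T \<inter> ?F) / ennreal (T ^ CARD('d))) \<longlongrightarrow> l) at_top"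
    "((\<lambda>T. emeasure Z.\<nu> (?E T) / ennreal (T ^ CARD('d))) \<longlongrightarrow> l) at_top"
    by (rule Z.exceed_limit[of x])
  have one: "ennreal \<theta> * (ennreal (1 / \<theta>) * l) = l"
    using \<theta> by (simp add: mult.assoc[symmetric] ennreal_mult'[symmetric])
  show ?thesis
  proof (rule that[of "ennreal (1 / \<theta>) * l"])
    have "((\<lambda>T. ennreal (1 / \<theta>) * (emeasure Z.\<nu> (?E T \<inter> ?F) / ennreal (T ^ CARD('d)))) \<longlongrightarrow> ennreal (1 / \<theta>) * l) at_top"
      by (intro tendsto_mult_ennreal tendsto_const l(2)) (use l(1) in auto)
    then show "(berman_mean M V \<delta> x \<longlongrightarrow> ennreal (1 / \<theta>) * l) at_top"
      unfolding mean[OF Vf, abs_def] exp_V[OF sets_exceed_event[OF \<delta> sets_cube]] by (simp add: ennreal_times_divide)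
    show "(berman_mean M Z \<delta> x \<longlongrightarrow> ennreal (\<P>(\<omega> in M. total_mass 0 (\<Theta> \<omega>) < \<infinity>)) * (ennreal (1 / \<theta>) * l)) at_top"
      unfolding Theta one mean[OF Zc, abs_def] by (rule l(3))
    show "ennreal (\<P>(\<omega> in M. total_mass 0 (\<Theta> \<omega>) < \<infinity>)) * (ennreal (1 / \<theta>) * l) < \<infinity>"
      unfolding Theta one by (rule l(1))
  qed
qed

lemma spectral_field_cadlag_part:
  fixes Z :: "'w \<Rightarrow> real ^ 'd::finite \<Rightarrow> real"
  assumes "prob_space M" "complete_measure M" and Z: "cadlag_field M Z"
    and mean: "\<And>t. (\<integral>\<omega>. Z \<omega> t \<partial>M) = 1"
    and sup: "\<And>T. T > 0 \<Longrightarrow> (\<integral>\<^sup>+\<omega>. (SUP t\<in>cube T. ennreal (Z \<omega> t)) \<partial>M) < \<infinity>"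
    and st: "stationary (max_stable_space M) (max_stable_field Z)" and \<delta>: "0 \<le> \<delta>"
  shows "spectral_field M (\<lambda>\<omega>. cadlag_part (Z \<omega>)) \<delta>"
proof -
  interpret M: prob_space M by fact
  interpret C: complete_measure M by fact
  let ?Z = "\<lambda>\<omega>. cadlag_part (Z \<omega>)"
  note mZ = C.measurable_cadlag_part(1)[OF Z] and ae_Z = C.measurable_cadlag_part(2)[OF Z]
  have rf: "random_field M UNIV Z" using Z by (simp add: cadlag_field_def)
  have law: "field_law (max_stable_space M) UNIV (max_stable_field (\<lambda>\<omega> t. ?Z \<omega> (t - h)))
      = field_law (max_stable_space M) UNIV (max_stable_field (\<lambda>\<omega> t. Z \<omega> (t - h)))" for h
  proof (rule field_law_cong_AE[OF assms(1)])
    show "random_field M UNIV (\<lambda>\<omega> t. ?Z \<omega> (t - h))" by (simp add: random_field_def measurable_cadlag_apply[OF mZ])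
    show "random_field M UNIV (\<lambda>\<omega> t. Z \<omega> (t - h))" using rf by (simp add: random_field_def)
    show "AE \<omega> in M. \<forall>t\<in>UNIV. ?Z \<omega> (t - h) = Z \<omega> (t - h)" using ae_Z by eventually_elim simp
  qed
  have shift: "(\<lambda>w t. max_stable_field U w (t - h)) = max_stable_field (\<lambda>\<omega> t. U \<omega> (t - h))"
    for U :: "'w \<Rightarrow> real ^ 'd \<Rightarrow> real" and h
    by (simp add: max_stable_field_def fun_eq_iff)
  have st': "stationary (max_stable_space M) (max_stable_field ?Z)"
    using st law law[of 0] unfolding stationary_def shift by simp
  show ?thesis
  proof (unfold_locales)
    show "?Z \<in> M \<rightarrow>\<^sub>M cadlag_algebra" by (rule mZ)
    show "stationary (max_stable_space M) (max_stable_field ?Z)" by (rule st')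
    show "(\<integral>\<^sup>+\<omega>. ennreal (?Z \<omega> t) \<partial>M) = 1" for t
    proof -
      have int: "integrable M (\<lambda>\<omega>. Z \<omega> t)" using mean[of t] not_integrable_integral_eq by fastforce
      have "(\<integral>\<^sup>+\<omega>. ennreal (?Z \<omega> t) \<partial>M) = (\<integral>\<^sup>+\<omega>. ennreal (Z \<omega> t) \<partial>M)"
        using ae_Z by (intro nn_integral_cong_AE, eventually_elim) simp
      also have "\<dots> = ennreal (\<integral>\<omega>. Z \<omega> t \<partial>M)"
      proof (rule nn_integral_eq_integral[OF int])
        have "AE \<omega> in M. Z \<omega> \<in> cadlag" using Z by (simp add: cadlag_field_def)
        then show "AE \<omega> in M. 0 \<le> Z \<omega> t" by eventually_elim (rule cadlag_nonneg)
      qed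
      finally show ?thesis by (simp add: mean)
    qed
    show "(\<integral>\<^sup>+\<omega>. (SUP t\<in>cube T. ennreal (?Z \<omega> t)) \<partial>M) < \<infinity>" if "T > 0" for T
    proof -
      have "(\<integral>\<^sup>+\<omega>. (SUP t\<in>cube T. ennreal (?Z \<omega> t)) \<partial>M) = (\<integral>\<^sup>+\<omega>. (SUP t\<in>cube T. ennreal (Z \<omega> t)) \<partial>M)"
        using ae_Z by (intro nn_integral_cong_AE, eventually_elim) simp
      then show ?thesis using sup[OF that] by (simp only:)
    qed
  qed (rule \<delta>)
qed

theorem lemma2p4:
  fixes M :: "'w measure"
    and Z :: "'w \<Rightarrow> real ^ 'd::finite \<Rightarrow> real"
    and \<delta> x :: real
  assumes "prob_space M" and "complete_measure M" and "nonatomic M"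
    and "cadlag_field M Z"
    and "\<And>t. (\<integral>\<omega>. Z \<omega> t \<partial>M) = 1"
    and "\<And>T. T > 0 \<Longrightarrow> (\<integral>\<^sup>+\<omega>. (SUP t\<in>cube T. ennreal (Z \<omega> t)) \<partial>M) < \<infinity>"
    and "\<P>(\<omega> in M. (SUP t. ennreal (Z \<omega> t)) > 0) = 1"
    and "stationary (max_stable_space M) (max_stable_field Z)"
    and "\<delta> \<ge> 0" and "x \<ge> 0"
    and "AE \<omega> in M. total_mass \<delta> (Z \<omega>) > 0"
  shows
    "(\<P>(\<omega> in M. total_mass 0 (Z \<omega>) < \<infinity>) = 1 \<longrightarrow>
        (\<forall>Q. is_Q M Z \<delta> Q \<longrightarrow>
           berman_exists M Z \<delta> x \<and>
           berman M Z \<delta> x =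
             (\<integral>\<^sup>+s\<in>{0..}. ennreal (\<P>(\<omega> in M. excursion \<delta> UNIV (Q \<omega>) s > ennreal x)) \<partial>lborel) \<and>
           berman M Z \<delta> x < \<infinity>)) \<and>
     (\<P>(\<omega> in M. total_mass 0 (Z \<omega>) < \<infinity>) > 0 \<longrightarrow>
        (\<forall>\<Theta> V. is_Theta M Z \<Theta> \<longrightarrow> is_V M Z V \<longrightarrow>
           berman_exists M Z \<delta> x \<and> berman_exists M V \<delta> x \<and>
           berman M Z \<delta> x = ennreal (\<P>(\<omega> in M. total_mass 0 (\<Theta> \<omega>) < \<infinity>)) * berman M V \<delta> x \<and>
           berman M Z \<delta> x < \<infinity>))"
proof -
  interpret prob_space M by fact
  have Z: "spectral_field M (\<lambda>\<omega>. cadlag_part (Z \<omega>)) \<delta>"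
    by (rule spectral_field_cadlag_part[OF assms(1,2,4,5,6,8,9)])
  have limit: "berman_exists M Y \<delta> x \<and> berman M Y \<delta> x = l" if "(berman_mean M Y \<delta> x \<longlongrightarrow> l) at_top"
    for Y :: "'w \<Rightarrow> real ^ 'd \<Rightarrow> real" and l
    using tendsto_Lim[OF _ that] that by (simp add: berman_exists_def berman_def)
  have nz: "AE \<omega> in M. Z \<omega> \<noteq> (\<lambda>_. 0)"
    using AE_prob_1[OF assms(7)] by eventually_elim auto
  show ?thesis
  proof (intro conjI impI allI)
    fix Q assume Q: "is_Q M Z \<delta> Q"
    note lim = dissipative_limit[OF assms(1,2) Z assms(4) Q, of x]
    show "berman_exists M Z \<delta> x"
      "berman M Z \<delta> x = (\<integral>\<^sup>+s\<in>{0..}. ennreal (\<P>(\<omega> in M. excursion \<delta> UNIV (Q \<omega>) s > ennreal x)) \<partial>lborel)"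
      "berman M Z \<delta> x < \<infinity>"
      using limit[OF lim(1)] lim(2) by simp_all
  next
    fix \<Theta> V assume P: "\<P>(\<omega> in M. total_mass 0 (Z \<omega>) < \<infinity>) > 0" and \<Theta>: "is_Theta M Z \<Theta>" and V: "is_V M Z V"
    obtain b where b: "(berman_mean M V \<delta> x \<longlongrightarrow> b) at_top"
        "(berman_mean M Z \<delta> x \<longlongrightarrow> ennreal (\<P>(\<omega> in M. total_mass 0 (\<Theta> \<omega>) < \<infinity>)) * b) at_top"
        "ennreal (\<P>(\<omega> in M. total_mass 0 (\<Theta> \<omega>) < \<infinity>)) * b < \<infinity>"
      by (rule conditioned_limit[OF assms(1,2) Z assms(4) nz P \<Theta> V])
    from limit[OF b(1)] limit[OF b(2)] b(3)
    show "berman_exists M Z \<delta> x" "berman_exists M V \<delta> x"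
      "berman M Z \<delta> x = ennreal (\<P>(\<omega> in M. total_mass 0 (\<Theta> \<omega>) < \<infinity>)) * berman M V \<delta> x"
      "berman M Z \<delta> x < \<infinity>"
      by simp_all
  qed
qed

end
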